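(* There is an efficiently recognizable class of graphs $\mathcal{C}$ such that, with $n$ denoting the order of a graph $G$: (i) $\mathrm{D}(G)\le (n+5)/2$ with the exception of all graphs in $\mathcal{C}$; (ii) if $G\in\mathcal{C}$, then the exact value of $\mathrm{D}(G)$ is efficiently computable. Moreover, every graph $G$ admits a defining formula whose alternation number is $1$ and whose quantifier rank is as small as possible (that is, equal to $\mathrm{D}(G)$) if $G\in\mathcal{C}$ and does not exceed $(n+5)/2$ if $G\notin\mathcal{C}$.
   Context: Graphs are finite, undirected and loopless; a graph is regarded as a structure with a single irreflexive symmetric binary predicate $E$ (adjacency). First order formulas use $E$, $=$ and the connectives $\neg,\wedge,\vee$; quantifiers range over vertices. A closed formula $\Phi$ distinguishes $G$ from $G'$ if it is true on $G$ and false on $G'$. It defines $G$ if it distinguishes $G$ from every (finite) structure $G'$ with a single binary relation that is not isomorphic to $G$ (of any order; equivalently for the parameters below, one may let $G'$ range over graphs only). The set $\mathrm{Nest}(\Phi)$ of sequences of nested quantifiers is defined inductively: $\mathrm{Nest}(\Phi)=\{\epsilon\}$ (the empty word) for atomic $\Phi$; $\mathrm{Nest}(\neg\Phi)$ is obtained from $\mathrm{Nest}(\Phi)$ by exchanging $\exists$ and $\forall$ in all words; $\mathrm{Nest}(\Phi\wedge\Psi)=\mathrm{Nest}(\Phi\vee\Psi)=\mathrm{Nest}(\Phi)\cup\mathrm{Nest}(\Psi)$; $\mathrm{Nest}(\exists x\Phi)$ and $\mathrm{Nest}(\forall x\Phi)$ are obtained by prepending $\exists$, respectively $\forall$, to every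 word of $\mathrm{Nest}(\Phi)$. The quantifier rank of $\Phi$ is the maximum length of a word in $\mathrm{Nest}(\Phi)$; the alternation number of $\Phi$ is the maximum, over words in $\mathrm{Nest}(\Phi)$, of the number of occurrences of $\exists\forall$ and $\forall\exists$ as consecutive letters. $\mathrm{D}(G)$ is the minimum quantifier rank of a formula defining $G$. "Efficient" (recognition, computation) means in time $O(n^2\log n)$ on a random access machine, where the input graph of order $n$ is given by its adjacency matrix. *)

theory Defs
  imports
    "Graph_Theory.Pair_Digraph"
    "Graph_Theory.Digraph_Isomorphism"
    "HOL-Library.Landau_Symbols"
begin

section \<open>Graphs and finite binary structures\<close>

text \<open>
  A finite structure with a single binary relation is a finite digraph without parallel arcs,
  loops allowed. As usual in first order logic, universes are non-empty. Every finite structure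
  is isomorphic to one whose elements are natural numbers, so type \<^typ>\<open>nat\<close> is a
  sufficient supply of vertices. The locale \<^locale>\<open>pair_graph\<close> adds symmetry and
  irreflexivity.
\<close>

type_synonym binstruct = "nat pair_pre_digraph"

definition structures :: "binstruct set" where
  "structures = {G. pair_fin_digraph G \<and> pverts G \<noteq> {}}"

definition graphs :: "binstruct set" where
  "graphs = {G. pair_graph G \<and> pverts G \<noteq> {}}"

definition isomorphic :: "binstruct \<Rightarrow> binstruct \<Rightarrow> bool" where
  "isomorphic G H \<longleftrightarrow> digraph_iso (with_proj G) (with_proj H)"

abbreviation order :: "binstruct \<Rightarrow> nat" where
  "order G \<equiv> card (pverts G)"


section \<open>First order formulas\<close>

datatype fm =
    Equal nat nat
  | Adj nat nat
  | Neg fm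
  | Conj fm fm
  | Disj fm fm
  | Exists nat fm
  | Forall nat fm

fun free_vars :: "fm \<Rightarrow> nat set" where
  "free_vars (Equal x y) = {x, y}"
| "free_vars (Adj x y) = {x, y}"
| "free_vars (Neg \<phi>) = free_vars \<phi>"
| "free_vars (Conj \<phi> \<psi>) = free_vars \<phi> \<union> free_vars \<psi>"
| "free_vars (Disj \<phi> \<psi>) = free_vars \<phi> \<union> free_vars \<psi>"
| "free_vars (Exists x \<phi>) = free_vars \<phi> - {x}"
| "free_vars (Forall x \<phi>) = free_vars \<phi> - {x}"

definition closed_fm :: "fm \<Rightarrow> bool" where
  "closed_fm \<phi> \<longleftrightarrow> free_vars \<phi> = {}"

fun sat :: "binstruct \<Rightarrow> (nat \<Rightarrow> nat) \<Rightarrow> fm \<Rightarrow> bool" where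
  "sat G a (Equal x y) \<longleftrightarrow> a x = a y"
| "sat G a (Adj x y) \<longleftrightarrow> (a x, a y) \<in> parcs G"
| "sat G a (Neg \<phi>) \<longleftrightarrow> \<not> sat G a \<phi>"
| "sat G a (Conj \<phi> \<psi>) \<longleftrightarrow> sat G a \<phi> \<and> sat G a \<psi>"
| "sat G a (Disj \<phi> \<psi>) \<longleftrightarrow> sat G a \<phi> \<or> sat G a \<psi>"
| "sat G a (Exists x \<phi>) \<longleftrightarrow> (\<exists>v\<in>pverts G. sat G (a(x := v)) \<phi>)"
| "sat G a (Forall x \<phi>) \<longleftrightarrow> (\<forall>v\<in>pverts G. sat G (a(x := v)) \<phi>)"

text \<open>For closed formulas the assignment is irrelevant.\<close>

definition true_on :: "fm \<Rightarrow> binstruct \<Rightarrow> bool" where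
  "true_on \<phi> G \<longleftrightarrow> (\<forall>a. range a \<subseteq> pverts G \<longrightarrow> sat G a \<phi>)"

definition distinguishes :: "fm \<Rightarrow> binstruct \<Rightarrow> binstruct \<Rightarrow> bool" where
  "distinguishes \<phi> G G' \<longleftrightarrow> true_on \<phi> G \<and> \<not> true_on \<phi> G'"

definition defines_struct :: "fm \<Rightarrow> binstruct \<Rightarrow> bool" where
  "defines_struct \<phi> G \<longleftrightarrow>
     closed_fm \<phi> \<and> (\<forall>G'\<in>structures. \<not> isomorphic G G' \<longrightarrow> distinguishes \<phi> G G')"

datatype quant = QE | QA

fun dual :: "quant \<Rightarrow> quant" where
  "dual QE = QA"
| "dual QA = QE"

fun nest :: "fm \<Rightarrow> quant list set" where
  "nest (Equal x y) = {[]}"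
| "nest (Adj x y) = {[]}"
| "nest (Neg \<phi>) = map dual ` nest \<phi>"
| "nest (Conj \<phi> \<psi>) = nest \<phi> \<union> nest \<psi>"
| "nest (Disj \<phi> \<psi>) = nest \<phi> \<union> nest \<psi>"
| "nest (Exists x \<phi>) = (#) QE ` nest \<phi>"
| "nest (Forall x \<phi>) = (#) QA ` nest \<phi>"

definition quantifier_rank :: "fm \<Rightarrow> nat" where
  "quantifier_rank \<phi> = Max (length ` nest \<phi>)"

definition alternations :: "quant list \<Rightarrow> nat" where
  "alternations w = card {i. Suc i < length w \<and> w ! i \<noteq> w ! Suc i}"

definition alternation_number :: "fm \<Rightarrow> nat" where
  "alternation_number \<phi> = Max (alternations ` nest \<phi>)"

definition D :: "binstruct \<Rightarrow> nat" where
  "D G = (LEAST k. \<exists>\<phi>. defines_struct \<phi> G \<and> quantifier_rank \<phi> = k)"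


section \<open>Random access machines\<close>

text \<open>
  A unit-cost load-store random access machine. Registers are addressed by constants in the
  program, memory cells indirectly by register contents. All cells hold natural numbers;
  subtraction is truncated. The machine halts when the program counter leaves the program.
\<close>

datatype instr =
    LoadConst nat nat    \<comment> \<open>\<open>LoadConst i c\<close>: \<open>R\<^sub>i := c\<close>\<close>
  | AddReg nat nat nat   \<comment> \<open>\<open>AddReg i j k\<close>: \<open>R\<^sub>i := R\<^sub>j + R\<^sub>k\<close>\<close>
  | SubReg nat nat nat   \<comment> \<open>\<open>SubReg i j k\<close>: \<open>R\<^sub>i := R\<^sub>j - R\<^sub>k\<close>\<close>
  | Load nat nat         \<comment> \<open>\<open>Load i j\<close>: \<open>R\<^sub>i := M[R\<^sub>j]\<close>\<close>
  | Store nat nat        \<comment> \<open>\<open>Store i j\<close>: \<open>M[R\<^sub>i] := R\<^sub>j\<close>\<close>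
  | JumpZero nat nat     \<comment> \<open>\<open>JumpZero i l\<close>: go to \<open>l\<close> if \<open>R\<^sub>i = 0\<close>\<close>

type_synonym program = "instr list"

record ram_state =
  pc :: nat
  reg :: "nat \<Rightarrow> nat"
  mem :: "nat \<Rightarrow> nat"

fun exec_instr :: "instr \<Rightarrow> ram_state \<Rightarrow> ram_state" where
  "exec_instr (LoadConst i c) s =
     s\<lparr>pc := pc s + 1, reg := (reg s)(i := c)\<rparr>"
| "exec_instr (AddReg i j k) s =
     s\<lparr>pc := pc s + 1, reg := (reg s)(i := reg s j + reg s k)\<rparr>"
| "exec_instr (SubReg i j k) s =
     s\<lparr>pc := pc s + 1, reg := (reg s)(i := reg s j - reg s k)\<rparr>"
| "exec_instr (Load i j) s =
     s\<lparr>pc := pc s + 1, reg := (reg s)(i := mem s (reg s j))\<rparr>"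
| "exec_instr (Store i j) s =
     s\<lparr>pc := pc s + 1, mem := (mem s)(reg s i := reg s j)\<rparr>"
| "exec_instr (JumpZero i l) s =
     s\<lparr>pc := (if reg s i = 0 then l else pc s + 1)\<rparr>"

definition halted :: "program \<Rightarrow> ram_state \<Rightarrow> bool" where
  "halted p s \<longleftrightarrow> length p \<le> pc s"

definition step :: "program \<Rightarrow> ram_state \<Rightarrow> ram_state" where
  "step p s = (if halted p s then s else exec_instr (p ! pc s) s)"

definition run :: "program \<Rightarrow> nat \<Rightarrow> ram_state \<Rightarrow> ram_state" where
  "run p k = step p ^^ k"

text \<open>
  Input: the adjacency matrix of \<open>G\<close> with respect to an enumeration
  \<open>v 0, \<dots>, v (n - 1)\<close> of its vertices, stored row by row in \<open>M[0], \<dots>, M[n\<^sup>2 - 1]\<close>,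
  and the order \<open>n\<close> of \<open>G\<close> in \<open>R\<^sub>0\<close>. All other cells are 0.
\<close>

definition input_state :: "binstruct \<Rightarrow> (nat \<Rightarrow> nat) \<Rightarrow> ram_state" where
  "input_state G v = (let n = order G in
     \<lparr> pc = 0,
       reg = (\<lambda>i. if i = 0 then n else 0),
       mem = (\<lambda>a. if a < n * n \<and> (v (a div n), v (a mod n)) \<in> parcs G then 1 else 0) \<rparr>)"

text \<open>
  Time \<open>O(n\<^sup>2 log n)\<close> with correctness on every input graph in \<open>K\<close>, however its vertices are
  enumerated; the result is returned in \<open>R\<^sub>0\<close>. As usual for the unit-cost measure, all
  numbers occurring in a computation have \<open>O(log n)\<close> bits, which rules out packing long
  bit strings into a single cell. The asymptotic conditions on \<open>t\<close> and \<open>w\<close> concern large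
  \<open>n\<close> only (note \<open>ln 1 = 0\<close>), the remaining ones all \<open>n\<close>.
\<close>

definition efficiently_computable_on ::
    "binstruct set \<Rightarrow> (binstruct \<Rightarrow> nat) \<Rightarrow> bool" where
  "efficiently_computable_on K f \<longleftrightarrow>
     (\<exists>(p :: program) (t :: nat \<Rightarrow> nat) (w :: nat \<Rightarrow> nat).
        (\<lambda>n. real (t n)) \<in> O(\<lambda>n. real n ^ 2 * ln (real n)) \<and>
        (\<lambda>n. real (w n)) \<in> O(\<lambda>n. ln (real n)) \<and>
        (\<forall>G\<in>K. \<forall>v. bij_betw v {..<order G} (pverts G) \<longrightarrow>
           (let n = order G; s = input_state G v in
              halted p (run p (t n) s) \<and>
              reg (run p (t n) s) 0 = f G \<and>
              (\<forall>k i. reg (run p k s) i < 2 ^ w n \<and> mem (run p k s) i < 2 ^ w n))))"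

text \<open>
  A recognizable class is automatically closed under isomorphism, since isomorphic graphs
  have the same adjacency matrices.
\<close>

definition efficiently_recognizable :: "binstruct set \<Rightarrow> bool" where
  "efficiently_recognizable C \<longleftrightarrow>
     C \<subseteq> graphs \<and> efficiently_computable_on graphs (\<lambda>G. if G \<in> C then 1 else 0)"

end

theory Submission
  imports Defs "HOL-Real_Asymp.Real_Asymp"
begin

text \<open>
  A graph \<open>G\<close> of order \<open>n\<close> is defined by a sentence of quantifier rank \<open>k\<close> and alternation number 1 as
  soon as Spoiler wins the \<open>k\<close>-round Ehrenfeucht game, switching between the structures at most once,
  against every non-isomorphic structure. Call vertices similar if the transposition of the two is an
  automorphism.

  Spoiler first selects a set \<open>X\<close> of at most \<open>(n - 1) / 2\<close> vertices over which the other vertices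
  realise more than \<open>|X|\<close> types, with \<open>X\<close> as large as possible. By maximality, vertices that are not
  determined by their type fall into homogeneous classes, so two more rounds force \<open>G'\<close> to agree with
  \<open>G\<close> except for the sizes of some sets of similar vertices. If two sizes differ, one of
  these sets is small enough to be counted while \<open>X\<close> stays selected. If one size differs, one graph is
  the other with additional copies of a vertex \<open>v\<close>. Then Spoiler forgets \<open>X\<close>, selects one vertex in each
  similarity class that is larger than the smaller version of the class of \<open>v\<close>, and exhausts a class
  for which Duplicator has answered in too small a class. This takes more than \<open>(n + 5) / 2\<close> rounds
  only if the class \<open>S\<close> of \<open>v\<close> contains more than half of the vertices of \<open>G\<close>. In that case the exact
  rank is \<open>|S| + 1\<close> or \<open>|S| + 2\<close>, as the comparison of \<open>G\<close> with \<open>G\<close> plus one more vertex in \<open>S\<close> shows.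

  Such a dominant class is found in time \<open>O(n\<^sup>2)\<close> by a majority vote among the rows of the adjacency
  matrix, each comparison of two rows taking time \<open>O(n)\<close>.
\<close>


section \<open>Games and defining formulas\<close>

text \<open>The bound (n + 5) / 2 comes out of two unrelated counts. If the sizes of two sets of
  vertices with equal refined type differ, and each has at least \<mu> vertices in \<open>G\<close>,
  then the vertices outside \<open>X\<close> and these two sets number at least |X| - 1, so n \<ge>
  2|X| + 2\<mu> - 1, while Spoiler needs |X| + (\<mu> + 1) + 1 rounds. If one size differs, let s be
  the size of the class of v in the smaller graph and k the number of its classes with more than s
  vertices. Spoiler needs (k + 1) + s + 1 rounds, and n \<ge> s + k (s + 1); comparing the two leads
  to (k - 1) (s - 1) \<ge> 0. This fails only for k = 0, which is why every exception stems from a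
  single huge class. One alternation is enough because Spoiler changes the structure at most once:
  either after selecting \<open>X\<close>, or just before the last round, when a vertex separating
  two answers is shown.\<close>

lemma quantifier_rank_eqI:
  assumes "nest \<phi> \<noteq> {}" "\<And>w. w \<in> nest \<phi> \<Longrightarrow> length w = k"
  shows "quantifier_rank \<phi> = k"
proof -
  have "length ` nest \<phi> = {k}" using assms by auto
  thus ?thesis by (simp add: quantifier_rank_def)
qed

text \<open>These are the partial isomorphisms: \<open>p\<close> is the graph of an injective
  function that preserves and reflects arcs. Taking both pairs equal covers loops.\<close>

definition conforms :: "'a pair_pre_digraph \<Rightarrow> 'b pair_pre_digraph \<Rightarrow> ('a \<times> 'b) set \<Rightarrow> bool" where
  "conforms A B p \<longleftrightarrow> (\<forall>x y x' y'. (x, y) \<in> p \<longrightarrow> (x', y') \<in> p \<longrightarrow>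
     (x = x' \<longleftrightarrow> y = y') \<and> ((x, x') \<in> parcs A \<longleftrightarrow> (y, y') \<in> parcs B))"

text \<open>
  A position of the Ehrenfeucht game is the set of pairs of vertices chosen so far. Duplicator
  \<open>survives\<close> \<open>r\<close> further rounds in which Spoiler moves in \<open>B\<close> only; in \<open>survives_alt\<close> Spoiler
  moves in \<open>A\<close> first and may switch to \<open>B\<close> once, which corresponds to one quantifier alternation.
\<close>

fun survives :: "'a pair_pre_digraph \<Rightarrow> 'b pair_pre_digraph \<Rightarrow> nat \<Rightarrow> ('a \<times> 'b) set \<Rightarrow> bool" where
  "survives A B 0 p \<longleftrightarrow> conforms A B p"
| "survives A B (Suc r) p \<longleftrightarrow> (\<forall>y\<in>pverts B. \<exists>x\<in>pverts A. survives A B r (insert (x, y) p))"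

fun survives_alt :: "'a pair_pre_digraph \<Rightarrow> 'b pair_pre_digraph \<Rightarrow> nat \<Rightarrow> ('a \<times> 'b) set \<Rightarrow> bool" where
  "survives_alt A B 0 p \<longleftrightarrow> conforms A B p"
| "survives_alt A B (Suc r) p \<longleftrightarrow> survives A B (Suc r) p \<and>
     (\<forall>x\<in>pverts A. \<exists>y\<in>pverts B. survives_alt A B r (insert (x, y) p))"

lemma conforms_mono: "conforms A B p \<Longrightarrow> q \<subseteq> p \<Longrightarrow> conforms A B q"
  unfolding conforms_def by (metis subsetD)

lemma conforms_converse: "conforms B A (p\<inverse>) \<longleftrightarrow> conforms A B p"
  unfolding conforms_def converse_iff by metis

lemma conformsD:
  assumes "conforms A B p" "(x, y) \<in> p" "(x', y') \<in> p"
  shows "x = x' \<longleftrightarrow> y = y'" "(x, x') \<in> parcs A \<longleftrightarrow> (y, y') \<in> parcs B"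
  using assms[unfolded conforms_def] by metis+

lemma survives_mono: "survives A B r p \<Longrightarrow> q \<subseteq> p \<Longrightarrow> survives A B r q"
proof (induction r arbitrary: p q)
  case 0 thus ?case by (auto intro: conforms_mono)
next
  case (Suc r)
  show ?case unfolding survives.simps
  proof
    fix y assume "y \<in> pverts B"
    then obtain x where x: "x \<in> pverts A" "survives A B r (insert (x, y) p)" using Suc.prems by auto
    have "survives A B r (insert (x, y) q)" using Suc.IH[OF x(2)] Suc.prems(2) by blast
    thus "\<exists>x\<in>pverts A. survives A B r (insert (x, y) q)" using x(1) by blast
  qed
qed

lemma survives_alt_mono: "survives_alt A B r p \<Longrightarrow> q \<subseteq> p \<Longrightarrow> survives_alt A B r q"
proof (induction r arbitrary: p q)
  case 0 thus ?case by (auto intro: conforms_mono)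
next
  case (Suc r)
  have "survives A B (Suc r) q"
    using Suc.prems(1) survives_mono[OF _ Suc.prems(2)] by (metis survives_alt.simps(2))
  moreover have "\<exists>y\<in>pverts B. survives_alt A B r (insert (x, y) q)" if x: "x \<in> pverts A" for x
  proof -
    obtain y where y: "y \<in> pverts B" "survives_alt A B r (insert (x, y) p)" using Suc.prems x by auto
    have "survives_alt A B r (insert (x, y) q)" using Suc.IH[OF y(2)] Suc.prems(2) by blast
    thus ?thesis using y(1) by blast
  qed
  ultimately show ?case by simp
qed

text \<open>Spoiler may waste a round: he moves anywhere in \<open>B\<close>, which needs a vertex
  there, and the new pair is forgotten by monotonicity.\<close>

lemma survives_Suc_imp:
  assumes "survives A B (Suc r) p" "pverts B \<noteq> {}"
  shows "survives A B r p"
  using assms by (metis survives.simps(2) ex_in_conv survives_mono subset_insertI)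

lemma survives_le:
  assumes "survives A B r p" "s \<le> r" "pverts B \<noteq> {}"
  shows "survives A B s p"
  using assms(2,1) by (induction rule: inc_induct) (auto intro: survives_Suc_imp[OF _ assms(3)] simp del: survives.simps)

lemma survives_conforms: "survives A B r p \<Longrightarrow> pverts B \<noteq> {} \<Longrightarrow> conforms A B p"
  using survives_le[of A B r p 0] by simp

lemma survives_alt_Suc_imp:
  assumes "survives_alt A B (Suc r) p" "pverts A \<noteq> {}"
  shows "survives_alt A B r p"
  using assms by (metis survives_alt.simps(2) ex_in_conv survives_alt_mono subset_insertI)

lemma survives_alt_le:
  assumes "survives_alt A B r p" "s \<le> r" "pverts A \<noteq> {}"
  shows "survives_alt A B s p"
  using assms(2,1) by (induction rule: inc_induct) (auto intro: survives_alt_Suc_imp[OF _ assms(3)] simp del: survives_alt.simps)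

lemma survives_alt_imp_survives: "survives_alt A B r p \<Longrightarrow> survives A B r p"
  by (cases r) auto

text \<open>A Spoiler who never switches stays in \<open>A\<close>. Since \<open>survives\<close>
  lets him move in its second argument, structures and pairs are exchanged.\<close>

lemma survives_alt_imp_survives_converse: "survives_alt A B r p \<Longrightarrow> survives B A r (p\<inverse>)"
proof (induction r arbitrary: p)
  case 0 thus ?case by (simp add: conforms_converse)
next
  case (Suc r)
  have "\<exists>y\<in>pverts B. survives B A r (insert (y, x) (p\<inverse>))" if "x \<in> pverts A" for x
  proof -
    obtain y where "y \<in> pverts B" "survives_alt A B r (insert (x, y) p)" using Suc.prems \<open>x \<in> pverts A\<close> by auto
    moreover have "(insert (x, y) p)\<inverse> = insert (y, x) (p\<inverse>)" by auto
    ultimately show ?thesis using Suc.IH by metis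
  qed
  thus ?case by simp
qed

text \<open>Bundles the rounds in which Spoiler selects all of \<open>T\<close>; the answers are
  collected in a function, and \<open>r\<close> rounds remain.\<close>

lemma survives_pick:
  assumes "finite T" "T \<subseteq> pverts B" "survives A B (r + card T) p"
  shows "\<exists>g. g ` T \<subseteq> pverts A \<and> survives A B r (p \<union> (\<lambda>y. (g y, y)) ` T)"
  using assms
proof (induction T arbitrary: p rule: finite_induct)
  case empty thus ?case by auto
next
  case (insert y T)
  then have "survives A B (Suc (r + card T)) p" by (simp del: survives.simps)
  then obtain x where x: "x \<in> pverts A" "survives A B (r + card T) (insert (x, y) p)"
    using insert.prems(1) by auto
  obtain g where g: "g ` T \<subseteq> pverts A" "survives A B r (insert (x, y) p \<union> (\<lambda>y. (g y, y)) ` T)"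
    using insert.IH[OF _ x(2)] insert.prems(1) by auto
  let ?g = "g(y := x)"
  have eq: "(\<lambda>y. (?g y, y)) ` T = (\<lambda>y. (g y, y)) ` T"
    using insert.hyps(2) by (intro image_cong) auto
  have "insert (x, y) p \<union> (\<lambda>y. (g y, y)) ` T = p \<union> (\<lambda>y. (?g y, y)) ` insert y T"
    unfolding image_insert eq by auto
  hence "survives A B r (p \<union> (\<lambda>y. (?g y, y)) ` insert y T)" using g(2) by metis
  moreover have "?g ` insert y T \<subseteq> pverts A" using g(1) x(1) insert.hyps(2) by auto
  ultimately show ?case by blast
qed

lemma survives_alt_pick:
  assumes "finite S" "S \<subseteq> pverts A" "survives_alt A B (r + card S) p"
  shows "\<exists>f. f ` S \<subseteq> pverts B \<and> survives_alt A B r (p \<union> (\<lambda>x. (x, f x)) ` S)"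
  using assms
proof (induction S arbitrary: p rule: finite_induct)
  case empty thus ?case by auto
next
  case (insert x S)
  then have "survives_alt A B (Suc (r + card S)) p" by (simp del: survives_alt.simps)
  then obtain y where y: "y \<in> pverts B" "survives_alt A B (r + card S) (insert (x, y) p)"
    using insert.prems(1) by auto
  obtain f where f: "f ` S \<subseteq> pverts B" "survives_alt A B r (insert (x, y) p \<union> (\<lambda>x. (x, f x)) ` S)"
    using insert.IH[OF _ y(2)] insert.prems(1) by auto
  let ?f = "f(x := y)"
  have eq: "(\<lambda>x. (x, ?f x)) ` S = (\<lambda>x. (x, f x)) ` S"
    using insert.hyps(2) by (intro image_cong) auto
  have "insert (x, y) p \<union> (\<lambda>x. (x, f x)) ` S = p \<union> (\<lambda>x. (x, ?f x)) ` insert x S"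
    unfolding image_insert eq by auto
  hence "survives_alt A B r (p \<union> (\<lambda>x. (x, ?f x)) ` insert x S)" using f(2) by metis
  moreover have "?f ` insert x S \<subseteq> pverts B" using f(1) y(1) insert.hyps(2) by auto
  ultimately show ?case by blast
qed

lemma survives_self: "p \<subseteq> Id \<Longrightarrow> survives A A r p"
proof (induction r arbitrary: p)
  case 0 thus ?case by (auto simp: conforms_def)
next
  case (Suc r) thus ?case by (auto intro!: bexI)
qed

lemma survives_alt_self: "p \<subseteq> Id \<Longrightarrow> survives_alt A A r p"
proof (induction r arbitrary: p)
  case 0 thus ?case by (auto simp: conforms_def)
next
  case (Suc r)
  have "survives A A (Suc r) p" using Suc.prems by (rule survives_self)
  thus ?case using Suc by (auto intro!: bexI)
qed

section \<open>Formulas that express survival in the game\<close>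

fun big_conj :: "fm list \<Rightarrow> fm" where
  "big_conj [] = Equal 0 0"
| "big_conj [\<phi>] = \<phi>"
| "big_conj (\<phi> # \<psi> # \<phi>s) = Conj \<phi> (big_conj (\<psi> # \<phi>s))"

fun big_disj :: "fm list \<Rightarrow> fm" where
  "big_disj [] = Neg (Equal 0 0)"
| "big_disj [\<phi>] = \<phi>"
| "big_disj (\<phi> # \<psi> # \<phi>s) = Disj \<phi> (big_disj (\<psi> # \<phi>s))"

lemma sat_big_conj: "sat G a (big_conj \<phi>s) \<longleftrightarrow> (\<forall>\<phi>\<in>set \<phi>s. sat G a \<phi>)"
  by (induction \<phi>s rule: big_conj.induct) auto

lemma sat_big_disj: "sat G a (big_disj \<phi>s) \<longleftrightarrow> (\<exists>\<phi>\<in>set \<phi>s. sat G a \<phi>)"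
  by (induction \<phi>s rule: big_disj.induct) auto

text \<open>The separate singleton clause of \<open>big_conj\<close> pays off here: the dummy atom
  \<open>Equal 0 0\<close>, with its free variable 0, enters only the empty conjunction, so that
  game formulas can be closed.\<close>

lemma free_vars_big_conj: "\<phi>s \<noteq> [] \<Longrightarrow> free_vars (big_conj \<phi>s) = (\<Union>\<phi>\<in>set \<phi>s. free_vars \<phi>)"
  by (induction \<phi>s rule: big_conj.induct) auto

lemma free_vars_big_disj: "\<phi>s \<noteq> [] \<Longrightarrow> free_vars (big_disj \<phi>s) = (\<Union>\<phi>\<in>set \<phi>s. free_vars \<phi>)"
  by (induction \<phi>s rule: big_disj.induct) auto

lemma nest_big_conj: "\<phi>s \<noteq> [] \<Longrightarrow> nest (big_conj \<phi>s) = (\<Union>\<phi>\<in>set \<phi>s. nest \<phi>)"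
  by (induction \<phi>s rule: big_conj.induct) auto

lemma nest_big_disj: "\<phi>s \<noteq> [] \<Longrightarrow> nest (big_disj \<phi>s) = (\<Union>\<phi>\<in>set \<phi>s. nest \<phi>)"
  by (induction \<phi>s rule: big_disj.induct) auto

definition literal :: "bool \<Rightarrow> fm \<Rightarrow> fm" where
  "literal b \<phi> = (if b then \<phi> else Neg \<phi>)"

lemma sat_literal: "sat G a (literal b \<phi>) \<longleftrightarrow> (b \<longleftrightarrow> sat G a \<phi>)"
  by (simp add: literal_def)

text \<open>Variable \<open>i\<close> stands for the vertex chosen in round \<open>i\<close>, so
  \<open>length as\<close> is always the next fresh variable.\<close>

definition diagram_pair :: "binstruct \<Rightarrow> nat list \<Rightarrow> nat \<times> nat \<Rightarrow> fm" where
  "diagram_pair A as = (\<lambda>(i, j). Conj (literal (as ! i = as ! j) (Equal i j))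
     (literal ((as ! i, as ! j) \<in> parcs A) (Adj i j)))"

definition diagram :: "binstruct \<Rightarrow> nat list \<Rightarrow> fm" where
  "diagram A as = big_conj (map (diagram_pair A as) (List.product [0..<length as] [0..<length as]))"

definition verts_list :: "binstruct \<Rightarrow> nat list" where
  "verts_list A = sorted_list_of_set (pverts A)"

text \<open>Hintikka formulas for the restricted games, evaluated in the structure opposite to
  \<open>A\<close>. A Spoiler move in the evaluated structure becomes a universal quantifier over a
  disjunction of answers in \<open>A\<close>; a move in \<open>A\<close> becomes a conjunction of
  existential quantifiers. The names give the order of the quantifier blocks.\<close>

fun all_fm :: "binstruct \<Rightarrow> nat \<Rightarrow> nat list \<Rightarrow> fm" where
  "all_fm A 0 as = diagram A as"
| "all_fm A (Suc r) as =
     Forall (length as) (big_disj (map (\<lambda>x. all_fm A r (as @ [x])) (verts_list A)))"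

fun ex_fm :: "binstruct \<Rightarrow> nat \<Rightarrow> nat list \<Rightarrow> fm" where
  "ex_fm A 0 as = diagram A as"
| "ex_fm A (Suc r) as =
     big_conj (map (\<lambda>x. Exists (length as) (ex_fm A r (as @ [x]))) (verts_list A))"

fun ex_all_fm :: "binstruct \<Rightarrow> nat \<Rightarrow> nat list \<Rightarrow> fm" where
  "ex_all_fm A 0 as = diagram A as"
| "ex_all_fm A (Suc r) as = Conj (all_fm A (Suc r) as)
     (big_conj (map (\<lambda>x. Exists (length as) (ex_all_fm A r (as @ [x]))) (verts_list A)))"

fun all_ex_fm :: "binstruct \<Rightarrow> nat \<Rightarrow> nat list \<Rightarrow> fm" where
  "all_ex_fm A 0 as = diagram A as"
| "all_ex_fm A (Suc r) as = Conj (ex_fm A (Suc r) as)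
     (Forall (length as) (big_disj (map (\<lambda>x. all_ex_fm A r (as @ [x])) (verts_list A))))"

definition position :: "nat list \<Rightarrow> (nat \<Rightarrow> nat) \<Rightarrow> (nat \<times> nat) set" where
  "position as b = (\<lambda>i. (as ! i, b i)) ` {..<length as}"

lemma position_snoc: "position (as @ [x]) (b(length as := y)) = insert (x, y) (position as b)"
proof -
  have "(\<lambda>i. ((as @ [x]) ! i, (b(length as := y)) i)) ` {..<length as} = (\<lambda>i. (as ! i, b i)) ` {..<length as}"
    by (intro image_cong) (auto simp: nth_append)
  thus ?thesis by (simp add: position_def lessThan_Suc)
qed

lemma position_snoc_converse:
  "(position (as @ [x]) (b(length as := y)))\<inverse> = insert (y, x) ((position as b)\<inverse>)"
  unfolding position_snoc by auto

lemma sat_diagram: "sat B b (diagram A as) \<longleftrightarrow> conforms A B (position as b)"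
proof -
  have "sat B b (diagram A as) \<longleftrightarrow> (\<forall>i<length as. \<forall>j<length as.
      (as ! i = as ! j \<longleftrightarrow> b i = b j) \<and> ((as ! i, as ! j) \<in> parcs A \<longleftrightarrow> (b i, b j) \<in> parcs B))"
    by (force simp: diagram_def sat_big_conj diagram_pair_def sat_literal)
  also have "\<dots> \<longleftrightarrow> conforms A B (position as b)"
  proof -
    have mem: "(x, y) \<in> position as b \<longleftrightarrow> (\<exists>i<length as. x = as ! i \<and> y = b i)" for x y
      by (auto simp: position_def)
    show ?thesis unfolding conforms_def mem by (intro iffI; (elim exE conjE)?; blast)
  qed
  finally show ?thesis .
qed

lemma product_upt_nonempty: "as \<noteq> [] \<Longrightarrow> List.product [0..<length as] [0..<length as] \<noteq> []"
  by (metis length_0_conv length_product length_upt diff_zero mult_eq_0_iff)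

text \<open>The word with \<open>i = 0\<close> comes from the conjunct in which Spoiler has already
  switched; all others arise by prepending \<open>q\<close>.\<close>

lemma replicate_words_Suc:
  "{replicate i q @ replicate (Suc r - i) q' |i. i \<le> Suc r} =
    insert (replicate (Suc r) q') ((#) q ` {replicate i q @ replicate (r - i) q' |i. i \<le> r})"
proof -
  have 1: "(\<exists>i\<le>Suc r. P i) \<longleftrightarrow> P 0 \<or> (\<exists>i\<le>r. P (Suc i))" for P
    by (metis Suc_le_mono le0 not0_implies_Suc)
  have "{f i |i. i \<le> Suc r} = insert (f 0) {f (Suc i) |i. i \<le> r}" for f :: "nat \<Rightarrow> 'a list"
    using 1[of "\<lambda>i. _ = f i"] by auto
  from this[of "\<lambda>i. replicate i q @ replicate (Suc r - i) q'"] show ?thesis by auto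
qed

context
  fixes A :: binstruct
  assumes fin: "finite (pverts A)" and nonempty: "pverts A \<noteq> {}"
begin

lemma set_verts_list: "set (verts_list A) = pverts A"
  using fin by (simp add: verts_list_def)

lemma verts_list_nonempty: "verts_list A \<noteq> []"
  using set_verts_list nonempty by auto

lemma sat_all_fm: "sat B b (all_fm A r as) \<longleftrightarrow> survives A B r (position as b)"
  by (induction r arbitrary: as b)
    (simp_all add: sat_diagram sat_big_disj set_verts_list position_snoc)

lemma sat_ex_fm: "sat B b (ex_fm A r as) \<longleftrightarrow> survives B A r ((position as b)\<inverse>)"
proof (induction r arbitrary: as b)
  case 0 thus ?case by (simp add: sat_diagram conforms_converse)
next
  case (Suc r)
  thus ?case by (simp add: sat_big_conj set_verts_list position_snoc_converse del: fun_upd_apply)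
qed

lemma sat_ex_all_fm: "sat B b (ex_all_fm A r as) \<longleftrightarrow> survives_alt A B r (position as b)"
  by (induction r arbitrary: as b)
    (simp_all add: sat_diagram sat_big_conj set_verts_list position_snoc sat_all_fm
       del: all_fm.simps survives.simps)

lemma sat_all_ex_fm: "sat B b (all_ex_fm A r as) \<longleftrightarrow> survives_alt B A r ((position as b)\<inverse>)"
proof (induction r arbitrary: as b)
  case 0 thus ?case by (simp add: sat_diagram conforms_converse)
next
  case (Suc r)
  thus ?case by (simp add: sat_big_disj set_verts_list position_snoc_converse sat_ex_fm
       del: ex_fm.simps survives.simps fun_upd_apply)
qed

lemma free_vars_diagram: "as \<noteq> [] \<Longrightarrow> free_vars (diagram A as) \<subseteq> {..<length as}"
  unfolding diagram_def
  by (subst free_vars_big_conj) (auto simp: product_upt_nonempty diagram_pair_def literal_def split: if_splits)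

lemma free_vars_game_fms:
  assumes "as \<noteq> [] \<or> r \<noteq> 0"
  shows "free_vars (all_fm A r as) \<subseteq> {..<length as} \<and> free_vars (ex_fm A r as) \<subseteq> {..<length as} \<and>
    free_vars (ex_all_fm A r as) \<subseteq> {..<length as} \<and> free_vars (all_ex_fm A r as) \<subseteq> {..<length as}"
  using assms
proof (induction r arbitrary: as)
  case (Suc r)
  have IH: "free_vars (all_fm A r (as @ [x])) \<subseteq> {..<Suc (length as)}"
    "free_vars (ex_fm A r (as @ [x])) \<subseteq> {..<Suc (length as)}"
    "free_vars (ex_all_fm A r (as @ [x])) \<subseteq> {..<Suc (length as)}"
    "free_vars (all_ex_fm A r (as @ [x])) \<subseteq> {..<Suc (length as)}" for x
    using Suc.IH[of "as @ [x]"] by simp_all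
  have sub: "(\<Union>x\<in>X. F x) - {length as} \<subseteq> {..<length as}" "(\<Union>x\<in>X. F x - {length as}) \<subseteq> {..<length as}"
    if "\<And>x. F x \<subseteq> {..<Suc (length as)}" for F :: "nat \<Rightarrow> nat set" and X
    using that by (fastforce simp: less_Suc_eq)+
  show ?case using verts_list_nonempty sub[OF IH(1)] sub[OF IH(2)] sub[OF IH(3)] sub[OF IH(4)]
    by (simp add: free_vars_big_disj free_vars_big_conj)
qed (simp add: free_vars_diagram)

lemma nest_diagram: "nest (diagram A as) = {[]}"
proof (cases "as = []")
  case False
  have "nest (diagram_pair A as ij) = {[]}" for ij
    by (cases ij) (simp add: diagram_pair_def literal_def)
  thus ?thesis using False unfolding diagram_def by (subst nest_big_conj) (auto simp: product_upt_nonempty)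
qed (simp add: diagram_def)

lemma nest_all_fm: "nest (all_fm A r as) = {replicate r QA}"
  using verts_list_nonempty by (induction r arbitrary: as) (auto simp: nest_diagram nest_big_disj)

lemma nest_ex_fm: "nest (ex_fm A r as) = {replicate r QE}"
  using verts_list_nonempty by (induction r arbitrary: as) (auto simp: nest_diagram nest_big_conj)

lemma nest_ex_all_fm:
  "nest (ex_all_fm A r as) = {replicate i QE @ replicate (r - i) QA |i. i \<le> r}"
proof (induction r arbitrary: as)
  case (Suc r)
  thus ?case using verts_list_nonempty
    by (auto simp: replicate_words_Suc nest_big_conj nest_all_fm simp del: all_fm.simps)
qed (simp add: nest_diagram)

lemma nest_all_ex_fm:
  "nest (all_ex_fm A r as) = {replicate i QA @ replicate (r - i) QE |i. i \<le> r}"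
proof (induction r arbitrary: as)
  case (Suc r)
  thus ?case using verts_list_nonempty
    by (auto simp: replicate_words_Suc nest_big_disj nest_ex_fm simp del: ex_fm.simps)
qed (simp add: nest_diagram)

end

lemma alternations_replicate:
  assumes "p \<noteq> q"
  shows "alternations (replicate i p @ replicate j q) = (if i = 0 \<or> j = 0 then 0 else 1)"
proof -
  have "{k. Suc k < i + j \<and> (replicate i p @ replicate j q) ! k \<noteq> (replicate i p @ replicate j q) ! Suc k}
    = (if i = 0 \<or> j = 0 then {} else {i - 1})"
    using assms by (auto simp: nth_append split: if_splits)
  thus ?thesis by (auto simp: alternations_def)
qed

text \<open>The two conjuncts cover a start of Spoiler in \<open>A\<close> and in the other
  structure. As \<open>nest\<close> of a conjunction is a union, offering both costs neither rank
  nor alternations.\<close>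

definition game_fm :: "binstruct \<Rightarrow> nat \<Rightarrow> fm" where
  "game_fm A k = Conj (ex_all_fm A k []) (all_ex_fm A k [])"

context
  fixes A :: binstruct
  assumes fin: "finite (pverts A)" and nonempty: "pverts A \<noteq> {}"
begin

lemma closed_game_fm: "0 < k \<Longrightarrow> closed_fm (game_fm A k)"
  using free_vars_game_fms[OF fin nonempty, of "[]" k] by (auto simp: closed_fm_def game_fm_def)

lemma quantifier_rank_game_fm: "quantifier_rank (game_fm A k) = k"
  by (rule quantifier_rank_eqI)
    (auto simp: game_fm_def nest_ex_all_fm[OF fin nonempty] nest_all_ex_fm[OF fin nonempty])

lemma alternation_number_game_fm:
  assumes "2 \<le> k"
  shows "alternation_number (game_fm A k) = 1"
proof -
  have 1: "alternations ` nest (game_fm A k) \<subseteq> {0, 1}"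
    by (auto simp: game_fm_def nest_ex_all_fm[OF fin nonempty] nest_all_ex_fm[OF fin nonempty] alternations_replicate split: if_splits)
  \<comment> \<open>From \<open>2 \<le> k\<close>, this word contains both letters, so the
    alternation number is exactly 1 and not 0.\<close>
  have "replicate 1 QE @ replicate (k - 1) QA \<in> nest (game_fm A k)"
    using assms unfolding game_fm_def nest.simps nest_ex_all_fm[OF fin nonempty] by (auto intro!: exI[of _ 1])
  moreover have "alternations (replicate 1 QE @ replicate (k - 1) QA) = 1"
    using assms by (subst alternations_replicate) auto
  ultimately have 2: "1 \<in> alternations ` nest (game_fm A k)" by (metis imageI)
  show ?thesis unfolding alternation_number_def
    using 1 2 by (intro Max_eqI) (auto intro: finite_subset[OF 1])
qed

lemma true_on_game_fm:
  assumes "pverts B \<noteq> {}"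
  shows "true_on (game_fm A k) B \<longleftrightarrow> survives_alt A B k {} \<and> survives_alt B A k {}"
proof -
  have "\<exists>b :: nat \<Rightarrow> nat. range b \<subseteq> pverts B" using assms by (auto intro!: exI[of _ "\<lambda>_. SOME x. x \<in> pverts B"] some_in_eq[THEN iffD2])
  thus ?thesis
    by (auto simp: true_on_def game_fm_def sat_ex_all_fm[OF fin nonempty] sat_all_ex_fm[OF fin nonempty] position_def)
qed

lemma defines_game_fm:
  assumes "0 < k"
    and "\<And>B. B \<in> structures \<Longrightarrow> survives_alt A B k {} \<Longrightarrow> survives_alt B A k {} \<Longrightarrow> isomorphic A B"
  shows "defines_struct (game_fm A k) A"
  using assms closed_game_fm true_on_game_fm nonempty survives_alt_self[of "{}" A k]
  by (auto simp: defines_struct_def distinguishes_def structures_def)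

end

section \<open>Similarity classes and the lower bound\<close>

definition simple :: "'a pair_pre_digraph \<Rightarrow> bool" where
  "simple A \<longleftrightarrow> finite (pverts A) \<and> parcs A \<subseteq> pverts A \<times> pverts A \<and> sym (parcs A) \<and> irrefl (parcs A)"

lemma simple_sym: "simple A \<Longrightarrow> (x, y) \<in> parcs A \<longleftrightarrow> (y, x) \<in> parcs A"
  by (auto simp: simple_def sym_def)

lemma simple_irrefl: "simple A \<Longrightarrow> (x, x) \<notin> parcs A"
  by (auto simp: simple_def irrefl_def)

lemma structures_iff:
  "A \<in> structures \<longleftrightarrow> finite (pverts A) \<and> parcs A \<subseteq> pverts A \<times> pverts A \<and> pverts A \<noteq> {}"
proof -
  have "finite (parcs A)" if "finite (pverts A)" "parcs A \<subseteq> pverts A \<times> pverts A"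
    using that by (meson finite_SigmaI finite_subset)
  thus ?thesis
    unfolding structures_def pair_fin_digraph_def pair_fin_digraph_axioms_def pair_wf_digraph_def by auto
qed

lemma graphs_iff: "A \<in> graphs \<longleftrightarrow> simple A \<and> pverts A \<noteq> {}"
proof -
  have "finite (parcs A)" if "finite (pverts A)" "parcs A \<subseteq> pverts A \<times> pverts A"
    using that by (meson finite_SigmaI finite_subset)
  thus ?thesis
    unfolding graphs_def pair_graph_def pair_digraph_def pair_pseudo_graph_def
      pair_fin_digraph_def pair_fin_digraph_axioms_def pair_wf_digraph_def
      pair_loopfree_digraph_def pair_loopfree_digraph_axioms_def
      pair_sym_digraph_def pair_sym_digraph_axioms_def simple_def symmetric_def irrefl_def
    by auto
qed

lemma isomorphicI:
  assumes "A \<in> structures" "B \<in> structures" "bij_betw f (pverts A) (pverts B)"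
    and "\<And>x y. x \<in> pverts A \<Longrightarrow> y \<in> pverts A \<Longrightarrow> (x, y) \<in> parcs A \<longleftrightarrow> (f x, f y) \<in> parcs B"
  shows "isomorphic A B"
proof -
  let ?h = "\<lparr>iso_verts = f, iso_arcs = map_prod f f, iso_head = snd, iso_tail = fst\<rparr>"
  have wf: "wf_digraph (with_proj A)"
    using assms(1) by unfold_locales (auto simp: structures_iff)
  have sub: "parcs A \<subseteq> pverts A \<times> pverts A" "parcs B \<subseteq> pverts B \<times> pverts B"
    using assms(1,2) by (auto simp: structures_iff)
  have inj: "inj_on f (pverts A)" and surj: "f ` pverts A = pverts B"
    using assms(3) by (auto simp: bij_betw_def)
  have "inj_on (map_prod f f) (parcs A)"
    using map_prod_inj_on[OF inj inj] sub(1) by (rule inj_on_subset)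
  hence iso: "pre_digraph.digraph_isomorphism (with_proj A) ?h"
    using wf inj by (auto simp: pre_digraph.digraph_isomorphism_def)
  have "map_prod f f ` parcs A = parcs B"
  proof
    show "map_prod f f ` parcs A \<subseteq> parcs B" using assms(4) sub(1) by fastforce
    show "parcs B \<subseteq> map_prod f f ` parcs A"
    proof
      fix e assume e: "e \<in> parcs B"
      then obtain x y where "x \<in> pverts A" "y \<in> pverts A" "e = (f x, f y)"
        using sub(2) surj by (cases e) blast
      thus "e \<in> map_prod f f ` parcs A" using assms(4) e by (auto intro!: rev_image_eqI[of "(x, y)"])
    qed
  qed
  hence "with_proj B = app_iso ?h (with_proj A)"
    using surj by (simp add: app_iso_def with_proj_def)
  thus ?thesis using iso by (auto simp: isomorphic_def digraph_iso_def)
qed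

lemma isomorphic_order: "isomorphic A B \<Longrightarrow> order A = order B"
  by (auto simp: isomorphic_def digraph_iso_def pre_digraph.digraph_isomorphism_def app_iso_def
    with_proj_def card_image)

definition similar :: "'a pair_pre_digraph \<Rightarrow> 'a \<Rightarrow> 'a \<Rightarrow> bool" where
  "similar A x y \<longleftrightarrow> x \<in> pverts A \<and> y \<in> pverts A \<and>
     (\<forall>z\<in>pverts A - {x, y}. (x, z) \<in> parcs A \<longleftrightarrow> (y, z) \<in> parcs A)"

definition sim_class :: "'a pair_pre_digraph \<Rightarrow> 'a \<Rightarrow> 'a set" where
  "sim_class A v = {u. similar A v u}"

lemma similar_refl: "x \<in> pverts A \<Longrightarrow> similar A x x"
  by (simp add: similar_def)

lemma similar_sym: "similar A x y \<Longrightarrow> similar A y x"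
  by (auto simp: similar_def)

text \<open>The only critical test vertex is \<open>y\<close>. For distinct \<open>x\<close>,
  \<open>y\<close>, \<open>z\<close> the three pairs among them have the same adjacency: test
  \<open>x\<close>, \<open>y\<close> at \<open>z\<close> and \<open>y\<close>, \<open>z\<close> at
  \<open>x\<close>, and use symmetry.\<close>

lemma similar_trans:
  assumes "simple A" "similar A x y" "similar A y z"
  shows "similar A x z"
  using assms(2,3) simple_sym[OF assms(1)] unfolding similar_def
  by (metis DiffD1 DiffD2 DiffI insert_iff singletonD)

lemma similarD:
  "similar A x y \<Longrightarrow> z \<in> pverts A \<Longrightarrow> z \<noteq> x \<Longrightarrow> z \<noteq> y \<Longrightarrow> (x, z) \<in> parcs A \<longleftrightarrow> (y, z) \<in> parcs A"
  by (auto simp: similar_def)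

text \<open>This makes every similarity class a clique or an independent set.\<close>

lemma similar_homogeneous:
  assumes "simple A" "similar A x y" "similar A x z" "similar A x w" "x \<noteq> y" "z \<noteq> w"
  shows "(x, y) \<in> parcs A \<longleftrightarrow> (z, w) \<in> parcs A"
  using assms simple_sym[OF assms(1)] unfolding similar_def
  by (metis DiffI insert_iff singletonD)

lemma sim_class_subset: "sim_class A v \<subseteq> pverts A"
  by (auto simp: sim_class_def similar_def)

lemma finite_sim_class: "finite (pverts A) \<Longrightarrow> finite (sim_class A v)"
  using sim_class_subset finite_subset by metis

text \<open>
  A vertex outside the similarity class \<open>S\<close> of \<open>v\<close> that is joined to \<open>S\<close> in the way in which \<open>S\<close> is
  joined to itself is Duplicator's last resort once \<open>S\<close> is exhausted. For a class of more than
  half of the vertices it is what separates quantifier rank \<open>|S| + 2\<close> from \<open>|S| + 1\<close>.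
\<close>

definition has_witness :: "'a pair_pre_digraph \<Rightarrow> 'a \<Rightarrow> bool" where
  "has_witness A v \<longleftrightarrow> (\<exists>u w. similar A v u \<and> u \<noteq> v \<and> w \<in> pverts A \<and> \<not> similar A v w \<and>
     ((v, w) \<in> parcs A \<longleftrightarrow> (v, u) \<in> parcs A))"

definition large_rank :: "'a pair_pre_digraph \<Rightarrow> 'a \<Rightarrow> nat" where
  "large_rank A v = card (sim_class A v) + (if has_witness A v then 2 else 1)"

section \<open>The unrestricted Ehrenfeucht game and the lower bound for \<open>D\<close>\<close>

fun equivalent :: "'a pair_pre_digraph \<Rightarrow> 'b pair_pre_digraph \<Rightarrow> nat \<Rightarrow> ('a \<times> 'b) set \<Rightarrow> bool" where
  "equivalent A B 0 p \<longleftrightarrow> conforms A B p"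
| "equivalent A B (Suc r) p \<longleftrightarrow> conforms A B p \<and>
     (\<forall>x\<in>pverts A. \<exists>y\<in>pverts B. equivalent A B r (insert (x, y) p)) \<and>
     (\<forall>y\<in>pverts B. \<exists>x\<in>pverts A. equivalent A B r (insert (x, y) p))"

lemma equivalent_conforms: "equivalent A B r p \<Longrightarrow> conforms A B p"
  by (cases r) auto

lemma nest_nonempty: "nest \<phi> \<noteq> {}"
  by (induction \<phi>) auto

lemma finite_nest: "finite (nest \<phi>)"
  by (induction \<phi>) auto

text \<open>The easy half of Ehrenfeucht's theorem. Switches are unrestricted in
  \<open>equivalent\<close>, because a lower bound on \<open>D\<close> has to cover formulas of
  every alternation number.\<close>

lemma equivalent_sat:
  assumes "equivalent A B r p" "\<And>w. w \<in> nest \<phi> \<Longrightarrow> length w \<le> r"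
    and "\<And>x. x \<in> free_vars \<phi> \<Longrightarrow> (a x, b x) \<in> p"
  shows "sat A a \<phi> \<longleftrightarrow> sat B b \<phi>"
  using assms
proof (induction \<phi> arbitrary: r p a b)
  case (Equal x y)
  thus ?case using equivalent_conforms[OF Equal.prems(1)] by (auto simp: conforms_def)
next
  case (Adj x y)
  thus ?case using equivalent_conforms[OF Adj.prems(1)] by (auto simp: conforms_def)
next
  case (Neg \<phi>)
  have "length w \<le> r" if "w \<in> nest \<phi>" for w
    using Neg.prems(2)[of "map dual w"] that by simp
  thus ?case using Neg.IH[OF Neg.prems(1), of a b] Neg.prems(3) by simp
next
  case (Conj \<phi> \<psi>)
  have "sat A a \<phi> \<longleftrightarrow> sat B b \<phi>" by (rule Conj.IH(1)[OF Conj.prems(1)]) (use Conj.prems in simp_all)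
  moreover have "sat A a \<psi> \<longleftrightarrow> sat B b \<psi>" by (rule Conj.IH(2)[OF Conj.prems(1)]) (use Conj.prems in simp_all)
  ultimately show ?case by simp
next
  case (Disj \<phi> \<psi>)
  have "sat A a \<phi> \<longleftrightarrow> sat B b \<phi>" by (rule Disj.IH(1)[OF Disj.prems(1)]) (use Disj.prems in simp_all)
  moreover have "sat A a \<psi> \<longleftrightarrow> sat B b \<psi>" by (rule Disj.IH(2)[OF Disj.prems(1)]) (use Disj.prems in simp_all)
  ultimately show ?case by simp
next
  case (Exists x \<phi>)
  \<comment> \<open>\<open>nest\<close> is never empty, so the quantifier contributes a letter to
    some word and at least one round is left to answer it.\<close>
  obtain w where "w \<in> nest \<phi>" using nest_nonempty by blast
  hence "length (QE # w) \<le> r" using Exists.prems(2) by (metis imageI nest.simps(6))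
  then obtain r' where r: "r = Suc r'" by (metis Suc_le_D length_Cons)
  have len: "length w \<le> r'" if "w \<in> nest \<phi>" for w using Exists.prems(2)[of "QE # w"] that r by auto
  have "sat A (a(x := v)) \<phi> \<longleftrightarrow> sat B (b(x := u)) \<phi>" if "equivalent A B r' (insert (v, u) p)" for u v
    using Exists.IH[OF that len] Exists.prems(3) by auto
  thus ?case using Exists.prems(1) unfolding r by (simp del: fun_upd_apply) metis
next
  case (Forall x \<phi>)
  obtain w where "w \<in> nest \<phi>" using nest_nonempty by blast
  hence "length (QA # w) \<le> r" using Forall.prems(2) by (metis imageI nest.simps(7))
  then obtain r' where r: "r = Suc r'" by (metis Suc_le_D length_Cons)
  have len: "length w \<le> r'" if "w \<in> nest \<phi>" for w using Forall.prems(2)[of "QA # w"] that r by auto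
  have "sat A (a(x := v)) \<phi> \<longleftrightarrow> sat B (b(x := u)) \<phi>" if "equivalent A B r' (insert (v, u) p)" for u v
    using Forall.IH[OF that len] Forall.prems(3) by auto
  thus ?case using Forall.prems(1) unfolding r by (simp del: fun_upd_apply) metis
qed

lemma equivalent_rank_bound:
  assumes "equivalent A B r {}" "A \<in> structures" "B \<in> structures" "\<not> isomorphic A B"
    and "defines_struct \<phi> A"
  shows "r < quantifier_rank \<phi>"
proof (rule ccontr)
  assume "\<not> r < quantifier_rank \<phi>"
  hence len: "length w \<le> r" if "w \<in> nest \<phi>" for w
    using Max_ge[of "length ` nest \<phi>" "length w"] finite_nest that unfolding quantifier_rank_def by fastforce
  have "free_vars \<phi> = {}" using assms(5) by (simp add: defines_struct_def closed_fm_def)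
  hence "sat A a \<phi> \<longleftrightarrow> sat B b \<phi>" for a b
    using equivalent_sat[OF assms(1) len] by blast
  moreover have "\<exists>a :: nat \<Rightarrow> nat. range a \<subseteq> pverts A"
    using assms(2) by (auto simp: structures_iff intro!: exI[of _ "\<lambda>_. SOME x. x \<in> pverts A"] some_in_eq[THEN iffD2])
  ultimately show False
    using assms(3-5) unfolding defines_struct_def distinguishes_def true_on_def by metis
qed

text \<open>
  \<open>B\<close> is \<open>A\<close> with one more vertex in the similarity class of \<open>v\<close>; the class is a clique if \<open>eps\<close>
  holds and independent otherwise.
\<close>

locale twin_extension =
  fixes A :: "'a pair_pre_digraph" and v new :: 'a
  assumes simple: "simple A" and v: "v \<in> pverts A" and new: "new \<notin> pverts A"
    and class_size: "2 \<le> card (sim_class A v)"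
begin

abbreviation "cls \<equiv> sim_class A v"
abbreviation "cls' \<equiv> insert new cls"

definition eps :: bool where
  "eps \<longleftrightarrow> (\<exists>u. similar A v u \<and> u \<noteq> v \<and> (v, u) \<in> parcs A)"

definition retract :: "'a \<Rightarrow> 'a" where
  "retract x = (if x = new then v else x)"

definition B :: "'a pair_pre_digraph" where
  "B = \<lparr>pverts = insert new (pverts A),
        parcs = {(x, y) \<in> insert new (pverts A) \<times> insert new (pverts A).
          if x \<in> cls' \<and> y \<in> cls' then x \<noteq> y \<and> eps else (retract x, retract y) \<in> parcs A}\<rparr>"

lemma pverts_B: "pverts B = insert new (pverts A)"
  by (simp add: B_def)

lemma parcs_B: "y \<in> pverts B \<Longrightarrow> y' \<in> pverts B \<Longrightarrow> (y, y') \<in> parcs B \<longleftrightarrow>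
    (if y \<in> cls' \<and> y' \<in> cls' then y \<noteq> y' \<and> eps else (retract y, retract y') \<in> parcs A)"
  by (auto simp: B_def)

lemma finite_verts: "finite (pverts A)"
  using simple by (simp add: simple_def)

lemma finite_cls: "finite cls"
  using finite_verts by (rule finite_sim_class)

lemma cls_subset: "cls \<subseteq> pverts A"
  by (rule sim_class_subset)

lemma card_cls': "card cls' = Suc (card cls)"
  using new cls_subset finite_cls by (subst card_insert_disjoint) auto

lemma adj_cls:
  assumes "x \<in> cls" "y \<in> cls"
  shows "(x, y) \<in> parcs A \<longleftrightarrow> x \<noteq> y \<and> eps"
proof (cases "x = y")
  case True
  thus ?thesis using simple_irrefl[OF simple] by simp
next
  case False
  have "\<not> cls \<subseteq> {v}" using class_size card_mono[of "{v}" cls] by auto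
  then obtain u where u: "similar A v u" "u \<noteq> v" by (auto simp: sim_class_def)
  have *: "(v, u') \<in> parcs A \<longleftrightarrow> (x, y) \<in> parcs A" if "similar A v u'" "u' \<noteq> v" for u'
    using similar_homogeneous[OF simple that(1), of x y] assms False that(2) by (auto simp: sim_class_def)
  show ?thesis using * u False by (auto simp: eps_def)
qed

lemma adj_cls_outside:
  assumes "x \<in> cls" "y \<in> cls" "z \<in> pverts A" "z \<notin> cls"
  shows "(x, z) \<in> parcs A \<longleftrightarrow> (y, z) \<in> parcs A"
  using assms similarD similar_trans[OF simple] similar_sym unfolding sim_class_def mem_Collect_eq
  by metis

definition matched :: "('a \<times> 'a) set \<Rightarrow> bool" where
  "matched p \<longleftrightarrow> (\<forall>x y. (x, y) \<in> p \<longrightarrow> x \<in> cls \<and> y \<in> cls' \<or> x \<in> pverts A - cls \<and> y = x) \<and>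
     (\<forall>x y x' y'. (x, y) \<in> p \<longrightarrow> (x', y') \<in> p \<longrightarrow> (x = x' \<longleftrightarrow> y = y'))"

lemma matched_conforms:
  assumes "matched p"
  shows "conforms A B p"
  unfolding conforms_def
proof (intro allI impI conjI)
  fix x y x' y' assume p: "(x, y) \<in> p" "(x', y') \<in> p"
  show "x = x' \<longleftrightarrow> y = y'" using assms p unfolding matched_def by blast
  have x: "x \<in> cls \<and> y \<in> cls' \<or> x \<in> pverts A - cls \<and> y = x"
    and x': "x' \<in> cls \<and> y' \<in> cls' \<or> x' \<in> pverts A - cls \<and> y' = x'"
    using assms p unfolding matched_def by blast+
  have V: "y \<in> pverts B" "y' \<in> pverts B" using x x' cls_subset by (auto simp: pverts_B)
  have retract: "retract z \<in> cls" if "z \<in> cls'" for z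
    using that v similar_refl[OF v] by (auto simp: retract_def sim_class_def)
  have retract': "retract z = z" "z \<notin> cls'" if "z \<in> pverts A - cls" for z
    using that new by (auto simp: retract_def)
  show "(x, x') \<in> parcs A \<longleftrightarrow> (y, y') \<in> parcs B"
  proof (cases "x \<in> cls"; cases "x' \<in> cls")
    assume "x \<in> cls" "x' \<in> cls"
    thus ?thesis using x x' V \<open>x = x' \<longleftrightarrow> y = y'\<close> by (simp add: parcs_B adj_cls)
  next
    assume "x \<in> cls" "x' \<notin> cls"
    thus ?thesis using x x' V retract[of y] retract'[of x'] adj_cls_outside[of x "retract y" x']
      by (auto simp: parcs_B)
  next
    assume "x \<notin> cls" "x' \<in> cls"
    thus ?thesis using x x' V retract[of y'] retract'[of x] adj_cls_outside[of x' "retract y'" x]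
      by (auto simp: parcs_B simple_sym[OF simple, of x])
  next
    assume "x \<notin> cls" "x' \<notin> cls"
    thus ?thesis using x x' V retract'[of x] retract'[of x'] by (simp add: parcs_B)
  qed
qed

lemma matched_insert:
  assumes "matched p" "x \<in> cls" "y \<in> cls'" "\<And>b. b \<in> cls' \<Longrightarrow> (x, b) \<notin> p" "\<And>a. a \<in> cls \<Longrightarrow> (a, y) \<notin> p"
  shows "matched (insert (x, y) p)"
proof -
  have p: "a \<in> cls \<and> b \<in> cls' \<or> a \<in> pverts A - cls \<and> b = a" if "(a, b) \<in> p" for a b
    using assms(1) that unfolding matched_def by blast
  have "b \<noteq> y \<and> a \<noteq> x" if "(a, b) \<in> p" for a b
    using p[OF that] assms(2-) new that by blast
  thus ?thesis using assms(1-3) unfolding matched_def by (auto simp del: insert_iff simp: insert_iff[of "(_, _)"])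
qed

text \<open>Only the class in \<open>A\<close> can run out of fresh vertices, as the one in
  \<open>B\<close> has one more. The second alternative grants an extra round as long as every move
  fell into the class: a witness then replaces the missing class vertex in the last round. A move
  outside the class leads back to the first alternative, since it uses up a round but no class
  vertex.\<close>

lemma equivalent_matched:
  assumes "matched p" "finite p"
    and "card (p \<inter> cls \<times> cls') + r \<le> card cls \<or>
      has_witness A v \<and> p \<subseteq> cls \<times> cls' \<and> card p + r \<le> Suc (card cls)"
  shows "equivalent A B r p"
  using assms
proof (induction r arbitrary: p)
  case 0 thus ?case by (simp add: matched_conforms)
next
  case (Suc r)
  let ?q = "p \<inter> cls \<times> cls'"
  have q: "p \<subseteq> cls \<times> cls' \<Longrightarrow> ?q = p" by blast
  have card_q: "card ?q + r \<le> card cls" using Suc.prems(3) q by auto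
  hence "card (snd ` ?q) < card cls'"
    using Suc.prems(2) card_image_le[of ?q snd] card_cls' by auto
  then obtain y0 where y0: "y0 \<in> cls'" "y0 \<notin> snd ` ?q"
    using finite_cls Suc.prems(2) by (meson card_mono finite_Int finite_imageI finite_insert leD subsetI)
  have step_cls: "equivalent A B r (insert (x, y) p)"
    if "x \<in> cls" "y \<in> cls'" "matched (insert (x, y) p)" for x y
  proof (rule Suc.IH[OF that(3)])
    have "insert (x, y) p \<inter> cls \<times> cls' = insert (x, y) ?q" using that by auto
    moreover have "card (insert (x, y) ?q) \<le> Suc (card ?q)" "card (insert (x, y) p) \<le> Suc (card p)"
      using Suc.prems(2) by (simp_all add: card_insert_if)
    ultimately show "card (insert (x, y) p \<inter> cls \<times> cls') + r \<le> card cls \<or>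
        has_witness A v \<and> insert (x, y) p \<subseteq> cls \<times> cls' \<and> card (insert (x, y) p) + r \<le> Suc (card cls)"
      using Suc.prems(3) that(1,2) by auto
  qed (use Suc.prems in simp)
  have step_out: "equivalent A B r (insert (x, x) p)" if x: "x \<in> pverts A" "x \<notin> cls" for x
  proof (rule Suc.IH)
    have "x \<notin> cls'" using x new by auto
    thus "matched (insert (x, x) p)" using Suc.prems(1) x unfolding matched_def by (metis (no_types, lifting) DiffI DiffD2 insert_iff prod.inject)
    show "card (insert (x, x) p \<inter> cls \<times> cls') + r \<le> card cls \<or> has_witness A v \<and>
        insert (x, x) p \<subseteq> cls \<times> cls' \<and> card (insert (x, x) p) + r \<le> Suc (card cls)"
      using card_q x by (simp add: Int_insert_left)
  qed (use Suc.prems in simp)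
  have "\<exists>y\<in>pverts B. equivalent A B r (insert (x, y) p)" if x: "x \<in> pverts A" for x
  proof (cases "x \<in> cls")
    case False
    thus ?thesis using step_out[OF x] x by (auto simp: pverts_B)
  next
    case True
    have "\<exists>y\<in>cls'. matched (insert (x, y) p)"
    proof (cases "\<exists>y. (x, y) \<in> p")
      case True
      then obtain y where y: "(x, y) \<in> p" by blast
      hence "y \<in> cls'" "insert (x, y) p = p" using Suc.prems(1) \<open>x \<in> cls\<close> unfolding matched_def by auto
      thus ?thesis using Suc.prems(1) by (intro bexI[of _ y]) simp_all
    next
      case False
      have "matched (insert (x, y0) p)"
        using y0 False \<open>x \<in> cls\<close> by (intro matched_insert[OF Suc.prems(1)]) force+
      thus ?thesis using y0(1) by blast
    qed
    thus ?thesis using step_cls[OF True] cls_subset by (auto simp: pverts_B)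
  qed
  moreover have "\<exists>x\<in>pverts A. equivalent A B r (insert (x, y) p)" if y: "y \<in> pverts B" for y
  proof (cases "y \<in> cls'")
    case False
    thus ?thesis using step_out[of y] y by (auto simp: pverts_B)
  next
    case True
    show ?thesis
    proof (cases "\<exists>x. (x, y) \<in> p")
      case True
      then obtain x where x: "(x, y) \<in> p" by blast
      hence "x \<in> cls" "insert (x, y) p = p" using Suc.prems(1) \<open>y \<in> cls'\<close> new unfolding matched_def by auto
      thus ?thesis using step_cls[of x y] \<open>y \<in> cls'\<close> Suc.prems(1) cls_subset by (metis subsetD)
    next
      case y_new: False
      show ?thesis
      proof (cases "card (fst ` ?q) < card cls")
        case True
        then obtain x0 where x0: "x0 \<in> cls" "x0 \<notin> fst ` ?q"
          using finite_cls Suc.prems(2) by (meson card_mono finite_Int finite_imageI leD subsetI)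
        have "matched (insert (x0, y) p)"
          using x0 y_new \<open>y \<in> cls'\<close> by (intro matched_insert[OF Suc.prems(1)]) force+
        thus ?thesis using step_cls[of x0 y] \<open>y \<in> cls'\<close> x0 cls_subset by auto
      next
        case False
        hence "card cls \<le> card ?q" using Suc.prems(2) card_image_le[of ?q fst] by simp
        \<comment> \<open>With the class in \<open>A\<close> exhausted, the first alternative of the
          budget is violated, and the second leaves no round after this one.\<close>
        hence r: "r = 0" and wit: "has_witness A v" and p_cls: "p \<subseteq> cls \<times> cls'"
          using card_q Suc.prems(3) by auto
        obtain u w where w: "similar A v u" "u \<noteq> v" "w \<in> pverts A" "\<not> similar A v w"
          "(v, w) \<in> parcs A \<longleftrightarrow> (v, u) \<in> parcs A"
          using wit by (auto simp: has_witness_def)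
        have "v \<in> cls" "u \<in> cls" "w \<notin> cls" using w similar_refl[OF v] by (auto simp: sim_class_def)
        \<comment> \<open>The witness is joined to the class as the class is to itself, so towards
          the chosen vertices it behaves like one more member.\<close>
        hence adj: "(x, w) \<in> parcs A \<longleftrightarrow> eps" "(w, x) \<in> parcs A \<longleftrightarrow> eps" if "x \<in> cls" for x
          using w adj_cls[of v u] adj_cls_outside[of x v w] that simple_sym[OF simple, of w x] by auto
        have "conforms A B (insert (w, y) p)"
          unfolding conforms_def
        proof (intro allI impI)
          fix a b a' b' assume ab: "(a, b) \<in> insert (w, y) p" "(a', b') \<in> insert (w, y) p"
          have in_p: "c \<in> cls \<and> d \<in> cls' \<and> d \<in> pverts B \<and> c \<noteq> w \<and> d \<noteq> y" if "(c, d) \<in> p" for c d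
            using that p_cls \<open>w \<notin> cls\<close> y_new cls_subset by (auto simp: pverts_B)
          show "(a = a' \<longleftrightarrow> b = b') \<and> ((a, a') \<in> parcs A \<longleftrightarrow> (b, b') \<in> parcs B)"
          proof (cases "(a, b) \<in> p"; cases "(a', b') \<in> p")
            assume "(a, b) \<in> p" "(a', b') \<in> p"
            thus ?thesis using matched_conforms[OF Suc.prems(1)] unfolding conforms_def by blast
          next
            assume 1: "(a, b) \<in> p" "(a', b') \<notin> p"
            hence "a' = w" "b' = y" using ab by auto
            thus ?thesis using in_p[OF 1(1)] adj[of a] y \<open>y \<in> cls'\<close> by (auto simp: parcs_B)
          next
            assume 1: "(a, b) \<notin> p" "(a', b') \<in> p"
            hence "a = w" "b = y" using ab by auto
            thus ?thesis using in_p[OF 1(2)] adj[of a'] y \<open>y \<in> cls'\<close> by (auto simp: parcs_B)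
          next
            assume "(a, b) \<notin> p" "(a', b') \<notin> p"
            thus ?thesis using ab y \<open>y \<in> cls'\<close> simple_irrefl[OF simple] by (auto simp: parcs_B)
          qed
        qed
        thus ?thesis using w(3) r by auto
      qed
    qed
  qed
  ultimately show ?case using Suc.prems(1) by (simp add: matched_conforms)
qed

lemma equivalent_twin_extension: "equivalent A B (large_rank A v - 1) {}"
  by (rule equivalent_matched) (auto simp: matched_def large_rank_def)

lemma B_structure: "finite (pverts B)" "parcs B \<subseteq> pverts B \<times> pverts B" "pverts B \<noteq> {}" "card (pverts B) = Suc (card (pverts A))"
  using finite_verts new by (auto simp: B_def)

end

lemma large_rank_le_quantifier_rank:
  assumes "A \<in> graphs" "v \<in> pverts A" "2 \<le> card (sim_class A v)" "defines_struct \<phi> A"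
  shows "large_rank A v \<le> quantifier_rank \<phi>"
proof -
  have s: "simple A" using assms(1) by (simp add: graphs_iff)
  hence "finite (pverts A)" by (simp add: simple_def)
  then obtain new where "new \<notin> pverts A" using ex_new_if_finite infinite_UNIV_nat by blast
  then interpret twin_extension A v new using s assms(2,3) by unfold_locales
  have "A \<in> structures" using s assms(2) by (auto simp: structures_iff simple_def)
  moreover have "B \<in> structures" using B_structure by (simp add: structures_iff)
  moreover have "\<not> isomorphic A B" using isomorphic_order[of A B] B_structure(4) by auto
  ultimately have "large_rank A v - 1 < quantifier_rank \<phi>"
    using equivalent_rank_bound[OF equivalent_twin_extension] assms(4) by blast
  thus ?thesis by simp
qed

section \<open>Reconstruction from a base set\<close>

text \<open>Types consist of indices rather than vertices, so that types in two structures can be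
  compared once base vertices are paired by index.\<close>

definition type_over :: "'a pair_pre_digraph \<Rightarrow> 'i set \<Rightarrow> ('i \<Rightarrow> 'a) \<Rightarrow> 'a \<Rightarrow> 'i set" where
  "type_over A I \<alpha> x = {i \<in> I. (x, \<alpha> i) \<in> parcs A}"

text \<open>The vertex \<open>w\<close> certifies that the type of \<open>u\<close> is not unique.
  For such \<open>u\<close>, the adjacency to any other vertex depends only on the type of the
  latter, and this includes the remaining vertices of the type of \<open>u\<close>.\<close>

definition homogeneous_on :: "('a \<times> 'a) set \<Rightarrow> 'a set \<Rightarrow> ('a \<Rightarrow> 't) \<Rightarrow> bool" where
  "homogeneous_on E W \<tau> \<longleftrightarrow> (\<forall>u\<in>W. \<forall>a\<in>W. \<forall>b\<in>W. \<forall>w\<in>W.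
     w \<noteq> u \<longrightarrow> \<tau> w = \<tau> u \<longrightarrow> a \<noteq> u \<longrightarrow> b \<noteq> u \<longrightarrow> \<tau> a = \<tau> b \<longrightarrow> (u, a) \<in> E \<longleftrightarrow> (u, b) \<in> E)"

text \<open>
  A set \<open>X\<close> of maximal size with more types over \<open>X\<close> than elements: adding a vertex \<open>u\<close> that shares
  its type creates no type beyond the old ones, hence splits no class of the partition.
\<close>

lemma exists_base:
  assumes "simple A" "pverts A \<noteq> {}"
  obtains X where "X \<subseteq> pverts A" "card X < card (type_over A X (\<lambda>x. x) ` (pverts A - X))"
    "homogeneous_on (parcs A) (pverts A - X) (type_over A X (\<lambda>x. x))"
proof -
  let ?\<tau> = "\<lambda>X. type_over A X (\<lambda>x. x)"
  let ?P = "\<lambda>X. X \<subseteq> pverts A \<and> card X < card (?\<tau> X ` (pverts A - X))"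
  have fin: "finite (pverts A)" using assms(1) by (simp add: simple_def)
  \<comment> \<open>The empty set is a candidate: over it there is exactly one type, and 0 <
    1.\<close>
  have "?\<tau> {} ` (pverts A - {}) = {{}}" using assms(2) by (auto simp: type_over_def)
  hence "?P {}" by simp
  moreover have "card X \<le> card (pverts A)" if "?P X" for X using that fin by (meson card_mono)
  ultimately have "\<exists>X. ?P X \<and> (\<forall>X'. ?P X' \<longrightarrow> card X' \<le> card X)"
    by (intro ex_has_greatest_nat[of ?P "{}" card "Suc (card (pverts A))"]) (auto simp: less_Suc_eq_le)
  then obtain X where X: "?P X" and max: "\<And>X'. ?P X' \<Longrightarrow> card X' \<le> card X" by blast
  let ?W = "pverts A - X"
  have "homogeneous_on (parcs A) ?W (?\<tau> X)"
    unfolding homogeneous_on_def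
  proof (intro ballI impI)
    fix u a b w
    assume u: "u \<in> ?W" and a: "a \<in> ?W" "a \<noteq> u" and b: "b \<in> ?W" "b \<noteq> u"
      and w: "w \<in> ?W" "w \<noteq> u" "?\<tau> X w = ?\<tau> X u" and ab: "?\<tau> X a = ?\<tau> X b"
    let ?W' = "pverts A - insert u X" and ?T = "?\<tau> (insert u X) ` (pverts A - insert u X)"
    have restrict: "?\<tau> (insert u X) x - {u} = ?\<tau> X x" if "x \<in> ?W'" for x
      using u by (auto simp: type_over_def)
    have image: "(\<lambda>t. t - {u}) ` ?T = ?\<tau> X ` ?W"
    proof -
      have "(\<lambda>t. t - {u}) ` ?T = ?\<tau> X ` ?W'"
        unfolding image_image by (intro image_cong refl restrict)
      \<comment> \<open>The type of \<open>u\<close> is not lost when \<open>u\<close> joins the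
        base, as \<open>w\<close> still realises it.\<close>
      moreover have "?\<tau> X ` ?W' = ?\<tau> X ` ?W"
        using u w by (auto simp: image_iff)
      ultimately show ?thesis by simp
    qed
    have cX: "card (insert u X) = Suc (card X)"
      using u X fin by (meson DiffD2 card_insert_disjoint finite_subset)
    \<comment> \<open>By maximality there are at most |X| + 1 types over the enlarged base. Dropping
      \<open>u\<close> maps them onto the old types, of which there are at least |X| + 1, so this
      map is injective.\<close>
    have "\<not> Suc (card X) < card ?T"
      using max[of "insert u X"] X u cX by auto
    hence "card ?T \<le> card ((\<lambda>t. t - {u}) ` ?T)"
      using X unfolding image by linarith
    moreover have finT: "finite ?T" using fin by simp
    ultimately have inj: "inj_on (\<lambda>t. t - {u}) ?T"
      by (meson card_image_le eq_card_imp_inj_on le_antisym)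
    have W': "a \<in> ?W'" "b \<in> ?W'" using a b by auto
    have "?\<tau> (insert u X) a = ?\<tau> (insert u X) b"
      by (rule inj_onD[OF inj _ imageI[OF W'(1)] imageI[OF W'(2)]])
        (simp only: restrict[OF W'(1)] restrict[OF W'(2)] ab)
    hence "u \<in> ?\<tau> (insert u X) a \<longleftrightarrow> u \<in> ?\<tau> (insert u X) b" by simp
    thus "(u, a) \<in> parcs A \<longleftrightarrow> (u, b) \<in> parcs A"
      by (simp add: type_over_def simple_sym[OF assms(1), of u])
  qed
  thus ?thesis using that X by blast
qed

section \<open>Refined types and what two rounds reveal about them\<close>

definition single :: "'a set \<Rightarrow> ('a \<Rightarrow> 't) \<Rightarrow> 'a \<Rightarrow> bool" where
  "single W \<tau> y \<longleftrightarrow> y \<in> W \<and> (\<forall>w\<in>W. \<tau> w = \<tau> y \<longrightarrow> w = y)"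

text \<open>The type is refined by the adjacencies to the vertices that are unique in their type.
  These are recorded by their types, which again makes different structures comparable. Under
  homogeneity, fine types determine adjacency.\<close>

definition fine_type :: "('a \<times> 'a) set \<Rightarrow> 'a set \<Rightarrow> ('a \<Rightarrow> 't) \<Rightarrow> 'a \<Rightarrow> 't \<times> 't set" where
  "fine_type E W \<tau> x = (\<tau> x, \<tau> ` {y. single W \<tau> y \<and> (x, y) \<in> E})"

text \<open>What survival for two rounds, with both Spoiler moves in one structure, says about the
  vertices outside the base. The answer \<open>y\<close> is fixed before the second move is
  known.\<close>

definition forth_step ::
    "('a \<times> 'a) set \<Rightarrow> 'a set \<Rightarrow> ('a \<Rightarrow> 't) \<Rightarrow> ('b \<times> 'b) set \<Rightarrow> 'b set \<Rightarrow> ('b \<Rightarrow> 't) \<Rightarrow> bool" where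
  "forth_step E W \<tau> E' W' \<tau>' \<longleftrightarrow> (\<forall>x\<in>W. \<exists>y\<in>W'. \<tau>' y = \<tau> x \<and>
     (\<forall>x2\<in>W. \<exists>y2\<in>W'. \<tau>' y2 = \<tau> x2 \<and> (y = y2 \<longleftrightarrow> x = x2) \<and> ((y, y2) \<in> E' \<longleftrightarrow> (x, x2) \<in> E)))"

locale two_step =
  fixes E :: "('a \<times> 'a) set" and W :: "'a set" and \<tau> :: "'a \<Rightarrow> 't"
    and E' :: "('b \<times> 'b) set" and W' :: "'b set" and \<tau>' :: "'b \<Rightarrow> 't"
  assumes sym: "sym E" "sym E'"
    and forth: "forth_step E W \<tau> E' W' \<tau>'" and back_step: "forth_step E' W' \<tau>' E W \<tau>"
    and homogeneous: "homogeneous_on E W \<tau>"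
begin

lemma forthE:
  assumes "x \<in> W"
  obtains y where "y \<in> W'" "\<tau>' y = \<tau> x"
    "\<And>x2. x2 \<in> W \<Longrightarrow> \<exists>y2\<in>W'. \<tau>' y2 = \<tau> x2 \<and> (y = y2 \<longleftrightarrow> x = x2) \<and> ((y, y2) \<in> E' \<longleftrightarrow> (x, x2) \<in> E)"
  using forth assms unfolding forth_step_def by metis

lemma backE:
  assumes "y \<in> W'"
  obtains x where "x \<in> W" "\<tau> x = \<tau>' y"
    "\<And>y2. y2 \<in> W' \<Longrightarrow> \<exists>x2\<in>W. \<tau> x2 = \<tau>' y2 \<and> (x = x2 \<longleftrightarrow> y = y2) \<and> ((x, x2) \<in> E \<longleftrightarrow> (y, y2) \<in> E')"
  using back_step assms unfolding forth_step_def by metis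

lemma symD: "(x, y) \<in> E \<longleftrightarrow> (y, x) \<in> E" "(x', y') \<in> E' \<longleftrightarrow> (y', x') \<in> E'"
  using sym by (auto dest: symD)

lemma hom:
  assumes "u \<in> W" "a \<in> W" "b \<in> W" "\<not> single W \<tau> u" "a \<noteq> u" "b \<noteq> u" "\<tau> a = \<tau> b"
  shows "(u, a) \<in> E \<longleftrightarrow> (u, b) \<in> E"
proof -
  obtain w where "w \<in> W" "w \<noteq> u" "\<tau> w = \<tau> u" using assms(1,4) by (auto simp: single_def)
  thus ?thesis using homogeneous assms unfolding homogeneous_on_def by metis
qed

text \<open>If a second vertex in \<open>W'\<close> had the type of \<open>y'\<close>, Spoiler would
  select both, and the answers would be two distinct vertices with the type of
  \<open>y\<close>.\<close>

lemma single_transfer: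
  assumes "single W \<tau> y" "y' \<in> W'" "\<tau>' y' = \<tau> y"
  shows "single W' \<tau>' y'"
  unfolding single_def
proof (intro conjI ballI impI assms(2))
  fix w assume w: "w \<in> W'" "\<tau>' w = \<tau>' y'"
  obtain x where x: "x \<in> W" "\<tau> x = \<tau>' y'"
    "\<And>y2. y2 \<in> W' \<Longrightarrow> \<exists>x2\<in>W. \<tau> x2 = \<tau>' y2 \<and> (x = x2 \<longleftrightarrow> y' = y2) \<and> ((x, x2) \<in> E \<longleftrightarrow> (y', y2) \<in> E')"
    using backE[OF assms(2)] by metis
  obtain x2 where "x2 \<in> W" "\<tau> x2 = \<tau>' w" "x = x2 \<longleftrightarrow> y' = w" using x(3)[OF w(1)] by blast
  thus "w = y'" using assms(1,3) x(1,2) w(2) unfolding single_def by metis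
qed

text \<open>One answer \<open>x\<close> to \<open>u\<close> serves for both second moves
  \<open>a\<close> and \<open>b\<close>, so a violation in \<open>E'\<close> would be mirrored by a
  violation in \<open>E\<close>. Hence homogeneity is demanded of one structure only, and the locale
  is symmetric.\<close>

lemma homogeneous': "homogeneous_on E' W' \<tau>'"
  unfolding homogeneous_on_def
proof (intro ballI impI)
  fix u a b w
  assume u: "u \<in> W'" and a: "a \<in> W'" "a \<noteq> u" and b: "b \<in> W'" "b \<noteq> u"
    and w: "w \<in> W'" "w \<noteq> u" "\<tau>' w = \<tau>' u" and ab: "\<tau>' a = \<tau>' b"
  obtain x where x: "x \<in> W" "\<tau> x = \<tau>' u"
    "\<And>y2. y2 \<in> W' \<Longrightarrow> \<exists>x2\<in>W. \<tau> x2 = \<tau>' y2 \<and> (x = x2 \<longleftrightarrow> u = y2) \<and> ((x, x2) \<in> E \<longleftrightarrow> (u, y2) \<in> E')"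
    using backE[OF u] by metis
  obtain xa where xa: "xa \<in> W" "\<tau> xa = \<tau>' a" "x = xa \<longleftrightarrow> u = a" "(x, xa) \<in> E \<longleftrightarrow> (u, a) \<in> E'"
    using x(3)[OF a(1)] by blast
  obtain xb where xb: "xb \<in> W" "\<tau> xb = \<tau>' b" "x = xb \<longleftrightarrow> u = b" "(x, xb) \<in> E \<longleftrightarrow> (u, b) \<in> E'"
    using x(3)[OF b(1)] by blast
  have "\<not> single W \<tau> x"
    using single_transfer[of x u] x u w unfolding single_def by metis
  hence "(x, xa) \<in> E \<longleftrightarrow> (x, xb) \<in> E" using hom[of x xa xb] x xa xb a b ab by auto
  thus "(u, a) \<in> E' \<longleftrightarrow> (u, b) \<in> E'" using xa xb by simp
qed

lemma swapped: "two_step E' W' \<tau>' E W \<tau>"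
  using sym forth back_step homogeneous' by unfold_locales

lemmas single_transfer_back = two_step.single_transfer[OF swapped]

text \<open>The answer to \<open>y\<close> has the same fine type: a vertex that is unique in its
  type can be answered only by the corresponding unique vertex, so a second move there compares the
  recorded adjacencies.\<close>

lemma fine_type_back:
  assumes "y \<in> W'"
  shows "\<exists>x\<in>W. fine_type E W \<tau> x = fine_type E' W' \<tau>' y"
proof -
  obtain x where x: "x \<in> W" "\<tau> x = \<tau>' y"
    "\<And>y2. y2 \<in> W' \<Longrightarrow> \<exists>x2\<in>W. \<tau> x2 = \<tau>' y2 \<and> (x = x2 \<longleftrightarrow> y = y2) \<and> ((x, x2) \<in> E \<longleftrightarrow> (y, y2) \<in> E')"
    using backE[OF assms] by metis
  have "\<tau> ` {z. single W \<tau> z \<and> (x, z) \<in> E} = \<tau>' ` {z. single W' \<tau>' z \<and> (y, z) \<in> E'}" (is "?L = ?R")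
  proof (intro equalityI subsetI)
    fix t assume "t \<in> ?R"
    then obtain z where z: "single W' \<tau>' z" "(y, z) \<in> E'" "t = \<tau>' z" by blast
    then obtain x2 where "x2 \<in> W" "\<tau> x2 = \<tau>' z" "(x, x2) \<in> E" using x(3)[of z] by (auto simp: single_def)
    thus "t \<in> ?L" using single_transfer_back[OF z(1), of x2] z(3) by force
  next
    fix t assume "t \<in> ?L"
    then obtain z where z: "single W \<tau> z" "(x, z) \<in> E" "t = \<tau> z" by blast
    hence "z \<in> W" by (simp add: single_def)
    then obtain z' where z': "z' \<in> W'" "\<tau>' z' = \<tau> z" by (rule forthE)
    then obtain x2 where x2: "x2 \<in> W" "\<tau> x2 = \<tau>' z'" "(x, x2) \<in> E \<longleftrightarrow> (y, z') \<in> E'" using x(3)[of z'] by blast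
    hence "x2 = z" using z(1) z'(2) by (auto simp: single_def)
    moreover have "single W' \<tau>' z'" using single_transfer[OF z(1) z'] .
    ultimately show "t \<in> ?R" using z(2,3) z'(2) x2(3) by (auto intro!: image_eqI[of _ _ z'])
  qed
  thus ?thesis using x(1,2) by (auto simp: fine_type_def)
qed

text \<open>If one of the two vertices is unique in its type, the fine type of the other records the
  adjacency. Otherwise the game supplies a pair \<open>x\<close>, \<open>z\<close> that has the
  types of \<open>y1\<close>, \<open>y2\<close> and is joined as these are, and homogeneity moves
  \<open>x1\<close>, \<open>x2\<close> to \<open>x\<close>, \<open>z\<close> one vertex at a
  time.\<close>

lemma fine_type_adj:
  assumes "x1 \<in> W" "x2 \<in> W" "x1 \<noteq> x2" "y1 \<in> W'" "y2 \<in> W'" "y1 \<noteq> y2"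
    and "fine_type E W \<tau> x1 = fine_type E' W' \<tau>' y1" "fine_type E W \<tau> x2 = fine_type E' W' \<tau>' y2"
  shows "(x1, x2) \<in> E \<longleftrightarrow> (y1, y2) \<in> E'"
proof -
  have \<tau>: "\<tau> x1 = \<tau>' y1" "\<tau> x2 = \<tau>' y2" using assms(7,8) by (auto simp: fine_type_def)
  have aux: "(a, b) \<in> E \<longleftrightarrow> (c, d) \<in> E'"
    if "single W \<tau> a" "d \<in> W'" "c \<in> W'" "\<tau> a = \<tau>' c" "fine_type E W \<tau> b = fine_type E' W' \<tau>' d" for a b c d
  proof -
    have c: "single W' \<tau>' c" using single_transfer[OF that(1,3)] that(4) by simp
    have "(a, b) \<in> E \<longleftrightarrow> \<tau> a \<in> snd (fine_type E W \<tau> b)"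
      using that(1) symD(1)[of a b] by (auto simp: fine_type_def single_def)
    moreover have "(c, d) \<in> E' \<longleftrightarrow> \<tau>' c \<in> snd (fine_type E' W' \<tau>' d)"
      using c symD(2)[of c d] by (auto simp: fine_type_def single_def)
    ultimately show ?thesis using that by simp
  qed
  show ?thesis
  proof (cases "single W \<tau> x1 \<or> single W \<tau> x2")
    case True
    thus ?thesis using aux[of x1 y2 y1 x2] aux[of x2 y1 y2 x1] assms \<tau> symD by metis
  next
    case False
    obtain x where x: "x \<in> W" "\<tau> x = \<tau>' y1"
      "\<And>y2. y2 \<in> W' \<Longrightarrow> \<exists>x2\<in>W. \<tau> x2 = \<tau>' y2 \<and> (x = x2 \<longleftrightarrow> y1 = y2) \<and> ((x, x2) \<in> E \<longleftrightarrow> (y1, y2) \<in> E')"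
      using backE[OF assms(4)] by metis
    obtain z where z: "z \<in> W" "\<tau> z = \<tau>' y2" "x \<noteq> z" "(x, z) \<in> E \<longleftrightarrow> (y1, y2) \<in> E'"
      using x(3)[OF assms(5)] assms(6) by blast
    have ns: "\<not> single W \<tau> x" "\<not> single W \<tau> z"
      using False x z \<tau> assms(1,2) unfolding single_def by metis+
    have "(x1, x2) \<in> E \<longleftrightarrow> (x, z) \<in> E"
    \<comment> \<open>Replacing \<open>x2\<close> by \<open>z\<close> first would create the pair of
      \<open>x1\<close> with itself when \<open>x1 = z\<close>; in that case all vertices involved
      have one type and a single replacement is enough.\<close>
    proof (cases "x1 = z")
      case False
      have "(x1, x2) \<in> E \<longleftrightarrow> (x1, z) \<in> E" using hom[of x1 x2 z] assms x z \<tau> \<open>\<not> (single W \<tau> x1 \<or> single W \<tau> x2)\<close> False by auto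
      moreover have "(z, x1) \<in> E \<longleftrightarrow> (z, x) \<in> E" using hom[of z x1 x] assms x z \<tau> ns False by auto
      ultimately show ?thesis using symD by metis
    next
      case True
      have "(x1, x2) \<in> E \<longleftrightarrow> (x1, x) \<in> E" using hom[of x1 x2 x] assms x z \<tau> \<open>\<not> (single W \<tau> x1 \<or> single W \<tau> x2)\<close> True by auto
      thus ?thesis using True symD by metis
    qed
    thus ?thesis using z by simp
  qed
qed

end

text \<open>The position after the base vertices \<open>\<alpha> i\<close> have been paired with
  \<open>\<beta> i\<close>, with two more rounds to survive for Spoiler in either structure.
  Indexing by \<open>I\<close> keeps the two structures on an equal footing, so that results can be
  swapped.\<close>

locale base_game =
  fixes A :: "'a pair_pre_digraph" and B :: "'b pair_pre_digraph"
    and I :: "'i set" and \<alpha> :: "'i \<Rightarrow> 'a" and \<beta> :: "'i \<Rightarrow> 'b"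
  assumes simple: "simple A" "simple B"
    and inj: "inj_on \<alpha> I" "inj_on \<beta> I"
    and range: "\<alpha> ` I \<subseteq> pverts A" "\<beta> ` I \<subseteq> pverts B"
    and survive: "survives A B 2 ((\<lambda>i. (\<alpha> i, \<beta> i)) ` I)" "survives B A 2 ((\<lambda>i. (\<beta> i, \<alpha> i)) ` I)"
    and homogeneous: "homogeneous_on (parcs A) (pverts A - \<alpha> ` I) (type_over A I \<alpha>)"
begin

abbreviation "pos \<equiv> (\<lambda>i. (\<alpha> i, \<beta> i)) ` I"
abbreviation "WA \<equiv> pverts A - \<alpha> ` I"
abbreviation "WB \<equiv> pverts B - \<beta> ` I"
abbreviation "\<tau>A \<equiv> type_over A I \<alpha>"
abbreviation "\<tau>B \<equiv> type_over B I \<beta>"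
abbreviation "fineA \<equiv> fine_type (parcs A) WA \<tau>A"
abbreviation "fineB \<equiv> fine_type (parcs B) WB \<tau>B"

end

lemma conforms_outside:
  assumes "conforms A B p" "(\<lambda>i. (\<alpha> i, \<beta> i)) ` I \<subseteq> p" "(x, y) \<in> p"
  shows "x \<in> \<alpha> ` I \<longleftrightarrow> y \<in> \<beta> ` I" "type_over A I \<alpha> x = type_over B I \<beta> y"
proof -
  have i: "(x = \<alpha> i \<longleftrightarrow> y = \<beta> i) \<and> ((x, \<alpha> i) \<in> parcs A \<longleftrightarrow> (y, \<beta> i) \<in> parcs B)" if "i \<in> I" for i
    using conformsD[OF assms(1,3)] assms(2) that by (metis (no_types, lifting) image_subset_iff)
  show "x \<in> \<alpha> ` I \<longleftrightarrow> y \<in> \<beta> ` I" using i by blast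
  show "type_over A I \<alpha> x = type_over B I \<beta> y" using i by (auto simp: type_over_def)
qed

lemma survives_forth_step:
  assumes "survives A B 2 ((\<lambda>i. (\<alpha> i, \<beta> i)) ` I)"
  shows "forth_step (parcs B) (pverts B - \<beta> ` I) (type_over B I \<beta>)
    (parcs A) (pverts A - \<alpha> ` I) (type_over A I \<alpha>)"
  unfolding forth_step_def
proof
  let ?p = "(\<lambda>i. (\<alpha> i, \<beta> i)) ` I"
  fix y assume y: "y \<in> pverts B - \<beta> ` I"
  then obtain x where x: "x \<in> pverts A" "survives A B (Suc 0) (insert (x, y) ?p)"
    using assms by (auto simp: numeral_2_eq_2)
  have 1: "\<exists>x2\<in>pverts A. conforms A B (insert (x2, y2) (insert (x, y) ?p))" if "y2 \<in> pverts B" for y2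
    using x(2) that by auto
  have "conforms A B (insert (x, y) ?p)"
    using survives_conforms[OF x(2)] y by auto
  hence "x \<notin> \<alpha> ` I" "type_over A I \<alpha> x = type_over B I \<beta> y"
    using conforms_outside[of A B "insert (x, y) ?p" \<alpha> \<beta> I x y] y by auto
  moreover have "\<exists>x2\<in>pverts A - \<alpha> ` I. type_over A I \<alpha> x2 = type_over B I \<beta> y2 \<and>
      (x = x2 \<longleftrightarrow> y = y2) \<and> ((x, x2) \<in> parcs A \<longleftrightarrow> (y, y2) \<in> parcs B)" if y2: "y2 \<in> pverts B - \<beta> ` I" for y2
  proof -
    obtain x2 where x2: "x2 \<in> pverts A" "conforms A B (insert (x2, y2) (insert (x, y) ?p))"
      using 1 y2 by blast
    have "x2 \<notin> \<alpha> ` I" "type_over A I \<alpha> x2 = type_over B I \<beta> y2"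
      using conforms_outside[OF x2(2), of \<alpha> \<beta> I x2 y2] y2 by auto
    moreover have "(x = x2 \<longleftrightarrow> y = y2) \<and> ((x, x2) \<in> parcs A \<longleftrightarrow> (y, y2) \<in> parcs B)"
      using conformsD[OF x2(2), of x y x2 y2] by blast
    ultimately show ?thesis using x2(1) by blast
  qed
  ultimately show "\<exists>x\<in>pverts A - \<alpha> ` I. type_over A I \<alpha> x = type_over B I \<beta> y \<and>
      (\<forall>y2\<in>pverts B - \<beta> ` I. \<exists>x2\<in>pverts A - \<alpha> ` I. type_over A I \<alpha> x2 = type_over B I \<beta> y2 \<and>
        (x = x2 \<longleftrightarrow> y = y2) \<and> ((x, x2) \<in> parcs A \<longleftrightarrow> (y, y2) \<in> parcs B))"
    using x(1) by blast
qed

section \<open>Comparison of fibres of fine types\<close>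

definition embedding :: "'a pair_pre_digraph \<Rightarrow> 'b pair_pre_digraph \<Rightarrow> ('a \<Rightarrow> 'b) \<Rightarrow> bool" where
  "embedding A B h \<longleftrightarrow> inj_on h (pverts A) \<and> h ` pverts A \<subseteq> pverts B \<and>
     (\<forall>x\<in>pverts A. \<forall>y\<in>pverts A. (x, y) \<in> parcs A \<longleftrightarrow> (h x, h y) \<in> parcs B)"

text \<open>The last condition does not follow from the others: a new vertex similar and adjacent to
  \<open>v\<close> separates \<open>v\<close> from class members that are not adjacent to
  \<open>v\<close>. It ensures that classes are not split, so class sizes can only grow.\<close>

definition class_extension :: "'a pair_pre_digraph \<Rightarrow> 'b pair_pre_digraph \<Rightarrow> ('a \<Rightarrow> 'b) \<Rightarrow> 'a \<Rightarrow> bool" where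
  "class_extension A B h v \<longleftrightarrow> embedding A B h \<and> v \<in> pverts A \<and> h ` pverts A \<noteq> pverts B \<and>
     (\<forall>y\<in>pverts B - h ` pverts A. similar B (h v) y) \<and>
     (\<forall>u w. similar A u w \<longrightarrow> similar B (h u) (h w))"

context base_game
begin

sublocale two_step "parcs A" WA \<tau>A "parcs B" WB \<tau>B
proof
  show "sym (parcs A)" "sym (parcs B)" using simple by (auto simp: simple_def)
  show "forth_step (parcs A) WA \<tau>A (parcs B) WB \<tau>B" using survives_forth_step[OF survive(2)] .
  show "forth_step (parcs B) WB \<tau>B (parcs A) WA \<tau>A" using survives_forth_step[OF survive(1)] .
qed (rule homogeneous)

lemma swapped_game: "base_game B A I \<beta> \<alpha>"
  using simple inj range survive homogeneous' by unfold_locales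

lemma finite_W: "finite WA" "finite WB"
  using simple by (auto simp: simple_def)

lemma fine_types_eq: "fineA ` WA = fineB ` WB"
  using fine_type_back two_step.fine_type_back[OF swapped] by (auto simp: image_iff) metis+

abbreviation "fibreA t \<equiv> {x \<in> WA. fineA x = t}"
abbreviation "fibreB t \<equiv> {y \<in> WB. fineB y = t}"

lemma conforms_pos: "pverts B \<noteq> {} \<Longrightarrow> conforms A B pos"
  using survives_conforms[OF survive(1)] by simp

text \<open>Spoiler selects one more vertex of the fibre than \<open>A\<close> contains. Some answer
  then has a different fine type, although its coarse type is right, and the last round tests an
  adjacency on which the fine types differ.\<close>

lemma fibre_not_larger:
  assumes "survives A B (card (fibreA t) + 2) pos" "pverts B \<noteq> {}"
  shows "card (fibreB t) \<le> card (fibreA t)"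
proof (rule ccontr)
  assume "\<not> ?thesis"
  hence "Suc (card (fibreA t)) \<le> card (fibreB t)" by simp
  then obtain T where T: "T \<subseteq> fibreB t" "card T = Suc (card (fibreA t))" "finite T"
    by (meson obtain_subset_with_card_n finite_W(2) finite_subset)
  have "survives A B (1 + card T) pos" using assms(1) T(2) by (simp add: numeral_2_eq_2 del: survives.simps)
  moreover have "T \<subseteq> pverts B" using T(1) by blast
  ultimately obtain g where g: "g ` T \<subseteq> pverts A" "survives A B 1 (pos \<union> (\<lambda>y. (g y, y)) ` T)"
    using survives_pick[OF T(3)] by blast
  let ?p = "pos \<union> (\<lambda>y. (g y, y)) ` T"
  have conf: "conforms A B ?p" using survives_conforms[OF g(2) assms(2)] .
  have gW: "g y \<in> WA" "\<tau>A (g y) = \<tau>B y" if "y \<in> T" for y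
    using conforms_outside[OF conf, of \<alpha> \<beta> I "g y" y] that T(1) g(1) by auto
  have inj: "inj_on g T"
    by (rule inj_onI, rule conformsD(1)[OF conf, THEN iffD1]) auto
  have "finite (fibreA t)" by (rule finite_subset[OF _ finite_W(1)]) blast
  hence "\<not> g ` T \<subseteq> fibreA t"
    using card_mono[of "fibreA t" "g ` T"] T(2) card_image[OF inj] by auto
  then obtain y where y: "y \<in> T" "g y \<notin> fibreA t" unfolding image_subset_iff by meson
  hence "fineA (g y) \<noteq> t" using gW(1)[OF y(1)] by blast
  note y = y(1) this
  have yB: "y \<in> WB" "fineB y = t" using T(1) y(1) by auto
  have move: "\<exists>x\<in>WA. \<tau>A x = \<tau>B z \<and> ((g y, x) \<in> parcs A \<longleftrightarrow> (y, z) \<in> parcs B)" if z: "z \<in> WB" for z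
  proof -
    obtain x where x: "x \<in> pverts A" "conforms A B (insert (x, z) ?p)" using g(2) z by auto
    show ?thesis
      using conforms_outside[OF x(2), of \<alpha> \<beta> I x z] conformsD(2)[OF x(2), of "g y" y x z] x(1) z y(1)
      by (intro bexI[of _ x]) auto
  qed
  have "snd (fineA (g y)) \<subseteq> snd (fineB y)"
  proof
    fix s assume "s \<in> snd (fineA (g y))"
    then obtain a where a: "single WA \<tau>A a" "(g y, a) \<in> parcs A" "s = \<tau>A a" by (auto simp: fine_type_def)
    hence "a \<in> WA" by (simp add: single_def)
    \<comment> \<open>Spoiler does not have to switch in order to test \<open>a\<close>: he selects
      the vertex \<open>z\<close> of the same type in \<open>B\<close>, and \<open>a\<close> is the
      only possible answer.\<close>
    then obtain z where z: "z \<in> WB" "\<tau>B z = \<tau>A a" by (rule forthE)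
    obtain x where x: "x \<in> WA" "\<tau>A x = \<tau>B z" "(g y, x) \<in> parcs A \<longleftrightarrow> (y, z) \<in> parcs B" using move[OF z(1)] by blast
    hence "x = a" using a(1) z(2) by (auto simp: single_def)
    moreover have "single WB \<tau>B z" using single_transfer[OF a(1) z] .
    ultimately show "s \<in> snd (fineB y)" using a(2,3) z(2) x(3)
      by (auto simp: fine_type_def intro!: image_eqI[of _ _ z])
  qed
  moreover have "snd (fineB y) \<subseteq> snd (fineA (g y))"
  proof
    fix s assume "s \<in> snd (fineB y)"
    then obtain z where z: "single WB \<tau>B z" "(y, z) \<in> parcs B" "s = \<tau>B z" by (auto simp: fine_type_def)
    then obtain x where x: "x \<in> WA" "\<tau>A x = \<tau>B z" "(g y, x) \<in> parcs A" using move[of z] by (auto simp: single_def)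
    moreover have "single WA \<tau>A x" using single_transfer_back[OF z(1) x(1,2)] .
    ultimately show "s \<in> snd (fineA (g y))" using z(3)
      by (auto simp: fine_type_def intro!: image_eqI[of _ _ x])
  qed
  ultimately have "fineA (g y) = fineB y" using gW(2)[OF y(1)] by (auto simp: fine_type_def)
  thus False using y(2) yB(2) by simp
qed

text \<open>The base pairing is combined with an arbitrary injection on each fibre. Adjacencies are
  preserved because they depend only on base indices and fine types, and vertices are missed only in
  fibres that are strictly larger in \<open>B\<close>.\<close>

lemma fine_embedding:
  assumes le: "\<And>t. card (fibreA t) \<le> card (fibreB t)" and "pverts B \<noteq> {}"
  obtains h where "embedding A B h" "\<And>i. i \<in> I \<Longrightarrow> h (\<alpha> i) = \<beta> i"
    "\<And>x. x \<in> WA \<Longrightarrow> h x \<in> WB \<and> fineB (h x) = fineA x"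
    "\<And>y. y \<in> pverts B - h ` pverts A \<Longrightarrow> y \<in> WB \<and> card (fibreA (fineB y)) < card (fibreB (fineB y))"
proof -
  have fin: "finite (fibreA t)" "finite (fibreB t)" for t
    by (rule finite_subset[OF _ finite_W(1)], blast, rule finite_subset[OF _ finite_W(2)], blast)
  have "\<forall>t. \<exists>g. g ` fibreA t \<subseteq> fibreB t \<and> inj_on g (fibreA t)"
    using card_le_inj[OF fin le] by blast
  then obtain g where "\<forall>t. g t ` fibreA t \<subseteq> fibreB t \<and> inj_on (g t) (fibreA t)"
    by (rule choice[THEN exE])
  hence g: "inj_on (g t) (fibreA t)" "g t ` fibreA t \<subseteq> fibreB t" for t by blast+
  define h where "h x = (if x \<in> \<alpha> ` I then \<beta> (the_inv_into I \<alpha> x) else g (fineA x) x)" for x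
  have h\<alpha>: "h (\<alpha> i) = \<beta> i" if "i \<in> I" for i
    using that inj(1) by (simp add: h_def the_inv_into_f_f)
  have hW: "h x = g (fineA x) x" if "x \<in> WA" for x using that by (simp add: h_def)
  have hW': "h x \<in> WB \<and> fineB (h x) = fineA x" if "x \<in> WA" for x
    using g(2)[of "fineA x"] that unfolding hW[OF that] by blast
  have injW: "x = y" if "x \<in> WA" "y \<in> WA" "h x = h y" for x y
  proof -
    have "fineA x = fineA y" using hW' that by metis
    thus ?thesis using inj_onD[OF g(1)[of "fineA x"], of x y] that hW by auto
  qed
  have "inj_on h (pverts A)"
  proof (rule inj_onI)
    fix x y assume xy: "x \<in> pverts A" "y \<in> pverts A" "h x = h y"
    show "x = y"
    proof (cases "x \<in> \<alpha> ` I"; cases "y \<in> \<alpha> ` I")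
      assume "x \<in> \<alpha> ` I" "y \<in> \<alpha> ` I"
      then obtain i j where "i \<in> I" "x = \<alpha> i" "j \<in> I" "y = \<alpha> j" by blast
      thus ?thesis using h\<alpha> inj_onD[OF inj(2), of i j] xy(3) by simp
    next
      assume "x \<in> \<alpha> ` I" "y \<notin> \<alpha> ` I"
      moreover have "h x \<in> \<beta> ` I" using \<open>x \<in> \<alpha> ` I\<close> h\<alpha> by auto
      ultimately show ?thesis using hW'[of y] xy by auto
    next
      assume "x \<notin> \<alpha> ` I" "y \<in> \<alpha> ` I"
      moreover have "h y \<in> \<beta> ` I" using \<open>y \<in> \<alpha> ` I\<close> h\<alpha> by auto
      ultimately show ?thesis using hW'[of x] xy by auto
    next
      assume "x \<notin> \<alpha> ` I" "y \<notin> \<alpha> ` I"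
      thus ?thesis using injW xy by auto
    qed
  qed
  moreover have "h ` pverts A \<subseteq> pverts B"
  proof
    fix y assume "y \<in> h ` pverts A"
    then obtain x where x: "x \<in> pverts A" "y = h x" by blast
    show "y \<in> pverts B"
      using x h\<alpha> hW'[of x] range(2) by (cases "x \<in> \<alpha> ` I") auto
  qed
  moreover have "(x, y) \<in> parcs A \<longleftrightarrow> (h x, h y) \<in> parcs B" if xy: "x \<in> pverts A" "y \<in> pverts A" for x y
  proof -
    have mixed: "(x, \<alpha> i) \<in> parcs A \<longleftrightarrow> (h x, \<beta> i) \<in> parcs B" if "x \<in> WA" "i \<in> I" for x i
    proof -
      have "\<tau>A x = \<tau>B (h x)" using hW'[OF that(1)] by (auto simp: fine_type_def)
      thus ?thesis using that(2) by (auto simp: type_over_def)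
    qed
    show ?thesis
    proof (cases "x \<in> \<alpha> ` I"; cases "y \<in> \<alpha> ` I")
      assume "x \<in> \<alpha> ` I" "y \<in> \<alpha> ` I"
      then obtain i j where ij: "i \<in> I" "x = \<alpha> i" "j \<in> I" "y = \<alpha> j" by blast
      hence "(\<alpha> i, \<beta> i) \<in> pos" "(\<alpha> j, \<beta> j) \<in> pos" by auto
      thus ?thesis using h\<alpha> conformsD(2)[OF conforms_pos[OF assms(2)]] ij by simp
    next
      assume "x \<in> \<alpha> ` I" "y \<notin> \<alpha> ` I"
      thus ?thesis using h\<alpha> mixed[of y] xy simple_sym[OF simple(1), of x] simple_sym[OF simple(2), of "h x"] by auto
    next
      assume "x \<notin> \<alpha> ` I" "y \<in> \<alpha> ` I"
      thus ?thesis using h\<alpha> mixed[of x] xy by auto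
    next
      assume *: "x \<notin> \<alpha> ` I" "y \<notin> \<alpha> ` I"
      show ?thesis
      proof (cases "x = y")
        case True
        thus ?thesis using simple_irrefl simple by metis
      next
        case False
        show ?thesis
          using fine_type_adj[of x y "h x" "h y"] hW'[of x] hW'[of y] injW[of x y] * xy False by auto
      qed
    qed
  qed
  ultimately have emb: "embedding A B h" by (auto simp: embedding_def)
  have "y \<in> WB \<and> card (fibreA (fineB y)) < card (fibreB (fineB y))" if y: "y \<in> pverts B - h ` pverts A" for y
  proof
    have "\<beta> i \<in> h ` pverts A" if "i \<in> I" for i
      using h\<alpha>[OF that] range(1) that by (metis image_eqI image_subset_iff)
    thus yW: "y \<in> WB" using y by blast
    let ?t = "fineB y"
    have "y \<notin> g ?t ` fibreA ?t" using y hW by force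
    hence "g ?t ` fibreA ?t \<subset> fibreB ?t" using g(2)[of ?t] yW by blast
    hence "card (g ?t ` fibreA ?t) < card (fibreB ?t)" using fin(2) by (rule psubset_card_mono[rotated])
    thus "card (fibreA ?t) < card (fibreB ?t)" using card_image[OF g(1)[of ?t]] by simp
  qed
  thus ?thesis using that emb h\<alpha> hW' by blast
qed

text \<open>A fibre lies in one similarity class if its coarse type is shared: its vertices agree on
  the base by type, on unique vertices by fine type, and on the rest by homogeneity. The harder part
  is that the additional vertices do not separate vertices that are similar in
  \<open>A\<close>.\<close>

lemma fine_class_extension:
  assumes "\<And>t. t \<noteq> t0 \<Longrightarrow> card (fibreA t) = card (fibreB t)" "card (fibreA t0) < card (fibreB t0)"
  obtains h v where "class_extension A B h v"
proof -
  interpret sw: base_game B A I \<beta> \<alpha> by (rule swapped_game)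
  have "fibreB t0 \<noteq> {}" using assms(2) by (metis card.empty not_less_zero)
  then obtain y0 where y0: "y0 \<in> fibreB t0" by blast
  hence VB: "pverts B \<noteq> {}" by blast
  have le: "card (fibreA t) \<le> card (fibreB t)" for t using assms by (cases "t = t0") auto
  obtain h where h: "embedding A B h" "\<And>i. i \<in> I \<Longrightarrow> h (\<alpha> i) = \<beta> i"
    "\<And>x. x \<in> WA \<Longrightarrow> h x \<in> WB \<and> fineB (h x) = fineA x"
    "\<And>y. y \<in> pverts B - h ` pverts A \<Longrightarrow> y \<in> WB \<and> card (fibreA (fineB y)) < card (fibreB (fineB y))"
    using fine_embedding[OF le VB] by blast
  have new: "y \<in> WB \<and> fineB y = t0" if "y \<in> pverts B - h ` pverts A" for y
    using h(4)[OF that] assms(1) by (cases "fineB y = t0") auto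
  have hinj: "x = y" if "h x = h y" "x \<in> pverts A" "y \<in> pverts A" for x y
    using h(1) that by (auto simp: embedding_def dest: inj_onD)
  have hV: "h x \<in> pverts B" if "x \<in> pverts A" for x
    using h(1) that by (auto simp: embedding_def)
  have hadj: "(x, y) \<in> parcs A \<longleftrightarrow> (h x, h y) \<in> parcs B" if "x \<in> pverts A" "y \<in> pverts A" for x y
    using h(1) that by (auto simp: embedding_def)
  have "t0 \<in> fineA ` WA" using fine_types_eq y0 by auto
  then obtain v where v: "v \<in> WA" "fineA v = t0" by blast
  have hv: "h v \<in> WB" "fineB (h v) = t0" using h(3) v by auto
  have "\<not> fibreB t0 \<subseteq> h ` WA"
  proof
    assume sub: "fibreB t0 \<subseteq> h ` WA"
    have "fibreB t0 \<subseteq> h ` fibreA t0"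
    proof
      fix y assume "y \<in> fibreB t0"
      moreover then obtain x where "x \<in> WA" "y = h x" using sub by blast
      ultimately show "y \<in> h ` fibreA t0" using h(3)[of x] by auto
    qed
    moreover have fin: "finite (fibreA t0)" by (rule finite_subset[OF _ finite_W(1)]) blast
    ultimately have "card (fibreB t0) \<le> card (h ` fibreA t0)" by (intro card_mono finite_imageI)
    also have "\<dots> \<le> card (fibreA t0)" using fin by (rule card_image_le)
    finally have "card (fibreB t0) \<le> card (fibreA t0)" .
    thus False using assms(2) by simp
  qed
  then obtain r where r: "r \<in> fibreB t0" "r \<notin> h ` WA" by blast
  have "r \<notin> h ` pverts A" using r h(2) range(1) by (auto simp: image_iff)
  hence ne: "h ` pverts A \<noteq> pverts B" using r(1) by blast
  \<comment> \<open>The fibre of \<open>t0\<close> has at least two elements in \<open>B\<close>, so \<open>v\<close> shares its coarse type with another vertex of \<open>A\<close>.\<close>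
  have "r \<noteq> h v" "\<tau>B r = \<tau>B (h v)" using r v(1) hv by (auto simp: fine_type_def)
  hence ns_hv: "\<not> single WB \<tau>B (h v)" using r(1) by (auto simp: single_def)
  have "\<tau>A v = \<tau>B (h v)" using hv(2) v(2) by (auto simp: fine_type_def)
  hence "\<not> single WA \<tau>A v" using single_transfer[of v "h v"] hv(1) ns_hv by auto
  then obtain c where c: "c \<in> WA" "c \<noteq> v" "\<tau>A c = \<tau>A v" using v(1) by (auto simp: single_def)
  have sim_fibre: "similar B a b" if "a \<in> fibreB t0" "b \<in> fibreB t0" for a b
  proof -
    have "fineB a = fineB b" using that by simp
    hence ab: "\<tau>B a = \<tau>B b" by (simp add: fine_type_def)
    have "(a, z) \<in> parcs B \<longleftrightarrow> (b, z) \<in> parcs B" if z: "z \<in> pverts B - {a, b}" for z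
    proof (cases "z \<in> \<beta> ` I")
      case True
      thus ?thesis using ab by (auto simp: type_over_def)
    next
      case False
      show ?thesis
      proof (cases "single WB \<tau>B z")
        case True
        have "(d, z) \<in> parcs B \<longleftrightarrow> \<tau>B z \<in> snd (fineB d)" for d
          using True by (auto simp: fine_type_def single_def)
        thus ?thesis using \<open>a \<in> fibreB t0\<close> \<open>b \<in> fibreB t0\<close> by simp
      next
        case ns: False
        have "(z, a) \<in> parcs B \<longleftrightarrow> (z, b) \<in> parcs B"
          using sw.hom[of z a b] ns z False ab \<open>a \<in> fibreB t0\<close> \<open>b \<in> fibreB t0\<close> by auto
        thus ?thesis using symD(2) by metis
      qed
    qed
    thus ?thesis using that by (auto simp: similar_def)
  qed
  have new_sim: "similar B (h v) y" if "y \<in> pverts B - h ` pverts A" for y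
    using sim_fibre new[OF that] hv by auto
  have lift: "similar B (h u) (h w)" if uw: "similar A u w" for u w
  proof -
    have uwV: "u \<in> pverts A" "w \<in> pverts A" using uw by (auto simp: similar_def)
    \<comment> \<open>The additional vertex \<open>z\<close> is joined to \<open>h w\<close> as
      \<open>h v\<close> is, hence as \<open>w\<close> to \<open>v\<close>; by homogeneity it is
      joined to \<open>h v\<close> as \<open>h c\<close> is. What remains is a statement about
      \<open>v\<close>, \<open>w\<close> and \<open>c\<close> in \<open>A\<close> alone.\<close>
    have one: "(h v, z) \<in> parcs B \<longleftrightarrow> (h w, z) \<in> parcs B"
      if w: "similar A v w" "w \<noteq> v" and z: "z \<in> pverts B - h ` pverts A" for w z
    proof -
      have wV: "w \<in> pverts A" and vV: "v \<in> pverts A" using w by (auto simp: similar_def)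
      have zW: "z \<in> WB" "fineB z = t0" using new[OF z] by auto
      have "(z, h w) \<in> parcs B \<longleftrightarrow> (h v, h w) \<in> parcs B"
        using similarD[OF similar_sym[OF new_sim[OF z]], of "h w"] hV[OF wV] z wV w(2) hinj[of w v] vV by blast
      hence 1: "(h w, z) \<in> parcs B \<longleftrightarrow> (w, v) \<in> parcs A"
        using hadj[OF wV vV] symD by metis
      have "\<tau>B z = \<tau>B (h c)" using zW c h(3)[OF c(1)] v by (auto simp: fine_type_def)
      moreover have "h c \<noteq> h v" using hinj[of c v] c v(1) by auto
      moreover have "z \<noteq> h v" using z vV by blast
      ultimately have "(h v, z) \<in> parcs B \<longleftrightarrow> (h v, h c) \<in> parcs B"
        using sw.hom[of "h v" z "h c"] hv(1) zW(1) h(3)[OF c(1)] ns_hv by auto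
      hence 2: "(h v, z) \<in> parcs B \<longleftrightarrow> (v, c) \<in> parcs A" using hadj[of v c] vV c(1) by blast
      have "(w, v) \<in> parcs A \<longleftrightarrow> (v, c) \<in> parcs A"
      proof (cases "w = c")
        case True
        thus ?thesis using symD by metis
      next
        case False
        \<comment> \<open>It remains to compare \<open>c\<close> and \<open>v\<close> as neighbours
          of \<open>w\<close>. For \<open>w\<close> in the base this is their common type; otherwise
          \<open>w\<close> also has that type, so homogeneity applies at \<open>w\<close>.\<close>
        have vc: "(v, c) \<in> parcs A \<longleftrightarrow> (w, c) \<in> parcs A" using similarD[OF w(1), of c] c False by auto
        show ?thesis
        proof (cases "w \<in> \<alpha> ` I")
          case True
          then obtain i where "i \<in> I" "w = \<alpha> i" by blast
          hence "(c, w) \<in> parcs A \<longleftrightarrow> (v, w) \<in> parcs A" using c(3) by (auto simp: type_over_def)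
          thus ?thesis using vc symD by metis
        next
          case False
          have "\<tau>A w = \<tau>A v"
          proof -
            have "(v, \<alpha> i) \<in> parcs A \<longleftrightarrow> (w, \<alpha> i) \<in> parcs A" if "i \<in> I" for i
              using similarD[OF w(1), of "\<alpha> i"] that range(1) v(1) False by auto
            thus ?thesis by (auto simp: type_over_def)
          qed
          hence "\<not> single WA \<tau>A w" using w(2) v(1) by (auto simp: single_def)
          hence "(w, c) \<in> parcs A \<longleftrightarrow> (w, v) \<in> parcs A"
            using hom[of w c v] c v(1) wV False w(2) \<open>w \<noteq> c\<close> by auto
          thus ?thesis using vc by simp
        qed
      qed
      thus ?thesis using 1 2 by simp
    qed
    have "(h u, z) \<in> parcs B \<longleftrightarrow> (h w, z) \<in> parcs B" if z: "z \<in> pverts B - {h u, h w}" for z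
    proof (cases "z \<in> h ` pverts A")
      case True
      then obtain x where x: "x \<in> pverts A" "z = h x" by blast
      thus ?thesis using similarD[OF uw, of x] z hadj uwV by auto
    next
      case False
      hence zn: "z \<in> pverts B - h ` pverts A" using z by blast
      \<comment> \<open>Towards every vertex other than \<open>h v\<close>, the additional vertex
        \<open>z\<close> behaves like \<open>h v\<close>.\<close>
      have gen: "(h x, z) \<in> parcs B \<longleftrightarrow> (x, v) \<in> parcs A" if "x \<in> pverts A" "x \<noteq> v" for x
      proof -
        have "(z, h x) \<in> parcs B \<longleftrightarrow> (h v, h x) \<in> parcs B"
          using similarD[OF similar_sym[OF new_sim[OF zn]], of "h x"] hV[OF that(1)] zn that hinj[of x v] v(1) by blast
        thus ?thesis using hadj[of v x] v(1) that symD by blast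
      qed
      consider "u = w" | "u = v" "w \<noteq> v" | "w = v" "u \<noteq> v" | "u \<noteq> v" "w \<noteq> v" by blast
      thus ?thesis
      proof cases
        case 4
        have "(v, u) \<in> parcs A \<longleftrightarrow> (v, w) \<in> parcs A" using similarD[OF uw, of v] 4 v(1) symD by blast
        thus ?thesis using gen[OF uwV(1)] gen[OF uwV(2)] 4 symD by metis
      qed (use one[of w z] one[of u z] uw similar_sym[OF uw] zn in auto)
    qed
    thus ?thesis using hV uwV by (auto simp: similar_def)
  qed
  have "class_extension A B h v"
    using h(1) v(1) ne new_sim lift by (auto simp: class_extension_def)
  thus ?thesis using that by blast
qed

end

section \<open>Graphs that differ in one similarity class\<close>

definition classes :: "'a pair_pre_digraph \<Rightarrow> 'a set set" where
  "classes A = sim_class A ` pverts A"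

lemma sim_class_eq_iff:
  assumes "simple A" "u \<in> pverts A" "w \<in> pverts A"
  shows "sim_class A u = sim_class A w \<longleftrightarrow> similar A u w"
proof
  assume "sim_class A u = sim_class A w"
  thus "similar A u w" using similar_refl[OF assms(3)] by (auto simp: sim_class_def)
next
  assume uw: "similar A u w"
  have "similar A u x \<longleftrightarrow> similar A w x" for x
    using similar_trans[OF assms(1) uw] similar_trans[OF assms(1) similar_sym[OF uw]] by metis
  thus "sim_class A u = sim_class A w" by (simp add: sim_class_def)
qed

lemma classes_disjoint:
  assumes "simple A" "c \<in> classes A" "d \<in> classes A" "x \<in> c" "x \<in> d"
  shows "c = d"
proof -
  obtain u w where uw: "u \<in> pverts A" "c = sim_class A u" "w \<in> pverts A" "d = sim_class A w"
    using assms(2,3) unfolding classes_def by blast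
  have "similar A u x" "similar A x w" using assms(4,5) uw similar_sym by (auto simp: sim_class_def)
  hence "similar A u w" using similar_trans[OF assms(1)] by blast
  thus ?thesis using sim_class_eq_iff[OF assms(1)] uw by simp
qed

lemma finite_classes: "simple A \<Longrightarrow> finite (classes A)"
  by (simp add: classes_def simple_def)

lemma class_eqI: "simple A \<Longrightarrow> c \<in> classes A \<Longrightarrow> x \<in> c \<Longrightarrow> c = sim_class A x"
  using classes_disjoint[of A c "sim_class A x" x] sim_class_subset
  by (auto simp: classes_def) (auto simp: sim_class_def similar_def)

lemma classes_memb: "c \<in> classes A \<Longrightarrow> c \<subseteq> pverts A \<and> c \<noteq> {}"
  using similar_refl sim_class_subset by (fastforce simp: classes_def sim_class_def)

lemma card_classes_le:
  assumes "simple A" "F \<subseteq> classes A" "\<And>c. c \<in> F \<Longrightarrow> m \<le> card c"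
  shows "card F * m \<le> card (\<Union>F)"
proof -
  have "card (\<Union>F) = sum card F"
  proof (rule card_Union_disjoint)
    show "pairwise disjnt F"
      using classes_disjoint[OF assms(1)] assms(2) unfolding pairwise_def disjnt_def by blast
    show "finite c" if "c \<in> F" for c
      using classes_memb[of c A] that assms(1,2) by (meson finite_subset simple_def subsetD)
  qed
  thus ?thesis using sum_bounded_below[of F m card] assms(3) by simp
qed

definition large_classes :: "'a pair_pre_digraph \<Rightarrow> nat \<Rightarrow> 'a set set" where
  "large_classes A s = {c \<in> classes A. s < card c}"

text \<open>Here \<open>A\<close> is always the smaller graph. The graph to be defined takes either
  role, which is why its order is bounded below in two ways, by \<open>small_order_bound\<close> and
  by \<open>big_order_bound\<close>.\<close>

locale extended =
  fixes A :: "'a pair_pre_digraph" and B :: "'b pair_pre_digraph" and h :: "'a \<Rightarrow> 'b" and v :: 'a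
  assumes simple: "simple A" "simple B" and ext: "class_extension A B h v"
begin

abbreviation "s \<equiv> card (sim_class A v)"
abbreviation "large \<equiv> large_classes A s"

lemma v: "v \<in> pverts A" using ext by (simp add: class_extension_def)

lemma fin: "finite (pverts A)" "finite (pverts B)" using simple by (auto simp: simple_def)

lemma hV: "x \<in> pverts A \<Longrightarrow> h x \<in> pverts B"
  using ext by (auto simp: class_extension_def embedding_def)

lemma hinj: "inj_on h (pverts A)"
  using ext by (auto simp: class_extension_def embedding_def)

lemma hadj: "x \<in> pverts A \<Longrightarrow> y \<in> pverts A \<Longrightarrow> (h x, h y) \<in> parcs B \<longleftrightarrow> (x, y) \<in> parcs A"
  using ext by (auto simp: class_extension_def embedding_def)

lemma h_similar: "similar A u w \<Longrightarrow> similar B (h u) (h w)"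
  using ext by (auto simp: class_extension_def)

lemma h_similar_rev:
  assumes "u \<in> pverts A" "w \<in> pverts A" "similar B (h u) (h w)"
  shows "similar A u w"
  unfolding similar_def
proof (intro conjI ballI assms(1,2))
  fix z assume z: "z \<in> pverts A - {u, w}"
  hence "h z \<noteq> h u" "h z \<noteq> h w" using inj_onD[OF hinj] assms(1,2) by blast+
  thus "(u, z) \<in> parcs A \<longleftrightarrow> (w, z) \<in> parcs A"
    using similarD[OF assms(3), of "h z"] hV[of z] hadj assms(1,2) z by auto
qed

lemma class_size_image: "u \<in> pverts A \<Longrightarrow> card (sim_class A u) \<le> card (sim_class B (h u))"
proof -
  assume u: "u \<in> pverts A"
  have "h ` sim_class A u \<subseteq> sim_class B (h u)" using h_similar by (auto simp: sim_class_def)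
  moreover have "card (h ` sim_class A u) = card (sim_class A u)"
    using hinj sim_class_subset by (metis card_image inj_on_subset)
  ultimately show ?thesis using finite_sim_class[OF fin(2)] by (metis card_mono)
qed

lemma class_size_v: "s < card (sim_class B (h v))"
proof -
  obtain r where r: "r \<in> pverts B" "r \<notin> h ` pverts A"
    using ext hV by (auto simp: class_extension_def)
  hence "similar B (h v) r" using ext by (auto simp: class_extension_def)
  hence "insert r (h ` sim_class A v) \<subseteq> sim_class B (h v)" using h_similar by (auto simp: sim_class_def)
  moreover have "r \<notin> h ` sim_class A v" using r sim_class_subset[of A v] by blast
  moreover have "card (h ` sim_class A v) = s"
    using hinj sim_class_subset by (metis card_image inj_on_subset)
  moreover have "finite (h ` sim_class A v)" using finite_sim_class[OF fin(1)] by blast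
  ultimately have "Suc s \<le> card (sim_class B (h v))"
    using card_mono[OF finite_sim_class[OF fin(2)]] by (metis card_insert_disjoint)
  thus ?thesis by simp
qed

text \<open>The class of \<open>v\<close> and the \<open>large\<close> classes are pairwise
  disjoint, and each of the latter has at least \<open>Suc s\<close> vertices.\<close>

lemma small_order_bound: "s + card large * Suc s \<le> card (pverts A)"
proof -
  have "card large * Suc s \<le> card (\<Union>large)"
    by (rule card_classes_le[OF simple(1)]) (auto simp: large_classes_def)
  moreover have "sim_class A v \<inter> \<Union>large = {}"
  proof (rule ccontr)
    assume "\<not> ?thesis"
    then obtain x c where x: "x \<in> sim_class A v" "c \<in> large" "x \<in> c" by blast
    hence "c = sim_class A v"
      using classes_disjoint[OF simple(1), of c "sim_class A v" x] v by (auto simp: large_classes_def classes_def)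
    thus False using x(2) by (simp add: large_classes_def)
  qed
  moreover have "\<Union>large \<subseteq> pverts A" using classes_memb by (fastforce simp: large_classes_def)
  moreover from this have "card (sim_class A v \<union> \<Union>large) \<le> card (pverts A)"
    by (intro card_mono fin Un_least sim_class_subset)
  moreover have "finite (\<Union>large)" using calculation(3) fin(1) by (rule finite_subset)
  ultimately show ?thesis
    using card_Un_disjoint[OF finite_sim_class[OF fin(1)], of "\<Union>large" v] by simp
qed

definition rep :: "'a set \<Rightarrow> 'a" where
  "rep c = (SOME x. x \<in> c)"

definition reps :: "'b set" where
  "reps = insert (h v) (h ` rep ` large)"

lemma rep_large:
  assumes "c \<in> large"
  shows "rep c \<in> pverts A" "sim_class A (rep c) = c" "rep c \<in> c"
proof -
  have c: "c \<in> classes A" using assms by (simp add: large_classes_def)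
  hence "\<exists>x. x \<in> c" using classes_memb by blast
  thus "rep c \<in> c" unfolding rep_def by (rule someI_ex)
  thus "rep c \<in> pverts A" "sim_class A (rep c) = c" using classes_memb[OF c] class_eqI[OF simple(1) c] by auto
qed

lemma rep_v: "v \<notin> rep ` large"
proof
  assume "v \<in> rep ` large"
  then obtain c where c: "c \<in> large" "v = rep c" by blast
  hence "c = sim_class A v" using rep_large(2)[OF c(1)] by simp
  thus False using c(1) by (simp add: large_classes_def)
qed

lemma reps_subset: "reps \<subseteq> pverts B"
  using hV v rep_large(1) by (auto simp: reps_def)

lemma card_reps: "card reps = Suc (card large)"
proof -
  have fl: "finite large" using finite_classes[OF simple(1)] by (simp add: large_classes_def)
  have sub: "insert v (rep ` large) \<subseteq> pverts A" using v rep_large(1) by blast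
  have "inj_on rep large" by (rule inj_on_inverseI[of _ "sim_class A"]) (rule rep_large(2))
  hence "card (insert v (rep ` large)) = Suc (card large)" using rep_v fl by (simp add: card_image)
  moreover have "reps = h ` insert v (rep ` large)" by (simp add: reps_def)
  ultimately show ?thesis using card_image[OF inj_on_subset[OF hinj sub]] by simp
qed

lemma finite_reps: "finite reps"
  using card_reps by (metis card.infinite Zero_not_Suc)

lemma reps_preimage:
  assumes "p \<in> reps"
  obtains u where "u \<in> pverts A" "p = h u" "s < card (sim_class B p)" "u = v \<or> u \<in> rep ` large"
proof -
  obtain u where u: "p = h u" "u = v \<or> u \<in> rep ` large" using assms by (auto simp: reps_def)
  have uA: "u \<in> pverts A" using u v rep_large(1) by auto
  have "s < card (sim_class B p)"
  proof (cases "u = v")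
    case True thus ?thesis using class_size_v u by simp
  next
    case False
    then obtain c where c: "c \<in> large" "u = rep c" using u by blast
    hence "s < card (sim_class A u)" using rep_large(2) by (auto simp: large_classes_def)
    thus ?thesis using class_size_image[OF uA] u by simp
  qed
  thus ?thesis using that u uA by blast
qed

lemma reps_dissimilar:
  assumes "p \<in> reps" "q \<in> reps" "p \<noteq> q"
  shows "\<not> similar B p q"
proof
  assume sim: "similar B p q"
  obtain u where u: "u \<in> pverts A" "p = h u" "u = v \<or> u \<in> rep ` large" using reps_preimage[OF assms(1)] by metis
  obtain w where w: "w \<in> pverts A" "q = h w" "w = v \<or> w \<in> rep ` large" using reps_preimage[OF assms(2)] by metis
  have "similar A u w" using h_similar_rev u w sim by blast
  hence "sim_class A u = sim_class A w" using sim_class_eq_iff[OF simple(1)] u w by blast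
  moreover have "card (sim_class A x) > s" if "x \<in> rep ` large" for x
    using that rep_large(2) by (auto simp: large_classes_def)
  ultimately have "u = w" using u(3) w(3) rep_large(2) by (metis imageE less_irrefl)
  thus False using u w assms(3) by simp
qed

text \<open>In the larger graph the class of \<open>h v\<close> also has more than \<open>s\<close>
  vertices, which gives one large class more than in \<open>A\<close>.\<close>

lemma big_order_bound: "Suc (card large) * Suc s \<le> card (pverts B)"
proof -
  have "inj_on (sim_class B) reps"
  proof (rule inj_onI)
    fix p q assume pq: "p \<in> reps" "q \<in> reps" "sim_class B p = sim_class B q"
    hence "similar B p q" using sim_class_eq_iff[OF simple(2)] reps_subset by blast
    thus "p = q" using reps_dissimilar pq by blast
  qed
  hence "card (sim_class B ` reps) = Suc (card large)" using card_reps by (metis card_image)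
  moreover have "card (sim_class B ` reps) * Suc s \<le> card (\<Union>(sim_class B ` reps))"
  proof (rule card_classes_le[OF simple(2)])
    show "sim_class B ` reps \<subseteq> classes B" using reps_subset by (auto simp: classes_def)
    show "Suc s \<le> card c" if "c \<in> sim_class B ` reps" for c
      using that reps_preimage by (metis Suc_leI imageE)
  qed
  moreover have "card (\<Union>(sim_class B ` reps)) \<le> card (pverts B)"
    using sim_class_subset fin(2) by (metis UN_least card_mono)
  ultimately show ?thesis by simp
qed

text \<open>Spoiler spends \<open>Suc (card large)\<close> rounds on \<open>reps\<close>,
  \<open>s\<close> rounds on further vertices of one class and one round on a separating vertex. The
  answers to \<open>reps\<close> are pairwise dissimilar, but \<open>A\<close> has only
  \<open>card large\<close> classes with more than \<open>s\<close> vertices, so one answer lies in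
  a class too small for the \<open>Suc s\<close> vertices selected from one class of
  \<open>B\<close>.\<close>

lemma not_survives_alt: "\<not> survives_alt B A (card large + s + 2) {}"
proof
  assume "survives_alt B A (card large + s + 2) {}"
  hence "survives_alt B A (Suc s + card reps) {}"
    by (simp add: card_reps add.commute numeral_2_eq_2 del: survives_alt.simps)
  then obtain f where f: "f ` reps \<subseteq> pverts A" "survives_alt B A (Suc s) ((\<lambda>p. (p, f p)) ` reps)"
    using survives_alt_pick[OF finite_reps reps_subset, of A "Suc s" "{}"] by auto
  let ?p = "(\<lambda>p. (p, f p)) ` reps"
  have nonempty: "pverts A \<noteq> {}" "pverts B \<noteq> {}" using v hV by auto
  have dissimilar: "\<not> similar A (f p) (f q)" if pq: "p \<in> reps" "q \<in> reps" "p \<noteq> q" for p q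
  proof
    assume sim: "similar A (f p) (f q)"
    obtain z where z: "z \<in> pverts B" "z \<noteq> p" "z \<noteq> q" "(p, z) \<in> parcs B \<longleftrightarrow> (q, z) \<notin> parcs B"
      using reps_dissimilar[OF pq] pq(1,2) reps_subset by (auto simp: similar_def)
    \<comment> \<open>If similar vertices answered the dissimilar \<open>p\<close> and
      \<open>q\<close>, selecting the vertex \<open>z\<close> that separates \<open>p\<close> from
      \<open>q\<close> would win at once, without a switch.\<close>
    have "survives_alt B A 1 ?p" using f(2) survives_alt_le[of B A "Suc s" ?p 1] nonempty by simp
    then obtain y where y: "y \<in> pverts A" "conforms B A (insert (z, y) ?p)" using z(1) by auto
    have "(p, f p) \<in> insert (z, y) ?p" "(q, f q) \<in> insert (z, y) ?p" using pq by auto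
    hence "y \<noteq> f p" "y \<noteq> f q" "(f p, y) \<in> parcs A \<longleftrightarrow> (p, z) \<in> parcs B" "(f q, y) \<in> parcs A \<longleftrightarrow> (q, z) \<in> parcs B"
      using conformsD[OF y(2), of p "f p" z y] conformsD[OF y(2), of q "f q" z y] z(2,3) by auto
    thus False using similarD[OF sim y(1)] z(4) by blast
  qed
  have "\<exists>p\<in>reps. card (sim_class A (f p)) \<le> s"
  proof (rule ccontr)
    assume neg: "\<not> ?thesis"
    have "(\<lambda>p. sim_class A (f p)) ` reps \<subseteq> large"
      using neg f(1) by (auto simp: large_classes_def classes_def)
    moreover have "inj_on (\<lambda>p. sim_class A (f p)) reps"
    proof (rule inj_onI)
      fix p q assume pq: "p \<in> reps" "q \<in> reps" "sim_class A (f p) = sim_class A (f q)"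
      hence "similar A (f p) (f q)" using sim_class_eq_iff[OF simple(1)] f(1) by blast
      thus "p = q" using dissimilar pq by blast
    qed
    moreover have "finite large" using finite_classes[OF simple(1)] by (simp add: large_classes_def)
    ultimately have "card reps \<le> card large" by (metis card_inj_on_le)
    thus False using card_reps by simp
  qed
  then obtain p where p: "p \<in> reps" "card (sim_class A (f p)) \<le> s" by blast
  have "s < card (sim_class B p)" using reps_preimage[OF p(1)] by metis
  moreover have "p \<in> pverts B" using reps_subset p(1) by blast
  moreover from this have "p \<in> sim_class B p" using similar_refl by (auto simp: sim_class_def)
  ultimately have "s \<le> card (sim_class B p - {p})" by simp
  then obtain S where S: "S \<subseteq> sim_class B p - {p}" "card S = s" "finite S"
    by (meson obtain_subset_with_card_n)
  have "S \<subseteq> pverts B" using S(1) sim_class_subset by fast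
  moreover have "survives_alt B A (1 + card S) ?p" using f(2) S(2) by simp
  ultimately obtain g where g: "g ` S \<subseteq> pverts A" "survives_alt B A 1 (?p \<union> (\<lambda>x. (x, g x)) ` S)"
    using survives_alt_pick[OF S(3)] by blast
  let ?q = "?p \<union> (\<lambda>x. (x, g x)) ` S"
  have conf: "conforms B A ?q"
    using survives_alt_le[OF g(2), of 0] nonempty by simp
  have inj: "inj_on g S"
    by (rule inj_onI, rule conformsD(1)[OF conf, THEN iffD2]) auto
  have "f p \<notin> g ` S"
  proof
    assume "f p \<in> g ` S"
    then obtain x where x: "x \<in> S" "f p = g x" by blast
    hence "p = x" using conformsD(1)[OF conf, of p "f p" x "g x"] p(1) by blast
    thus False using x(1) S(1) by blast
  qed
  hence "card (insert (f p) (g ` S)) = Suc s" using inj S(2,3) by (simp add: card_image)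
  hence "\<not> insert (f p) (g ` S) \<subseteq> sim_class A (f p)"
    using card_mono[OF finite_sim_class[OF fin(1)], of "insert (f p) (g ` S)" "f p"] p(2) by linarith
  moreover have fpA: "f p \<in> pverts A" using f(1) p(1) by blast
  ultimately obtain x where x: "x \<in> S" "\<not> similar A (f p) (g x)"
    using similar_refl[OF fpA] by (auto simp: sim_class_def)
  have gxA: "g x \<in> pverts A" using g(1) x(1) by blast
  obtain u where u: "u \<in> pverts A" "u \<noteq> f p" "u \<noteq> g x" "(f p, u) \<in> parcs A \<longleftrightarrow> (g x, u) \<notin> parcs A"
    using x(2) fpA gxA by (auto simp: similar_def)
  \<comment> \<open>The only switch: \<open>u\<close> separates two answers in \<open>A\<close>,
    whereas nothing in \<open>B\<close> separates the similar vertices \<open>p\<close> and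
    \<open>x\<close>.\<close>
  have "survives B A 1 ?q" using g(2) by (rule survives_alt_imp_survives)
  then obtain y where y: "y \<in> pverts B" "conforms B A (insert (y, u) ?q)" using u(1) by auto
  have "(p, f p) \<in> insert (y, u) ?q" "(x, g x) \<in> insert (y, u) ?q" using p x by auto
  hence "y \<noteq> p" "y \<noteq> x" "(p, y) \<in> parcs B \<longleftrightarrow> (f p, u) \<in> parcs A" "(x, y) \<in> parcs B \<longleftrightarrow> (g x, u) \<in> parcs A"
    using conformsD[OF y(2), of p "f p" y u] conformsD[OF y(2), of x "g x" y u] u(2,3) by auto
  moreover have "similar B p x" using x(1) S(1) by (auto simp: sim_class_def)
  ultimately show False using similarD[of B p x y] y(1) u(4) by blast
qed

text \<open>Spoiler selects \<open>Suc s\<close> vertices of the class in \<open>B\<close>. Their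
  answers are too many for the class of \<open>v\<close>, and also too many for its complement. So
  some answer outside the class is joined to one inside it in the way the class is joined to itself,
  which makes it a witness.\<close>

lemma not_survives:
  assumes "\<not> has_witness A v" "card (pverts A) + 1 < 2 * s"
  shows "\<not> survives A B (Suc s) {}"
proof
  assume "survives A B (Suc s) {}"
  obtain S where S: "S \<subseteq> sim_class B (h v)" "card S = Suc s" "finite S"
    using class_size_v by (meson Suc_leI finite_sim_class[OF fin(2)] obtain_subset_with_card_n)
  have "S \<subseteq> pverts B" using S(1) sim_class_subset by fast
  then obtain g where g: "g ` S \<subseteq> pverts A" "survives A B 0 ({} \<union> (\<lambda>y. (g y, y)) ` S)"
    using survives_pick[OF S(3), of B A 0 "{}"] \<open>survives A B (Suc s) {}\<close> S(2) by auto
  have conf: "conforms A B ((\<lambda>y. (g y, y)) ` S)" using g(2) by simp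
  have inj: "inj_on g S" by (rule inj_onI, rule conformsD(1)[OF conf, THEN iffD1]) auto
  hence cg: "card (g ` S) = Suc s" using S(2) by (simp add: card_image)
  have fc: "finite (sim_class A v)" using finite_sim_class[OF fin(1)] .
  have "\<not> g ` S \<subseteq> sim_class A v" using card_mono[OF fc] cg by (metis Suc_n_not_le_n)
  then obtain y where y: "y \<in> S" "g y \<notin> sim_class A v" by blast
  have "\<not> g ` S \<subseteq> pverts A - sim_class A v"
  proof
    assume "g ` S \<subseteq> pverts A - sim_class A v"
    hence "Suc s \<le> card (pverts A - sim_class A v)" using cg card_mono fin(1) by (metis finite_Diff)
    also have "\<dots> = card (pverts A) - s" using card_Diff_subset[OF fc sim_class_subset] .
    finally show False using assms(2) by simp
  qed
  then obtain z where z: "z \<in> S" "g z \<in> sim_class A v" using g(1) by blast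
  have "2 \<le> s" using assms(2) v fin(1) card_gt_0_iff[of "pverts A"] by auto
  hence "\<not> sim_class A v \<subseteq> {v}" using card_mono[of "{v}" "sim_class A v"] by auto
  then obtain u where u: "similar A v u" "u \<noteq> v" by (auto simp: sim_class_def)
  have uA: "u \<in> pverts A" using u by (simp add: similar_def)
  have "y \<noteq> z" using y z by auto
  have "similar B (h v) y" "similar B (h v) z" using y z S(1) by (auto simp: sim_class_def)
  moreover have "similar B (h v) (h u)" "h u \<noteq> h v" using h_similar[OF u(1)] u(2) inj_onD[OF hinj] uA v by auto
  ultimately have "(h v, h u) \<in> parcs B \<longleftrightarrow> (z, y) \<in> parcs B"
    using similar_homogeneous[OF simple(2), of "h v" "h u" z y] \<open>y \<noteq> z\<close> by auto
  moreover have "(g z, g y) \<in> parcs A \<longleftrightarrow> (z, y) \<in> parcs B"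
    using conformsD(2)[OF conf, of "g z" z "g y" y] y z by blast
  ultimately have 1: "(v, u) \<in> parcs A \<longleftrightarrow> (g z, g y) \<in> parcs A" using hadj[OF v uA] by simp
  have gyA: "g y \<in> pverts A" using g(1) y by blast
  have "g y \<noteq> v" "g y \<noteq> g z" using y z similar_refl[OF v] by (auto simp: sim_class_def)
  hence "(v, g y) \<in> parcs A \<longleftrightarrow> (g z, g y) \<in> parcs A"
    using similarD[of A v "g z" "g y"] z(2) gyA by (auto simp: sim_class_def)
  hence "has_witness A v"
    using u 1 y(2) gyA unfolding has_witness_def sim_class_def by blast
  thus False using assms(1) by contradiction
qed

end

section \<open>Round counts and the upper bound\<close>

lemma survives_simple:
  assumes "simple A" "survives A B 2 {}" "finite (pverts B)" "parcs B \<subseteq> pverts B \<times> pverts B"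
  shows "simple B"
proof -
  \<comment> \<open>The opponent may be any binary structure. Two moves in \<open>B\<close> expose a
    loop, selected twice, or an arc without its reverse.\<close>
  have step: "\<exists>x\<in>pverts A. \<exists>x2\<in>pverts A. conforms A B {(x2, y2), (x, y)}"
    if "y \<in> pverts B" "y2 \<in> pverts B" for y y2
    using assms(2) that by (fastforce simp: numeral_2_eq_2)
  have "(y, y) \<notin> parcs B" for y
  proof
    assume y: "(y, y) \<in> parcs B"
    then obtain x x2 where "conforms A B {(x2, y), (x, y)}" using step[of y y] assms(4) by blast
    thus False using conformsD(2)[of A B _ x y x y] y simple_irrefl[OF assms(1)] by auto
  qed
  moreover have "(z, y) \<in> parcs B" if yz: "(y, z) \<in> parcs B" for y z
  proof -
    obtain x x2 where "conforms A B {(x2, z), (x, y)}" using step[of y z] assms(4) yz by blast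
    thus ?thesis using conformsD(2)[of A B _ x y x2 z] conformsD(2)[of A B _ x2 z x y] yz simple_sym[OF assms(1), of x x2] by auto
  qed
  ultimately show ?thesis using assms(3,4) by (auto simp: simple_def sym_def irrefl_def)
qed

text \<open>Equivalent to (k - 1) (s - 1) \<ge> 0. With the order bounds it keeps
  \<open>k + s + 2\<close> rounds within half of the order plus 5.\<close>

lemma product_bound:
  fixes k s :: nat
  assumes "1 \<le> k" "1 \<le> s"
  shows "2 * (k + s + 2) \<le> s + k * Suc s + 5"
proof -
  obtain a b where "k = Suc a" "s = Suc b" using assms by (metis Suc_le_D One_nat_def)
  thus ?thesis by (simp add: algebra_simps)
qed

text \<open>The two lower bounds on \<open>K\<close> treat ordinary and exceptional graphs alike:
  \<open>K\<close> is at least (n + 5) / 2 rounded down, and it reaches \<open>large_rank\<close>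
  wherever that exceeds (n + 5) / 2.\<close>

locale rank_bound =
  fixes A :: "'a pair_pre_digraph" and K :: nat
  assumes simple_A: "simple A"
    and K_half: "\<And>m. 2 * m \<le> card (pverts A) + 5 \<Longrightarrow> m \<le> K"
    and K_large: "\<And>v. v \<in> pverts A \<Longrightarrow> card (pverts A) + 1 < 2 * card (sim_class A v) \<Longrightarrow>
      card (pverts A) + 5 < 2 * large_rank A v \<Longrightarrow> large_rank A v \<le> K"
begin

lemma class_card_pos: "simple C \<Longrightarrow> v \<in> pverts C \<Longrightarrow> 1 \<le> card (sim_class C v)"
  using similar_refl[of v C] finite_sim_class[of C v] card_gt_0_iff[of "sim_class C v"]
  by (auto simp: sim_class_def simple_def)

text \<open>The case in which the graph to be defined is the smaller one. \<open>K\<close> rounds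
  can be too few for \<open>not_survives_alt\<close> only if no class exceeds \<open>s\<close> and
  \<open>s\<close> is more than half of the order. Then \<open>K_large\<close> excludes a witness,
  and \<open>Suc s\<close> rounds are left for \<open>not_survives\<close>.\<close>

lemma no_extension:
  assumes "simple B" "class_extension A B h v" "survives_alt A B K {}" "survives_alt B A K {}"
  shows False
proof -
  interpret extended A B h v using simple_A assms(1,2) by unfold_locales
  have ne: "pverts A \<noteq> {}" "pverts B \<noteq> {}" using v hV by auto
  have notK: "K < card large + s + 2"
    using not_survives_alt survives_alt_le[OF assms(4) _ ne(2)] by (meson not_le)
  have "card large = 0"
    using notK K_half[of "card large + s + 2"] product_bound[of "card large" s] small_order_bound
      class_card_pos[OF simple_A v] by linarith
  hence s: "K < s + 2" using notK by simp
  hence "\<not> 2 * (s + 2) \<le> card (pverts A) + 5" using K_half[of "s + 2"] by auto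
  hence big: "card (pverts A) + 1 < 2 * s" by simp
  have nw: "\<not> has_witness A v"
    using K_large[OF v big] s big by (auto simp: large_rank_def)
  have "Suc s \<le> K"
    using K_large[OF v big] K_half[of "s + 1"] nw
    by (cases "2 * (s + 1) \<le> card (pverts A) + 5") (simp_all add: large_rank_def)
  hence "survives A B (Suc s) {}"
    using survives_alt_imp_survives[OF assms(3)] survives_le ne(2) by blast
  thus False using not_survives nw big by blast
qed

text \<open>The case in which the graph to be defined is the larger one. Its class of
  \<open>h v\<close> has at least \<open>s + 1\<close> vertices, so its \<open>large_rank\<close>
  already provides the \<open>s + 2\<close> rounds that \<open>not_survives_alt\<close>
  requires.\<close>

lemma not_extension:
  assumes "simple B" "class_extension B A h v" "survives_alt A B K {}"
  shows False
proof -
  interpret extended B A h v using simple_A assms(1,2) by unfold_locales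
  have ne: "pverts A \<noteq> {}" using v hV by auto
  have notK: "K < card large + s + 2"
    using not_survives_alt survives_alt_le[OF assms(3) _ ne] by (meson not_le)
  have "s + card large * Suc s \<le> card (pverts A)" using big_order_bound by simp
  hence "card large = 0"
    using notK K_half[of "card large + s + 2"] product_bound[of "card large" s]
      class_card_pos[OF assms(1) v] by linarith
  hence s: "K < s + 2" using notK by simp
  have "s + 2 \<le> large_rank A (h v)" using class_size_v by (simp add: large_rank_def)
  moreover have nle: "\<not> 2 * (s + 2) \<le> card (pverts A) + 5" using K_half[of "s + 2"] s by auto
  moreover have "card (pverts A) + 1 < 2 * card (sim_class A (h v))"
    using nle class_size_v by simp
  moreover have "card (pverts A) + 5 < 2 * large_rank A (h v)"
    using nle \<open>s + 2 \<le> large_rank A (h v)\<close> by simp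
  ultimately have "large_rank A (h v) \<le> K"
    using K_large[OF hV[OF v]] by blast
  thus False using \<open>s + 2 \<le> large_rank A (h v)\<close> s by simp
qed

lemma two_fibres_bound:
  assumes "base_game A B X (\<lambda>x. x) f" "X \<subseteq> pverts A"
    and "card X < card (type_over A X (\<lambda>x. x) ` (pverts A - X))" "t1 \<noteq> t2"
    and "\<mu> \<le> card {x \<in> pverts A - X. fine_type (parcs A) (pverts A - X) (type_over A X (\<lambda>x. x)) x = t1}"
    and "\<mu> \<le> card {x \<in> pverts A - X. fine_type (parcs A) (pverts A - X) (type_over A X (\<lambda>x. x)) x = t2}"
  shows "2 * (card X + \<mu> + 2) \<le> card (pverts A) + 5"
proof -
  let ?W = "pverts A - X" and ?\<tau> = "type_over A X (\<lambda>x. x)"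
  let ?F = "\<lambda>t. {x \<in> ?W. fine_type (parcs A) ?W ?\<tau> x = t}"
  let ?R = "?W - (?F t1 \<union> ?F t2)"
  have fin: "finite (pverts A)" using simple_A by (simp add: simple_def)
  have finF: "finite (?F t)" for t by (rule finite_subset[of _ "pverts A"]) (use fin in auto)
  \<comment> \<open>At most two coarse types vanish with the two fibres, so the vertices of
    \<open>?R\<close> still realise at least |X| - 1 types and are at least as many.\<close>
  have "?\<tau> ` ?W \<subseteq> ?\<tau> ` ?R \<union> {fst t1, fst t2}" by (auto simp: fine_type_def)
  hence "card (?\<tau> ` ?W) \<le> card (?\<tau> ` ?R \<union> {fst t1, fst t2})" using fin by (intro card_mono) auto
  also have "\<dots> \<le> card (?\<tau> ` ?R) + card {fst t1, fst t2}" by (rule card_Un_le)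
  also have "\<dots> \<le> card ?R + 2" using fin by (intro add_mono card_image_le) (auto simp: card_insert_if)
  finally have 1: "card (?\<tau> ` ?W) \<le> card ?R + 2" .
  have "?F t1 \<inter> ?F t2 = {}" using assms(4) by auto
  hence 2: "card (?F t1 \<union> ?F t2) = card (?F t1) + card (?F t2)" using finF by (intro card_Un_disjoint)
  have sub: "?F t1 \<union> ?F t2 \<subseteq> ?W" by auto
  have "card ?W = card ?R + card (?F t1 \<union> ?F t2)"
    using card_Diff_subset[OF _ sub] card_mono[OF _ sub] finF fin by simp
  moreover have "card (pverts A) = card X + card ?W"
    using assms(2) fin card_mono[OF fin assms(2)] by (simp add: card_Diff_subset finite_subset)
  ultimately show ?thesis using 1 2 assms(3,5,6) by simp
qed

theorem survives_imp_isomorphism: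
  assumes "finite (pverts B)" "parcs B \<subseteq> pverts B \<times> pverts B" "pverts A \<noteq> {}" "pverts B \<noteq> {}"
    and "survives_alt A B K {}" "survives_alt B A K {}"
  shows "\<exists>h. bij_betw h (pverts A) (pverts B) \<and>
    (\<forall>x\<in>pverts A. \<forall>y\<in>pverts A. (x, y) \<in> parcs A \<longleftrightarrow> (h x, h y) \<in> parcs B)"
proof -
  have finA: "finite (pverts A)" using simple_A by (simp add: simple_def)
  have n1: "1 \<le> card (pverts A)" using finA assms(3) by (simp add: Suc_leI card_gt_0_iff)
  have "survives A B 2 {}"
    using survives_le[OF survives_alt_imp_survives[OF assms(5)] K_half[of 2] assms(4)] n1 by simp
  hence simple_B: "simple B" using survives_simple simple_A assms(1,2) by blast
  obtain X where X: "X \<subseteq> pverts A" "card X < card (type_over A X (\<lambda>x. x) ` (pverts A - X))"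
    "homogeneous_on (parcs A) (pverts A - X) (type_over A X (\<lambda>x. x))"
    using exists_base[OF simple_A assms(3)] by blast
  have finX: "finite X" using X(1) finA finite_subset by blast
  \<comment> \<open>More than |X| types among n - |X| vertices give 2|X| + 1 \<le> n. Hence three
    rounds are left after \<open>X\<close> has been selected, and \<open>base_game\<close> asks for
    two.\<close>
  have "card (type_over A X (\<lambda>x. x) ` (pverts A - X)) \<le> card (pverts A) - card X"
    using card_image_le[of "pverts A - X" "type_over A X (\<lambda>x. x)"] finA finX X(1) by (simp add: card_Diff_subset)
  hence q: "card X + 3 \<le> K" using X(2) by (intro K_half) simp
  hence "survives_alt A B ((K - card X) + card X) {}" using assms(5) by simp
  then obtain f where f: "f ` X \<subseteq> pverts B" "survives_alt A B (K - card X) ((\<lambda>x. (x, f x)) ` X)"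
    using survives_alt_pick[OF finX X(1), of B "K - card X" "{}"] by auto
  let ?p = "(\<lambda>x. (x, f x)) ` X"
  have conv: "?p\<inverse> = (\<lambda>x. (f x, x)) ` X" by auto
  have surv: "survives A B m ?p" "survives B A m ((\<lambda>x. (f x, x)) ` X)" if "m + card X \<le> K" for m
    using survives_alt_imp_survives[OF f(2)] survives_alt_imp_survives_converse[OF f(2)]
      survives_le[of A B "K - card X" ?p m] survives_le[of B A "K - card X" _ m] assms(3,4) that conv by auto
  have conf: "conforms A B ?p" using survives_conforms surv(1)[of 0] q assms(4) by auto
  interpret base_game A B X "\<lambda>x. x" f
  proof
    show "inj_on f X" by (rule inj_onI, rule conformsD(1)[OF conf, THEN iffD2]) auto
    show "survives A B 2 ?p" "survives B A 2 ((\<lambda>x. (f x, x)) ` X)" using surv[of 2] q by auto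
  qed (use simple_A simple_B X f in auto)
  interpret sw: base_game B A X f "\<lambda>x. x" by (rule swapped_game)
  show ?thesis
  proof (cases "\<forall>t. card (fibreA t) = card (fibreB t)")
    case True
    have le: "card (fibreA t) \<le> card (fibreB t)" for t
      unfolding True[rule_format, of t] by (rule order_refl)
    obtain h where h: "embedding A B h"
      "\<And>y. y \<in> pverts B - h ` pverts A \<Longrightarrow> y \<in> WB \<and> card (fibreA (fineB y)) < card (fibreB (fineB y))"
      by (rule fine_embedding[OF le assms(4)]) blast
    have "y \<notin> pverts B - h ` pverts A" for y
      using h(2)[of y] True[rule_format, of "fineB y"] by linarith
    hence "pverts B - h ` pverts A = {}" by blast
    thus ?thesis using h(1) unfolding embedding_def bij_betw_def by blast
  next
    case False
    then obtain t0 where t0: "card (fibreA t0) \<noteq> card (fibreB t0)" by blast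
    have unique: "card (fibreA t) = card (fibreB t)" if "t \<noteq> t0" for t
    proof (rule ccontr)
      assume t: "card (fibreA t) \<noteq> card (fibreB t)"
      let ?\<mu> = "\<lambda>t. min (card (fibreA t)) (card (fibreB t))"
      \<comment> \<open>Applied to the fibre whose smaller version is the smaller of the two. Both
        fibres then have at least that many vertices in \<open>A\<close>, which makes the remaining
        rounds suffice, and Spoiler plays in the structure where the fibre is larger.\<close>
      have contra: False if t: "card (fibreA t) \<noteq> card (fibreB t)" "?\<mu> t \<le> ?\<mu> t'" "t \<noteq> t'" for t t'
      proof -
        have "2 * (card X + ?\<mu> t + 2) \<le> card (pverts A) + 5"
          using two_fibres_bound[OF base_game_axioms X(1,2) t(3), of "?\<mu> t"] t(2) by simp
        hence "card X + ?\<mu> t + 2 \<le> K" by (rule K_half)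
        hence "(?\<mu> t + 2) + card X \<le> K" by simp
        note s = surv[OF this]
        show False
        proof (cases "card (fibreA t) < card (fibreB t)")
          case True
          thus False using fibre_not_larger[of t] s(1) assms(4) by (simp add: min_def)
        next
          case False
          thus False using sw.fibre_not_larger[of t] s(2) assms(3) t(1) by (simp add: min_def split: if_splits)
        qed
      qed
      from nat_le_linear show False
      proof
        assume "?\<mu> t \<le> ?\<mu> t0" thus False using contra[OF t] that by blast
      next
        assume "?\<mu> t0 \<le> ?\<mu> t" thus False using contra[OF t0] that by blast
      qed
    qed
    show ?thesis
    proof (cases "card (fibreA t0) < card (fibreB t0)")
      case True
      obtain h v where ext: "class_extension A B h v" by (rule fine_class_extension[OF unique True])
      show ?thesis using no_extension[OF simple_B ext assms(5,6)] by (rule FalseE)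
    next
      case False
      hence lt: "card (fibreB t0) < card (fibreA t0)" using t0 by simp
      obtain h v where ext: "class_extension B A h v"
        by (rule sw.fine_class_extension[OF unique[symmetric] lt])
      show ?thesis using not_extension[OF simple_B ext assms(5)] by (rule FalseE)
    qed
  qed
qed

end

section \<open>Structured programs for the random access machine\<close>

text \<open>\<open>For i c\<close> runs \<open>c\<close> with register \<open>i\<close> going down
  from n - 1 to 0. With no other loops, the running time has a bound that depends on n alone and can
  be read off the syntax.\<close>

datatype cmd =
    Basic instr
  | Skip
  | Seq cmd cmd (infixr \<open>;;\<close> 60)
  | If0 nat cmd cmd
  | For nat cmd

fun exec_reg :: "(nat \<Rightarrow> nat) \<Rightarrow> instr \<Rightarrow> (nat \<Rightarrow> nat) \<Rightarrow> (nat \<Rightarrow> nat)" where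
  "exec_reg m (LoadConst i c) \<rho> = \<rho>(i := c)"
| "exec_reg m (AddReg i j k) \<rho> = \<rho>(i := \<rho> j + \<rho> k)"
| "exec_reg m (SubReg i j k) \<rho> = \<rho>(i := \<rho> j - \<rho> k)"
| "exec_reg m (Load i j) \<rho> = \<rho>(i := m (\<rho> j))"
| "exec_reg m (Store i j) \<rho> = \<rho>"
| "exec_reg m (JumpZero i l) \<rho> = \<rho>"

fun for_down :: "(nat \<Rightarrow> 's \<Rightarrow> 's) \<Rightarrow> nat \<Rightarrow> 's \<Rightarrow> 's" where
  "for_down f 0 s = s"
| "for_down f (Suc k) s = for_down f k (f k s)"

text \<open>
  Compiled programs keep the order \<open>n\<close> of the input graph in register 0, the number 1 in register 1
  and 0 in register 3. The latter turns \<open>JumpZero 3\<close> into an unconditional jump.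
\<close>

primrec sem :: "cmd \<Rightarrow> (nat \<Rightarrow> nat) \<Rightarrow> (nat \<Rightarrow> nat) \<Rightarrow> (nat \<Rightarrow> nat)" where
  "sem (Basic ins) = (\<lambda>m \<rho>. exec_reg m ins \<rho>)"
| "sem Skip = (\<lambda>m \<rho>. \<rho>)"
| "sem (c1 ;; c2) = (\<lambda>m \<rho>. sem c2 m (sem c1 m \<rho>))"
| "sem (If0 i c1 c2) = (\<lambda>m \<rho>. if \<rho> i = 0 then sem c1 m \<rho> else sem c2 m \<rho>)"
| "sem (For i c) = (\<lambda>m \<rho>. (for_down (\<lambda>k \<sigma>. sem c m (\<sigma>(i := k))) (\<rho> 0) \<rho>)(i := 0))"

primrec code_size :: "cmd \<Rightarrow> nat" where
  "code_size (Basic ins) = 1"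
| "code_size Skip = 0"
| "code_size (c1 ;; c2) = code_size c1 + code_size c2"
| "code_size (If0 i c1 c2) = 2 + code_size c2 + code_size c1"
| "code_size (For i c) = 4 + code_size c"

text \<open>The second argument is the absolute address of the code, needed for jump targets. The
  non-zero branch of \<open>If0\<close> comes first because \<open>JumpZero\<close> falls through to
  it.\<close>

primrec compile :: "cmd \<Rightarrow> nat \<Rightarrow> program" where
  "compile (Basic ins) = (\<lambda>b. [ins])"
| "compile Skip = (\<lambda>b. [])"
| "compile (c1 ;; c2) = (\<lambda>b. compile c1 b @ compile c2 (b + code_size c1))"
| "compile (If0 i c1 c2) = (\<lambda>b. JumpZero i (b + 2 + code_size c2) # compile c2 (b + 1) @
     JumpZero 3 (b + 2 + code_size c2 + code_size c1) # compile c1 (b + 2 + code_size c2))"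
| "compile (For i c) = (\<lambda>b. AddReg i 0 3 # JumpZero i (b + 4 + code_size c) # SubReg i i 1 #
     compile c (b + 3) @ [JumpZero 3 (b + 1)])"

text \<open>An upper bound, as both branches are charged. Each iteration of a loop adds the test,
  the decrement and the jump back; the copy of n and the last test are charged once.\<close>

primrec cost :: "cmd \<Rightarrow> nat \<Rightarrow> nat" where
  "cost (Basic ins) = (\<lambda>n. 1)"
| "cost Skip = (\<lambda>n. 0)"
| "cost (c1 ;; c2) = (\<lambda>n. cost c1 n + cost c2 n)"
| "cost (If0 i c1 c2) = (\<lambda>n. 2 + cost c1 n + cost c2 n)"
| "cost (For i c) = (\<lambda>n. 2 + n * (3 + cost c n))"

fun target :: "instr \<Rightarrow> nat set" where
  "target (LoadConst i c) = {i}"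
| "target (AddReg i j k) = {i}"
| "target (SubReg i j k) = {i}"
| "target (Load i j) = {i}"
| "target (Store i j) = {}"
| "target (JumpZero i l) = {}"

primrec writes :: "cmd \<Rightarrow> nat set" where
  "writes (Basic ins) = target ins"
| "writes Skip = {}"
| "writes (c1 ;; c2) = writes c1 \<union> writes c2"
| "writes (If0 i c1 c2) = writes c1 \<union> writes c2"
| "writes (For i c) = insert i (writes c)"

text \<open>
  Additions are restricted to small second summands, so that \<open>k\<close> steps only produce numbers that are
  polynomial in \<open>n\<close> and \<open>k\<close>; unrestricted addition would allow repeated doubling.
\<close>

fun tame :: "instr \<Rightarrow> bool" where
  "tame (LoadConst i c) \<longleftrightarrow> i \<notin> {0, 3} \<and> c \<le> 1"
| "tame (AddReg i j k) \<longleftrightarrow> k \<in> {0, 1, 3} \<and> i \<notin> {1, 3} \<and> (i = 0 \<longrightarrow> j = 0 \<and> k = 1)"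
| "tame (SubReg i j k) \<longleftrightarrow> i \<notin> {1, 3} \<and> (i = 0 \<longrightarrow> j = 0)"
| "tame (Load i j) \<longleftrightarrow> i \<notin> {0, 1, 3}"
| "tame (Store i j) \<longleftrightarrow> False"
| "tame (JumpZero i l) \<longleftrightarrow> True"

text \<open>A non-empty \<open>target\<close> rules out stores and jumps as basic commands, so
  memory stays fixed and control flow is structured.\<close>

primrec wf_cmd :: "cmd \<Rightarrow> bool" where
  "wf_cmd (Basic ins) \<longleftrightarrow> tame ins \<and> target ins \<noteq> {} \<and> target ins \<inter> {0, 1, 3} = {}"
| "wf_cmd Skip \<longleftrightarrow> True"
| "wf_cmd (c1 ;; c2) \<longleftrightarrow> wf_cmd c1 \<and> wf_cmd c2"
| "wf_cmd (If0 i c1 c2) \<longleftrightarrow> wf_cmd c1 \<and> wf_cmd c2"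
| "wf_cmd (For i c) \<longleftrightarrow> wf_cmd c \<and> i \<notin> {0, 1, 3} \<and> i \<notin> writes c"

lemma length_compile: "length (compile c b) = code_size c"
  by (induction c arbitrary: b) auto

text \<open>Loop rule for descending indices: \<open>I k\<close> describes the state in which all
  indices from \<open>k\<close> on have been processed.\<close>

lemma for_down_invariant:
  assumes "I n s" "\<And>k s. k < n \<Longrightarrow> I (Suc k) s \<Longrightarrow> I k (f k s)"
  shows "I 0 (for_down f n s)"
  using assms by (induction n arbitrary: s) auto

lemma sem_unchanged: "i \<notin> writes c \<Longrightarrow> sem c m \<rho> i = \<rho> i"
proof (induction c arbitrary: \<rho>)
  case (Basic ins) thus ?case by (cases ins) auto
next
  case (For j c)
  have "for_down (\<lambda>k \<sigma>. sem c m (\<sigma>(j := k))) (\<rho> 0) \<rho> i = \<rho> i"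
    by (rule for_down_invariant[where I = "\<lambda>k \<sigma>. \<sigma> i = \<rho> i"]) (use For in auto)
  thus ?case using For.prems by simp
qed auto

lemma wf_cmd_writes: "wf_cmd c \<Longrightarrow> writes c \<inter> {0, 1, 3} = {}"
  by (induction c) auto

section \<open>Correctness and number sizes of compiled programs\<close>

definition code_at :: "program \<Rightarrow> nat \<Rightarrow> program \<Rightarrow> bool" where
  "code_at p b xs \<longleftrightarrow> (\<exists>l r. p = l @ xs @ r \<and> length l = b)"

lemma code_at_Cons: "code_at p b (x # xs) \<Longrightarrow> b < length p \<and> p ! b = x \<and> code_at p (Suc b) xs"
proof -
  assume "code_at p b (x # xs)"
  then obtain l r where lr: "p = l @ (x # xs) @ r" "length l = b" by (auto simp: code_at_def)
  hence "p = (l @ [x]) @ xs @ r" "length (l @ [x]) = Suc b" by auto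
  hence "code_at p (Suc b) xs" unfolding code_at_def by blast
  thus ?thesis using lr by (auto simp: nth_append)
qed

lemma code_at_append: "code_at p b (xs @ ys) \<Longrightarrow> code_at p b xs \<and> code_at p (b + length xs) ys"
proof -
  assume "code_at p b (xs @ ys)"
  then obtain l r where "p = l @ (xs @ ys) @ r" "length l = b" by (auto simp: code_at_def)
  hence "p = l @ xs @ (ys @ r)" "p = (l @ xs) @ ys @ r" by auto
  thus ?thesis using \<open>length l = b\<close> unfolding code_at_def by (metis length_append)
qed

definition reaches :: "program \<Rightarrow> nat \<Rightarrow> ram_state \<Rightarrow> ram_state \<Rightarrow> bool" where
  "reaches p T s s' \<longleftrightarrow> (\<exists>k\<le>T. run p k s = s')"

lemma run_add: "run p (j + k) s = run p k (run p j s)"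
  unfolding run_def by (subst add.commute) (simp add: funpow_add)

lemma run_Suc: "run p (Suc k) s = step p (run p k s)"
  by (simp add: run_def)

lemma reaches_refl: "reaches p 0 s s"
  by (simp add: reaches_def run_def)

lemma reaches_trans [trans]: "reaches p T1 s s' \<Longrightarrow> reaches p T2 s' s'' \<Longrightarrow> reaches p (T1 + T2) s s''"
  unfolding reaches_def by (metis add_mono run_add)

lemma reaches_mono: "reaches p T s s' \<Longrightarrow> T \<le> T' \<Longrightarrow> reaches p T' s s'"
  unfolding reaches_def by (blast intro: le_trans)

lemma reaches_step:
  assumes "code_at p (pc s) (x # xs)"
  shows "reaches p 1 s (exec_instr x s)"
  using code_at_Cons[OF assms]
  by (auto simp: reaches_def run_def step_def halted_def intro!: exI[of _ 1])

abbreviation state :: "nat \<Rightarrow> (nat \<Rightarrow> nat) \<Rightarrow> (nat \<Rightarrow> nat) \<Rightarrow> ram_state" where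
  "state b \<rho> m \<equiv> \<lparr>pc = b, reg = \<rho>, mem = m\<rparr>"

lemma reaches_Basic:
  assumes "code_at p b (x # xs)" "target x \<noteq> {}"
  shows "reaches p 1 (state b \<rho> m) (state (Suc b) (exec_reg m x \<rho>) m)"
  using reaches_step[of p "state b \<rho> m" x xs] assms by (cases x) auto

lemma reaches_Jump:
  assumes "code_at p b (JumpZero i l # xs)"
  shows "reaches p 1 (state b \<rho> m) (state (if \<rho> i = 0 then l else Suc b) \<rho> m)"
  using reaches_step[of p "state b \<rho> m" "JumpZero i l" xs] assms by (cases "\<rho> i = 0") simp_all

lemma compile_correct:
  assumes "wf_cmd c" "code_at p b (compile c b)" "\<rho> 1 = 1" "\<rho> 3 = 0"
  shows "reaches p (cost c (\<rho> 0)) (state b \<rho> m) (state (b + code_size c) (sem c m \<rho>) m)"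
  using assms
proof (induction c arbitrary: b \<rho>)
  case (Basic ins)
  thus ?case using reaches_Basic[of p b ins "[]" \<rho> m] by simp
next
  case Skip
  thus ?case using reaches_refl by simp
next
  case (Seq c1 c2)
  have code: "code_at p b (compile c1 b)" "code_at p (b + code_size c1) (compile c2 (b + code_size c1))"
    using code_at_append Seq.prems(2) length_compile by fastforce+
  have fixed: "sem c1 m \<rho> 0 = \<rho> 0" "sem c1 m \<rho> 1 = \<rho> 1" "sem c1 m \<rho> 3 = \<rho> 3"
    using sem_unchanged wf_cmd_writes[of c1] Seq.prems(1) by auto
  have "reaches p (cost c1 (\<rho> 0)) (state b \<rho> m) (state (b + code_size c1) (sem c1 m \<rho>) m)"
    using Seq code by simp
  also have "reaches p (cost c2 (\<rho> 0)) \<dots> (state (b + code_size c1 + code_size c2) (sem c2 m (sem c1 m \<rho>)) m)"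
    using Seq.IH(2)[of "b + code_size c1" "sem c1 m \<rho>"] Seq.prems code fixed by simp
  finally show ?case by (simp add: add.assoc)
next
  case (If0 i c1 c2)
  let ?j = "JumpZero 3 (b + 2 + code_size c2 + code_size c1)"
  have code0: "code_at p b (JumpZero i (b + 2 + code_size c2) # compile c2 (b + 1) @ ?j # compile c1 (b + 2 + code_size c2))"
    using If0.prems(2) by simp
  hence "code_at p (Suc b) (compile c2 (b + 1) @ ?j # compile c1 (b + 2 + code_size c2))"
    using code_at_Cons by blast
  hence app: "code_at p (Suc b) (compile c2 (b + 1)) \<and>
      code_at p (Suc b + length (compile c2 (b + 1))) (?j # compile c1 (b + 2 + code_size c2))"
    by (rule code_at_append)
  have code2: "code_at p (Suc b) (compile c2 (Suc b))" using app by simp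
  have codej: "code_at p (Suc b + code_size c2) (?j # compile c1 (b + 2 + code_size c2))"
    using app unfolding length_compile by blast
  have "code_at p (Suc (Suc b + code_size c2)) (compile c1 (b + 2 + code_size c2))"
    using code_at_Cons[OF codej] by blast
  hence code1: "code_at p (b + 2 + code_size c2) (compile c1 (b + 2 + code_size c2))"
    by simp
  show ?case
  proof (cases "\<rho> i = 0")
    case True
    have "reaches p 1 (state b \<rho> m) (state (b + 2 + code_size c2) \<rho> m)"
      using reaches_Jump[OF code0, of \<rho> m] True by simp
    also have "reaches p (cost c1 (\<rho> 0)) \<dots> (state (b + 2 + code_size c2 + code_size c1) (sem c1 m \<rho>) m)"
      using If0.IH(1)[OF _ code1] If0.prems by simp
    finally have "reaches p (cost (If0 i c1 c2) (\<rho> 0)) (state b \<rho> m)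
        (state (b + 2 + code_size c2 + code_size c1) (sem c1 m \<rho>) m)" by (rule reaches_mono) simp
    thus ?thesis using True by (simp add: add.assoc)
  next
    case False
    have fixed: "sem c2 m \<rho> 3 = 0"
      using sem_unchanged[of 3 c2 m \<rho>] wf_cmd_writes[of c2] If0.prems by auto
    have "reaches p 1 (state b \<rho> m) (state (Suc b) \<rho> m)"
      using reaches_Jump[OF code0, of \<rho> m] False by simp
    also have "reaches p (cost c2 (\<rho> 0)) \<dots> (state (Suc b + code_size c2) (sem c2 m \<rho>) m)"
      using If0.IH(2)[OF _ code2] If0.prems by simp
    also have "reaches p 1 \<dots> (state (b + 2 + code_size c2 + code_size c1) (sem c2 m \<rho>) m)"
      using reaches_Jump[OF codej, of "sem c2 m \<rho>" m] fixed by simp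
    finally have "reaches p (cost (If0 i c1 c2) (\<rho> 0)) (state b \<rho> m)
        (state (b + 2 + code_size c2 + code_size c1) (sem c2 m \<rho>) m)" by (rule reaches_mono) simp
    thus ?thesis using False by (simp add: add.assoc)
  qed
next
  case (For i c)
  let ?end = "b + 4 + code_size c"
  let ?f = "\<lambda>k \<sigma>. sem c m (\<sigma>(i := k))"
  have code0: "code_at p b (AddReg i 0 3 # JumpZero i ?end # SubReg i i 1 # compile c (b + 3) @ [JumpZero 3 (b + 1)])"
    using For.prems(2) by simp
  hence code1: "code_at p (Suc b) (JumpZero i ?end # SubReg i i 1 # compile c (b + 3) @ [JumpZero 3 (b + 1)])"
    using code_at_Cons by blast
  hence code2: "code_at p (Suc (Suc b)) (SubReg i i 1 # compile c (b + 3) @ [JumpZero 3 (b + 1)])"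
    using code_at_Cons by blast
  hence "code_at p (Suc (Suc (Suc b))) (compile c (b + 3) @ [JumpZero 3 (b + 1)])"
    using code_at_Cons by blast
  hence "code_at p (b + 3) (compile c (b + 3) @ [JumpZero 3 (b + 1)])" by (simp add: numeral_3_eq_3)
  hence app: "code_at p (b + 3) (compile c (b + 3)) \<and>
      code_at p (b + 3 + length (compile c (b + 3))) [JumpZero 3 (b + 1)]"
    by (rule code_at_append)
  have code3: "code_at p (b + 3) (compile c (b + 3))" using app by blast
  have codej: "code_at p (b + 3 + code_size c) [JumpZero 3 (b + 1)]"
    using app unfolding length_compile by blast
  have i: "i \<notin> {0, 1, 3}" "i \<notin> writes c" "wf_cmd c" using For.prems(1) by auto
  have fixed: "sem c m \<sigma> 0 = \<sigma> 0" "sem c m \<sigma> 1 = \<sigma> 1" "sem c m \<sigma> 3 = \<sigma> 3" "sem c m \<sigma> i = \<sigma> i" for \<sigma>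
    using sem_unchanged wf_cmd_writes[of c] i by auto
  have loop: "reaches p (k * (3 + cost c (\<sigma> 0)) + 1) (state (Suc b) \<sigma> m) (state ?end ((for_down ?f k \<sigma>)(i := 0)) m)"
    if "\<sigma> i = k" "\<sigma> 1 = 1" "\<sigma> 3 = 0" for k \<sigma>
    using that
  proof (induction k arbitrary: \<sigma>)
    case 0
    have "\<sigma>(i := 0) = \<sigma>" using 0(1) by auto
    thus ?case using reaches_Jump[OF code1, of \<sigma> m] 0(1) by simp
  next
    case (Suc k)
    let ?\<sigma> = "\<sigma>(i := k)"
    have "reaches p 1 (state (Suc b) \<sigma> m) (state (Suc (Suc b)) \<sigma> m)"
      using reaches_Jump[OF code1, of \<sigma> m] Suc.prems(1) by simp
    also have "reaches p 1 \<dots> (state (b + 3) ?\<sigma> m)"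
      using reaches_Basic[OF code2, of \<sigma> m] Suc.prems by (simp add: numeral_3_eq_3)
    also have "reaches p (cost c (\<sigma> 0)) \<dots> (state (b + 3 + code_size c) (sem c m ?\<sigma>) m)"
    proof -
      have "?\<sigma> 1 = 1" "?\<sigma> 3 = 0" "?\<sigma> 0 = \<sigma> 0" using Suc.prems i(1) by auto
      thus ?thesis using For.IH[OF i(3) code3, of ?\<sigma>] by metis
    qed
    also have "reaches p 1 \<dots> (state (Suc b) (sem c m ?\<sigma>) m)"
      using reaches_Jump[OF codej, of "sem c m ?\<sigma>" m] fixed Suc.prems i(1) by simp
    also have "reaches p (k * (3 + cost c (\<sigma> 0)) + 1) \<dots> (state ?end ((for_down ?f k (sem c m ?\<sigma>))(i := 0)) m)"
    proof -
      have "sem c m ?\<sigma> i = k" "sem c m ?\<sigma> 1 = 1" "sem c m ?\<sigma> 3 = 0" "sem c m ?\<sigma> 0 = \<sigma> 0"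
        using fixed Suc.prems i(1) by auto
      thus ?thesis using Suc.IH[of "sem c m ?\<sigma>"] by metis
    qed
    finally show ?case unfolding for_down.simps by (rule reaches_mono) simp
  qed
  let ?\<rho> = "\<rho>(i := \<rho> 0)"
  have "reaches p 1 (state b \<rho> m) (state (Suc b) ?\<rho> m)"
    using reaches_Basic[OF code0, of \<rho> m] For.prems by simp
  also have "reaches p (\<rho> 0 * (3 + cost c (\<rho> 0)) + 1) \<dots> (state ?end ((for_down ?f (\<rho> 0) ?\<rho>)(i := 0)) m)"
    using loop[of ?\<rho> "\<rho> 0"] For.prems i(1) by simp
  finally have 1: "reaches p (1 + (\<rho> 0 * (3 + cost c (\<rho> 0)) + 1)) (state b \<rho> m)
      (state ?end ((for_down ?f (\<rho> 0) ?\<rho>)(i := 0)) m)" .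
  \<comment> \<open>The initial copy of n into register \<open>i\<close> leaves no trace: the first
    iteration overwrites it, and without iterations the final reset does.\<close>
  have 2: "(for_down ?f (\<rho> 0) ?\<rho>)(i := 0) = (for_down ?f (\<rho> 0) \<rho>)(i := 0)"
    by (cases "\<rho> 0") (simp_all del: fun_upd_apply)
  show ?case using 1 unfolding 2 sem.simps code_size.simps cost.simps
    by (simp add: ac_simps del: fun_upd_apply)
qed

text \<open>Only registers 0, 1 and 3 may occur as second summand. Register 0 grows by at most one
  per step and the others stay at most 1, so each step raises the maximum by at most n + k +
  1.\<close>

lemma tame_run_bound:
  assumes "\<And>x. x \<in> set p \<Longrightarrow> tame x"
    and "reg s 0 = n" "\<And>i. i \<noteq> 0 \<Longrightarrow> reg s i = 0" "\<And>i. mem s i \<le> 1"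
  shows "reg (run p k s) 1 \<le> 1 \<and> reg (run p k s) 3 = 0 \<and> reg (run p k s) 0 \<le> n + k \<and>
    mem (run p k s) = mem s \<and> (\<forall>i. reg (run p k s) i \<le> n + 1 + k * (n + k + 1))"
proof (induction k)
  case 0
  have "reg s i \<le> n + 1" for i using assms(2,3) by (cases "i = 0") auto
  thus ?case using assms by (simp add: run_def)
next
  case (Suc k)
  let ?s = "run p k s"
  have mono: "n + 1 + k * (n + k + 1) + (n + k + 1) \<le> n + 1 + Suc k * (n + Suc k + 1)"
    by (simp add: algebra_simps)
  show ?case
  proof (cases "halted p ?s")
    case True
    have "reg ?s i \<le> n + 1 + Suc k * (n + Suc k + 1)" for i
      using Suc mono by (meson le_add1 le_trans)
    thus ?thesis using Suc True by (auto simp: run_Suc step_def)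
  next
    case False
    define x where "x = p ! pc ?s"
    have x: "tame x" using False assms(1) by (auto simp: x_def halted_def)
    have run: "run p (Suc k) s = exec_instr x ?s" using False by (simp add: run_Suc step_def x_def)
    have old: "reg ?s i \<le> n + 1 + k * (n + k + 1)" for i using Suc by blast
    have big: "reg ?s i \<le> n + 1 + Suc k * (n + Suc k + 1)" for i using old[of i] mono by linarith
    have add: "reg ?s i + reg ?s j \<le> n + 1 + Suc k * (n + Suc k + 1)" if "j \<in> {0, 1, 3}" for i j
    proof -
      have "reg ?s j \<le> n + k + 1" using that Suc by auto
      thus ?thesis using old[of i] mono by linarith
    qed
    have one: "1 \<le> n + 1 + Suc k * (n + Suc k + 1)" by simp
    show ?thesis
    proof (cases x)
      case (LoadConst i c)
      thus ?thesis using x Suc big one unfolding run by (auto intro: le_trans)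
    next
      case (AddReg i j l)
      thus ?thesis using x Suc big add[of l j] unfolding run by auto
    next
      case (SubReg i j l)
      thus ?thesis using x Suc big big[of j] unfolding run by (auto intro: le_trans[OF diff_le_self])
    next
      case (Load i j)
      thus ?thesis using x Suc big assms(4) one unfolding run by (auto intro: le_trans)
    next
      case (Store i j)
      thus ?thesis using x by simp
    next
      case (JumpZero i l)
      thus ?thesis using x Suc big unfolding run by auto
    qed
  qed
qed

lemma run_halted:
  assumes "halted p (run p t s)" "t \<le> k"
  shows "run p k s = run p t s"
  using assms(2)
proof (induction rule: dec_induct)
  case (step k) thus ?case using assms(1) by (simp add: run_Suc step_def)
qed simp

text \<open>Register 0 serves as loop bound and must not be written by commands. The command
  therefore leaves n + 1 minus the result in register \<open>d\<close>, and two tame instructions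
  recover the result.\<close>

definition program_of :: "cmd \<Rightarrow> nat \<Rightarrow> program" where
  "program_of c d = LoadConst 1 1 # compile c 1 @ [AddReg 0 0 1, SubReg 0 0 d]"

lemma mem_input_state: "mem (input_state G v) a =
    (if a < order G * order G \<and> (v (a div order G), v (a mod order G)) \<in> parcs G then 1 else 0)"
  by (simp add: input_state_def Let_def)

lemma reg_input_state: "reg (input_state G v) = (\<lambda>i. if i = 0 then order G else 0)"
  by (simp add: input_state_def Let_def)

lemma tame_compile: "wf_cmd c \<Longrightarrow> x \<in> set (compile c b) \<Longrightarrow> tame x"
  by (induction c arbitrary: b) auto

lemma tame_program_of: "wf_cmd c \<Longrightarrow> x \<in> set (program_of c d) \<Longrightarrow> tame x"
  using tame_compile[of c x 1] by (auto simp: program_of_def)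

lemma program_of_correct:
  assumes "wf_cmd c" "d \<noteq> 0"
  shows "halted (program_of c d) (run (program_of c d) (cost c (order G) + 3) (input_state G v))"
    and "reg (run (program_of c d) (cost c (order G) + 3) (input_state G v)) 0 =
      order G + 1 - sem c (mem (input_state G v)) ((reg (input_state G v))(1 := 1)) d"
proof -
  let ?p = "program_of c d" and ?s = "input_state G v"
  let ?m = "mem ?s" and ?n = "order G"
  let ?\<rho> = "(reg ?s)(1 := 1)"
  let ?\<rho>' = "sem c ?m ?\<rho>"
  have s: "?s = state 0 (reg ?s) ?m" by (simp add: input_state_def Let_def)
  have code0: "code_at ?p 0 (LoadConst 1 1 # compile c 1 @ [AddReg 0 0 1, SubReg 0 0 d])"
    unfolding code_at_def program_of_def by (intro exI[of _ "[]"]) simp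
  hence "code_at ?p 1 (compile c 1 @ [AddReg 0 0 1, SubReg 0 0 d])" using code_at_Cons by fastforce
  hence code1: "code_at ?p 1 (compile c 1)" and code2: "code_at ?p (1 + code_size c) [AddReg 0 0 1, SubReg 0 0 d]"
    using code_at_append length_compile by fastforce+
  have code3: "code_at ?p (Suc (1 + code_size c)) [SubReg 0 0 d]" using code_at_Cons[OF code2] by blast
  have fixed: "?\<rho>' 0 = ?n" "?\<rho>' 1 = 1" using sem_unchanged[of _ c ?m ?\<rho>] wf_cmd_writes[OF assms(1)]
    by (auto simp: reg_input_state)
  let ?end = "state (Suc (Suc (1 + code_size c))) (?\<rho>'(0 := ?n + 1 - ?\<rho>' d)) ?m"
  have "reaches ?p 1 (state 0 (reg ?s) ?m) (state 1 ?\<rho> ?m)"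
    using reaches_Basic[OF code0, of "reg ?s" ?m] by simp
  also have "reaches ?p (cost c ?n) \<dots> (state (1 + code_size c) ?\<rho>' ?m)"
    using compile_correct[OF assms(1) code1, of ?\<rho> ?m] by (simp add: reg_input_state)
  also have "reaches ?p 1 \<dots> (state (Suc (1 + code_size c)) (?\<rho>'(0 := ?n + 1)) ?m)"
    using reaches_Basic[OF code2, of ?\<rho>' ?m] fixed by simp
  also have "reaches ?p 1 \<dots> ?end"
    using reaches_Basic[OF code3, of "?\<rho>'(0 := ?n + 1)" ?m] assms(2) by simp
  finally obtain k where k: "k \<le> cost c ?n + 3" "run ?p k ?s = ?end"
    using s by (auto simp: reaches_def numeral_3_eq_3)
  have halt: "halted ?p (run ?p k ?s)"
    unfolding k(2) by (simp add: halted_def program_of_def length_compile)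
  show "halted ?p (run ?p (cost c ?n + 3) ?s)" using halt run_halted[OF halt k(1)] by simp
  show "reg (run ?p (cost c ?n + 3) ?s) 0 = ?n + 1 - ?\<rho>' d"
    using run_halted[OF halt k(1)] k(2) by simp
qed

section \<open>Logarithmic word size and a criterion for efficient computability\<close>

lemma nat_le_power_ceiling_log:
  fixes x :: nat
  assumes "0 < x"
  shows "x \<le> 2 ^ nat \<lceil>log 2 (real x)\<rceil>"
proof -
  have "real x = 2 powr log 2 (real x)" using assms by (subst powr_log_cancel) auto
  also have "\<dots> \<le> 2 powr real (nat \<lceil>log 2 (real x)\<rceil>)" by (intro powr_mono real_nat_ceiling_ge) auto
  also have "\<dots> = real (2 ^ nat \<lceil>log 2 (real x)\<rceil>)" by (simp add: powr_realpow)
  finally show ?thesis by (simp only: of_nat_le_iff)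
qed

lemma log_bound_in_O_ln:
  "(\<lambda>n::nat. real (nat \<lceil>log 2 (real (n + 2 + a * (n + 1)^2 * (n + a * (n + 1)^2 + 1)))\<rceil>)) \<in> O(\<lambda>n. ln (real n))"
proof -
  have 1: "(\<lambda>n::nat. log 2 (real n + 2 + real a * (real n + 1)^2 * (real n + real a * (real n + 1)^2 + 1)) + 1) \<in> O(\<lambda>n. ln (real n))"
    by (cases "a = 0"; real_asymp)
  have "(\<lambda>n::nat. real (nat \<lceil>log 2 (real (n + 2 + a * (n + 1)^2 * (n + a * (n + 1)^2 + 1)))\<rceil>)) \<in>
      O(\<lambda>n::nat. log 2 (real n + 2 + real a * (real n + 1)^2 * (real n + real a * (real n + 1)^2 + 1)) + 1)"
  proof (intro bigoI[of _ 1] always_eventually allI)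
    fix n :: nat
    let ?x = "real n + 2 + real a * (real n + 1)^2 * (real n + real a * (real n + 1)^2 + 1)"
    have eq: "real (n + 2 + a * (n + 1)^2 * (n + a * (n + 1)^2 + 1)) = ?x"
      by (simp add: algebra_simps)
    have "1 \<le> ?x" by simp
    moreover have "0 \<le> log 2 x" if "1 \<le> x" for x :: real using that by simp
    ultimately have "0 \<le> log 2 ?x" by blast
    thus "norm (real (nat \<lceil>log 2 (real (n + 2 + a * (n + 1)^2 * (n + a * (n + 1)^2 + 1)))\<rceil>)) \<le> 1 * norm (log 2 ?x + 1)"
      unfolding eq by (simp add: abs_if)
  qed
  thus ?thesis using 1 by (rule landau_o.big_trans)
qed

lemma efficiently_computable_onI:
  assumes "wf_cmd c" "d \<noteq> 0"
    and cost: "\<And>n. cost c n + 3 \<le> a * (n + 1)^2"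
    and correct: "\<And>G v. G \<in> K \<Longrightarrow> bij_betw v {..<order G} (pverts G) \<Longrightarrow>
      order G + 1 - sem c (mem (input_state G v)) ((reg (input_state G v))(1 := 1)) d = f G"
  shows "efficiently_computable_on K f"
proof -
  define t where "t n = cost c n + 3" for n
  define W where "W n = nat \<lceil>log 2 (real (n + 2 + a * (n + 1)^2 * (n + a * (n + 1)^2 + 1)))\<rceil>" for n
  have "(\<lambda>n. real (t n)) \<in> O(\<lambda>n. real (a * (n + 1)^2))"
    using cost unfolding t_def
    by (intro bigoI[of _ 1] always_eventually allI) (simp only: norm_of_nat mult_1 of_nat_le_iff)
  also have "(\<lambda>n. real (a * (n + 1)^2)) \<in> O(\<lambda>n. real n ^ 2 * ln (real n))"
    by (cases "a = 0"; simp; real_asymp)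
  finally have t: "(\<lambda>n. real (t n)) \<in> O(\<lambda>n. real n ^ 2 * ln (real n))" .
  have W: "(\<lambda>n. real (W n)) \<in> O(\<lambda>n. ln (real n))"
    unfolding W_def by (rule log_bound_in_O_ln)
  have bound: "n + 1 + k * (n + k + 1) < 2 ^ W n" if "k \<le> t n" for k n
  proof -
    let ?T = "a * (n + 1)^2"
    have "k \<le> ?T" using that cost[of n] by (simp add: t_def)
    hence "n + 1 + k * (n + k + 1) \<le> n + 1 + ?T * (n + ?T + 1)" by (intro add_mono mult_mono) auto
    also have "\<dots> < n + 2 + ?T * (n + ?T + 1)" by simp
    also have "\<dots> \<le> 2 ^ W n"
      unfolding W_def by (rule nat_le_power_ceiling_log) simp
    finally show ?thesis .
  qed
  have "reg (run (program_of c d) k (input_state G v)) i < 2 ^ W (order G) \<and>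
        mem (run (program_of c d) k (input_state G v)) i < 2 ^ W (order G)" for G v k i
  proof -
    let ?p = "program_of c d" and ?s = "input_state G v" and ?n = "order G"
    \<comment> \<open>A halted run stays constant, so the bound for at most \<open>t n\<close> steps
      covers runs of any length.\<close>
    let ?k = "min k (t ?n)"
    have "halted ?p (run ?p (t ?n) ?s)"
      unfolding t_def by (rule program_of_correct(1)[OF assms(1,2)])
    hence eq: "run ?p k ?s = run ?p ?k ?s"
      using run_halted[where p = ?p and t = "t ?n" and s = ?s and k = k] by (cases "k \<le> t ?n") auto
    have inv: "mem (run ?p ?k ?s) = mem ?s \<and> (\<forall>i. reg (run ?p ?k ?s) i \<le> ?n + 1 + ?k * (?n + ?k + 1))"
      using tame_run_bound[where p = ?p and s = ?s and n = ?n and k = ?k, OF tame_program_of] assms(1,2) by (simp add: mem_input_state reg_input_state)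
    have lt: "?n + 1 + ?k * (?n + ?k + 1) < 2 ^ W ?n" by (rule bound) simp
    have "mem ?s i \<le> ?n + 1 + ?k * (?n + ?k + 1)" by (simp add: mem_input_state)
    hence "mem (run ?p ?k ?s) i < 2 ^ W ?n" using inv lt by simp
    moreover have "reg (run ?p ?k ?s) i < 2 ^ W ?n" using inv lt le_less_trans by blast
    ultimately show ?thesis unfolding eq by blast
  qed
  thus ?thesis unfolding efficiently_computable_on_def Let_def
    using t W program_of_correct[OF assms(1,2)] correct
    by (intro exI[of _ "program_of c d"] exI[of _ t] exI[of _ W]) (auto simp: t_def)
qed

section \<open>Finding the dominant similarity class\<close>

text \<open>
  Registers: 4 is the current row, 13 the candidate for a row of the dominant class, 12 is zero if
  these rows agree, 14 is the balance of the vote, 15 and 16 count the rows that agree with the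
  candidate, 17 to 20 record the entries of the candidate's row at agreeing and at other rows, 22 is
  the witness flag, 23 the result and 24 the result subtracted from \<open>n + 1\<close>. Rows are scanned from
  their end since loops count down.
\<close>

definition row_end :: "nat \<Rightarrow> nat \<Rightarrow> cmd" where
  "row_end dst src = Basic (AddReg dst 0 3) ;;
     For 6 (Basic (SubReg 11 src 6) ;; If0 11 Skip (Basic (AddReg dst dst 0)))"

text \<open>A truncated difference is zero also when its first argument is smaller; only then is the
  reverse difference needed.\<close>

definition neq :: "nat \<Rightarrow> nat \<Rightarrow> nat \<Rightarrow> cmd" where
  "neq t a b = Basic (SubReg t a b) ;; If0 t (Basic (SubReg t b a)) Skip"

text \<open>Entries in the columns of the two rows themselves are ignored, as similarity says
  nothing about them.\<close>

definition compare_rows :: cmd where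
  "compare_rows = row_end 7 4 ;; row_end 8 13 ;; Basic (LoadConst 12 0) ;;
     For 5 (Basic (SubReg 7 7 1) ;; Basic (SubReg 8 8 1) ;; Basic (Load 9 7) ;; Basic (Load 10 8) ;;
       neq 11 9 10 ;; If0 11 Skip (neq 11 5 4 ;; If0 11 Skip (neq 11 5 13 ;; If0 11 Skip
         (Basic (LoadConst 12 1)))))"

definition vote :: cmd where
  "vote = Basic (LoadConst 13 0) ;; Basic (LoadConst 14 0) ;;
     For 4 (If0 14 (Basic (AddReg 13 4 3) ;; Basic (LoadConst 14 1))
       (compare_rows ;; If0 12 (Basic (AddReg 14 14 1)) (Basic (SubReg 14 14 1))))"

text \<open>Register 15 goes up by two per agreeing row: twice the class size is what the threshold
  test needs, and doubling at the end is not tame.\<close>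

definition count :: cmd where
  "count = row_end 21 13 ;; Basic (LoadConst 15 0) ;; Basic (LoadConst 16 0) ;; Basic (LoadConst 17 0) ;;
     Basic (LoadConst 18 0) ;; Basic (LoadConst 19 0) ;; Basic (LoadConst 20 0) ;;
     For 4 (compare_rows ;; Basic (SubReg 21 21 1) ;; Basic (Load 9 21) ;;
       If0 12 (Basic (AddReg 16 16 1) ;; Basic (AddReg 15 15 1) ;; Basic (AddReg 15 15 1) ;;
           neq 11 4 13 ;; If0 11 Skip (If0 9 (Basic (LoadConst 17 1)) (Basic (LoadConst 18 1))))
         (If0 9 (Basic (LoadConst 19 1)) (Basic (LoadConst 20 1))))"

definition find_witness :: cmd where
  "find_witness = Basic (LoadConst 22 0) ;; If0 17 Skip (If0 19 Skip (Basic (LoadConst 22 1))) ;;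
     If0 18 Skip (If0 20 Skip (Basic (LoadConst 22 1)))"

definition analyse :: cmd where
  "analyse = vote ;; count ;; find_witness"

text \<open>After the subtractions register 11 is non-zero iff twice the class size exceeds n + 1,
  or n + 3 if there is no witness. This is the inequality in \<open>dominant_iff\<close>, tested on
  the class of the candidate.\<close>

definition recognize :: cmd where
  "recognize = analyse ;; Basic (LoadConst 23 0) ;; Basic (SubReg 11 15 0) ;; Basic (SubReg 11 11 1) ;;
     If0 22 (Basic (SubReg 11 11 1) ;; Basic (SubReg 11 11 1)) Skip ;;
     If0 11 Skip (Basic (LoadConst 23 1)) ;; Basic (AddReg 24 0 1) ;; Basic (SubReg 24 24 23)"

definition evaluate :: cmd where
  "evaluate = analyse ;; Basic (AddReg 23 16 1) ;; If0 22 Skip (Basic (AddReg 23 23 1)) ;;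
     Basic (AddReg 24 0 1) ;; Basic (SubReg 24 24 23)"

lemmas cmd_defs = row_end_def neq_def compare_rows_def vote_def count_def find_witness_def
  analyse_def recognize_def evaluate_def

lemma wf_vote: "wf_cmd vote" and wf_analyse: "wf_cmd analyse"
  and wf_recognize: "wf_cmd recognize" and wf_evaluate: "wf_cmd evaluate"
  by (simp_all add: cmd_defs)

lemma sem_wf_unchanged: "wf_cmd c \<Longrightarrow> i \<in> {0, 1, 3} \<Longrightarrow> sem c m \<rho> i = \<rho> i"
  using sem_unchanged wf_cmd_writes by blast

text \<open>Loops are nested at most twice, so the cost is quadratic; 500 is a generous
  factor.\<close>

lemma cost_recognize: "cost recognize n + 3 \<le> 500 * (n + 1)^2"
  and cost_evaluate: "cost evaluate n + 3 \<le> 500 * (n + 1)^2"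
  by (simp_all add: cmd_defs power2_eq_square algebra_simps)

lemma sem_neq: "t \<noteq> a \<Longrightarrow> t \<noteq> b \<Longrightarrow> sem (neq t a b) m \<rho> = \<rho>(t := (\<rho> a - \<rho> b) + (\<rho> b - \<rho> a))"
  by (auto simp: neq_def fun_upd_def)

section \<open>Verification of the matrix routines\<close>

lemma sem_row_end:
  assumes "dst \<notin> {0, 6, 11}" "src \<notin> {6, 11, dst}" "\<rho> 3 = 0" "\<rho> src \<le> \<rho> 0"
  shows "sem (row_end dst src) m \<rho> dst = \<rho> src * \<rho> 0 + \<rho> 0"
proof -
  let ?f = "\<lambda>k \<sigma>. sem (Basic (SubReg 11 src 6) ;; If0 11 Skip (Basic (AddReg dst dst 0))) m (\<sigma>(6 := k))"
  let ?\<rho> = "\<rho>(dst := \<rho> 0)"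
  let ?I = "\<lambda>k (\<sigma> :: nat \<Rightarrow> nat). \<sigma> 0 = \<rho> 0 \<and> \<sigma> src = \<rho> src \<and> \<sigma> dst = (\<rho> src - k) * \<rho> 0 + \<rho> 0"
  have "?I 0 (for_down ?f (\<rho> 0) ?\<rho>)"
  proof (rule for_down_invariant[where I = ?I])
    show "?I (\<rho> 0) ?\<rho>" using assms by auto
  next
    fix k and \<sigma> :: "nat \<Rightarrow> nat" assume k: "k < \<rho> 0" and I: "?I (Suc k) \<sigma>"
    have "\<rho> src - k = Suc (\<rho> src - Suc k)" if "k < \<rho> src" using that by simp
    thus "?I k (?f k \<sigma>)" using I assms(1,2) by (cases "k < \<rho> src") auto
  qed
  thus ?thesis using assms by (simp add: row_end_def)
qed

lemma writes_row_end: "writes (row_end dst src) = {dst, 6, 11}"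
  by (auto simp: row_end_def)

lemma writes_compare_rows: "writes compare_rows = {5, 6, 7, 8, 9, 10, 11, 12}"
  by (auto simp: compare_rows_def writes_row_end neq_def)

lemma compare_rows_unchanged:
  "i \<notin> {5, 6, 7, 8, 9, 10, 11, 12} \<Longrightarrow> sem compare_rows m \<rho> i = \<rho> i"
  using sem_unchanged[of i compare_rows m \<rho>] by (simp add: writes_compare_rows)

definition rows_agree :: "(nat \<Rightarrow> nat) \<Rightarrow> nat \<Rightarrow> nat \<Rightarrow> nat \<Rightarrow> bool" where
  "rows_agree m n x y \<longleftrightarrow> (\<forall>j<n. j \<noteq> x \<longrightarrow> j \<noteq> y \<longrightarrow> m (x * n + j) = m (y * n + j))"

lemma sem_compare_rows:
  assumes "\<rho> 0 = n" "\<rho> 1 = 1" "\<rho> 3 = 0" "\<rho> 4 < n" "\<rho> 13 < n"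
  shows "sem compare_rows m \<rho> 12 = 0 \<longleftrightarrow> rows_agree m n (\<rho> 4) (\<rho> 13)"
proof -
  define u c where "u = \<rho> 4" and "c = \<rho> 13"
  define \<rho>1 where "\<rho>1 = sem (row_end 7 4) m \<rho>"
  define \<rho>2 where "\<rho>2 = sem (row_end 8 13) m \<rho>1"
  have keep1: "\<rho>1 i = \<rho> i" if "i \<notin> {7, 6, 11}" for i
    using sem_unchanged[of i "row_end 7 4" m \<rho>] that by (simp add: \<rho>1_def writes_row_end)
  have keep2: "\<rho>2 i = \<rho>1 i" if "i \<notin> {8, 6, 11}" for i
    using sem_unchanged[of i "row_end 8 13" m \<rho>1] that by (simp add: \<rho>2_def writes_row_end)
  have "\<rho>1 7 = u * n + n" unfolding \<rho>1_def u_def using assms by (subst sem_row_end) auto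
  moreover have "\<rho>2 8 = c * n + n" unfolding \<rho>2_def c_def using assms keep1 by (subst sem_row_end) auto
  ultimately have \<rho>2: "\<rho>2 0 = n" "\<rho>2 1 = 1" "\<rho>2 4 = u" "\<rho>2 13 = c" "\<rho>2 7 = u * n + n" "\<rho>2 8 = c * n + n"
    using keep1 keep2 assms by (auto simp: u_def c_def)
  let ?body = "Basic (SubReg 7 7 1) ;; Basic (SubReg 8 8 1) ;; Basic (Load 9 7) ;; Basic (Load 10 8) ;;
       neq 11 9 10 ;; If0 11 Skip (neq 11 5 4 ;; If0 11 Skip (neq 11 5 13 ;; If0 11 Skip
         (Basic (LoadConst 12 1))))"
  let ?f = "\<lambda>k \<sigma>. sem ?body m (\<sigma>(5 := k))"
  let ?I = "\<lambda>k (\<sigma> :: nat \<Rightarrow> nat). \<sigma> 0 = n \<and> \<sigma> 1 = 1 \<and> \<sigma> 4 = u \<and> \<sigma> 13 = c \<and> \<sigma> 7 = u * n + k \<and> \<sigma> 8 = c * n + k \<and>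
    (\<sigma> 12 = 0 \<longleftrightarrow> (\<forall>j. k \<le> j \<longrightarrow> j < n \<longrightarrow> j \<noteq> u \<longrightarrow> j \<noteq> c \<longrightarrow> m (u * n + j) = m (c * n + j)))"
  have "?I 0 (for_down ?f n (\<rho>2(12 := 0)))"
  proof (rule for_down_invariant[where I = ?I])
    show "?I n (\<rho>2(12 := 0))" using \<rho>2 by auto
  next
    fix k and \<sigma> :: "nat \<Rightarrow> nat" assume k: "k < n" and I: "?I (Suc k) \<sigma>"
    have split: "(\<forall>j. k \<le> j \<longrightarrow> P j) \<longleftrightarrow> P k \<and> (\<forall>j. Suc k \<le> j \<longrightarrow> P j)" for P
      by (metis Suc_leD Suc_leI le_neq_implies_less order_refl)
    show "?I k (?f k \<sigma>)"
      unfolding split using I k by (auto simp: sem_neq)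
  qed
  moreover have "sem compare_rows m \<rho> 12 = for_down ?f n (\<rho>2(12 := 0)) 12"
    using \<rho>2(1) by (simp add: compare_rows_def \<rho>1_def \<rho>2_def)
  ultimately show ?thesis by (auto simp: rows_agree_def u_def c_def)
qed

lemma card_from_Suc:
  assumes "k < n"
  shows "card {j. k \<le> j \<and> j < n \<and> P j} = card {j. Suc k \<le> j \<and> j < n \<and> P j} + (if P k then 1 else 0)"
proof -
  have "{j. k \<le> j \<and> j < n \<and> P j} = (if P k then {k} else {}) \<union> {j. Suc k \<le> j \<and> j < n \<and> P j}"
    using assms by (auto simp: Suc_le_eq le_less)
  thus ?thesis by (auto simp: card_insert_if)
qed

lemma ex_pair_iff:
  fixes n :: nat
  shows "(\<exists>i<n. P i \<and> Z i) \<and> (\<exists>j<n. Q j \<and> Z j) \<or> (\<exists>i<n. P i \<and> \<not> Z i) \<and> (\<exists>j<n. Q j \<and> \<not> Z j) \<longleftrightarrow>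
    (\<exists>i<n. \<exists>j<n. P i \<and> Q j \<and> (Z i \<longleftrightarrow> Z j))"
  by blast

text \<open>All that vote and count use of the input. Agreement of a row with itself holds by
  definition, so the relation is an equivalence on row numbers below \<open>n\<close>.\<close>

locale row_equivalence =
  fixes m :: "nat \<Rightarrow> nat" and n :: nat
  assumes pos: "0 < n"
    and sym_rows: "x < n \<Longrightarrow> y < n \<Longrightarrow> rows_agree m n x y \<Longrightarrow> rows_agree m n y x"
    and trans_rows: "x < n \<Longrightarrow> y < n \<Longrightarrow> z < n \<Longrightarrow> rows_agree m n x y \<Longrightarrow> rows_agree m n y z \<Longrightarrow> rows_agree m n x z"
begin

abbreviation R where "R \<equiv> rows_agree m n"

text \<open>The majority vote of Boyer and Moore.\<close>

lemma sem_vote: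
  assumes "\<rho> 0 = n" "\<rho> 1 = 1" "\<rho> 3 = 0"
  shows "sem vote m \<rho> 13 < n"
    and "x < n \<Longrightarrow> n < 2 * card {j. j < n \<and> R j x} \<Longrightarrow> R (sem vote m \<rho> 13) x"
proof -
  let ?body = "If0 14 (Basic (AddReg 13 4 3) ;; Basic (LoadConst 14 1))
       (compare_rows ;; If0 12 (Basic (AddReg 14 14 1)) (Basic (SubReg 14 14 1)))"
  let ?f = "\<lambda>k \<sigma>. sem ?body m (\<sigma>(4 := k))"
  let ?N = "\<lambda>k x. card {j. k \<le> j \<and> j < n \<and> R j x}"
  \<comment> \<open>After n - k rows, a class has at most half of them, up to the balance: the
    balance counts in favour of the candidate's class and against all others. At the end a class
    other than the candidate's thus has at most n / 2 rows.\<close>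
  let ?I = "\<lambda>k (\<sigma> :: nat \<Rightarrow> nat). \<sigma> 0 = n \<and> \<sigma> 1 = 1 \<and> \<sigma> 3 = 0 \<and> k \<le> n \<and> \<sigma> 13 < n \<and>
    (\<forall>x<n. if R (\<sigma> 13) x then 2 * ?N k x \<le> (n - k) + \<sigma> 14 else 2 * ?N k x + \<sigma> 14 \<le> n - k)"
  let ?\<rho> = "\<rho>(13 := 0, 14 := 0)"
  have I: "?I 0 (for_down ?f n ?\<rho>)"
  proof (rule for_down_invariant[where I = ?I])
    have "{j. n \<le> j \<and> j < n \<and> R j x} = {}" for x by auto
    thus "?I n ?\<rho>" using assms pos by simp
  next
    fix k and \<sigma> :: "nat \<Rightarrow> nat" assume k: "k < n" and I: "?I (Suc k) \<sigma>"
    have N: "?N k x = ?N (Suc k) x + (if R k x then 1 else 0)" for x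
      by (rule card_from_Suc[OF k])
    have nk: "n - k = Suc (n - Suc k)" using k by simp
    let ?c = "\<sigma> 13" and ?t = "\<sigma> 14"
    have old: "if R ?c x then 2 * ?N (Suc k) x \<le> (n - Suc k) + ?t else 2 * ?N (Suc k) x + ?t \<le> n - Suc k"
      if "x < n" for x using I that by blast
    show "?I k (?f k \<sigma>)"
    proof (cases "?t = 0")
      case True
      have new: "?f k \<sigma> 0 = n" "?f k \<sigma> 1 = 1" "?f k \<sigma> 3 = 0" "?f k \<sigma> 13 = k" "?f k \<sigma> 14 = 1"
        using True I by auto
      have "if R k x then 2 * ?N k x \<le> (n - k) + 1 else 2 * ?N k x + 1 \<le> n - k" if "x < n" for x
        using old[OF that] True unfolding N nk by (auto split: if_splits)
      hence all: "\<forall>x<n. if R k x then 2 * ?N k x \<le> (n - k) + 1 else 2 * ?N k x + 1 \<le> n - k" by blast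
      show ?thesis unfolding new
        by (rule conjI[OF refl conjI[OF refl conjI[OF refl conjI[OF less_imp_le[OF k] conjI[OF k all]]]]])
    next
      case False
      let ?\<sigma> = "sem compare_rows m (\<sigma>(4 := k))"
      have keep: "?\<sigma> 0 = n" "?\<sigma> 1 = 1" "?\<sigma> 3 = 0" "?\<sigma> 13 = ?c" "?\<sigma> 14 = ?t"
        using I by (simp_all add: compare_rows_unchanged)
      have cmp: "?\<sigma> 12 = 0 \<longleftrightarrow> R k ?c" using sem_compare_rows[of "\<sigma>(4 := k)" n m] I k by simp
      have new: "?f k \<sigma> 0 = n" "?f k \<sigma> 1 = 1" "?f k \<sigma> 3 = 0" "?f k \<sigma> 13 = ?c"
        "?f k \<sigma> 14 = (if R k ?c then ?t + 1 else ?t - 1)"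
        using False keep cmp by simp_all
      have c: "?c < n" using I by blast
      have "if R ?c x then 2 * ?N k x \<le> (n - k) + (if R k ?c then ?t + 1 else ?t - 1)
          else 2 * ?N k x + (if R k ?c then ?t + 1 else ?t - 1) \<le> n - k" if x: "x < n" for x
      proof -
        have "R k x \<longleftrightarrow> R ?c x" if "R k ?c"
          using that trans_rows[OF k c x] trans_rows[OF c k x] sym_rows[OF k c] by blast
        moreover have "\<not> R k x" if "\<not> R k ?c" "R ?c x"
          using that trans_rows[OF k x c] sym_rows[OF c x] by blast
        ultimately show ?thesis using old[OF x] False unfolding N nk
          by (cases "R k ?c"; cases "R ?c x"; cases "R k x") auto
      qed
      hence all: "\<forall>x<n. if R ?c x then 2 * ?N k x \<le> (n - k) + (if R k ?c then ?t + 1 else ?t - 1)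
          else 2 * ?N k x + (if R k ?c then ?t + 1 else ?t - 1) \<le> n - k" by blast
      show ?thesis unfolding new
        by (rule conjI[OF refl conjI[OF refl conjI[OF refl conjI[OF less_imp_le[OF k] conjI[OF c all]]]]])
    qed
  qed
  have eq: "sem vote m \<rho> 13 = for_down ?f n ?\<rho> 13"
    using assms by (simp add: vote_def)
  show "sem vote m \<rho> 13 < n" using I eq by simp
  show "R (sem vote m \<rho> 13) x" if "x < n" "n < 2 * card {j. j < n \<and> R j x}"
  proof (rule ccontr)
    assume "\<not> ?thesis"
    hence "\<not> R (for_down ?f n ?\<rho> 13) x" unfolding eq .
    moreover have "if R (for_down ?f n ?\<rho> 13) x then 2 * ?N 0 x \<le> (n - 0) + for_down ?f n ?\<rho> 14
        else 2 * ?N 0 x + for_down ?f n ?\<rho> 14 \<le> n - 0" using I that(1) by blast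
    ultimately have "2 * ?N 0 x \<le> n" by (simp only: if_False)
    thus False using that(2) by simp
  qed
qed

lemma sem_count:
  assumes "\<rho> 0 = n" "\<rho> 1 = 1" "\<rho> 3 = 0" "\<rho> 13 < n"
  defines "c \<equiv> \<rho> 13"
  shows "sem count m \<rho> 16 = card {j. j < n \<and> R j c}"
    and "sem count m \<rho> 15 = 2 * card {j. j < n \<and> R j c}"
    and "sem count m \<rho> 17 = 0 \<longleftrightarrow> \<not> (\<exists>j<n. R j c \<and> j \<noteq> c \<and> m (c * n + j) = 0)"
    and "sem count m \<rho> 18 = 0 \<longleftrightarrow> \<not> (\<exists>j<n. R j c \<and> j \<noteq> c \<and> m (c * n + j) \<noteq> 0)"
    and "sem count m \<rho> 19 = 0 \<longleftrightarrow> \<not> (\<exists>j<n. \<not> R j c \<and> m (c * n + j) = 0)"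
    and "sem count m \<rho> 20 = 0 \<longleftrightarrow> \<not> (\<exists>j<n. \<not> R j c \<and> m (c * n + j) \<noteq> 0)"
proof -
  define \<rho>1 where "\<rho>1 = sem (row_end 21 13) m \<rho>"
  have keep: "\<rho>1 i = \<rho> i" if "i \<notin> {21, 6, 11}" for i
    using sem_unchanged[of i "row_end 21 13" m \<rho>] that by (simp add: \<rho>1_def writes_row_end)
  have "\<rho>1 21 = c * n + n" unfolding \<rho>1_def c_def using assms by (subst sem_row_end) auto
  hence \<rho>1: "\<rho>1 0 = n" "\<rho>1 1 = 1" "\<rho>1 3 = 0" "\<rho>1 13 = c" "\<rho>1 21 = c * n + n"
    using keep assms by (auto simp: c_def)
  have c: "c < n" using assms by (simp add: c_def)
  let ?update = "Basic (SubReg 21 21 1) ;; Basic (Load 9 21) ;;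
       If0 12 (Basic (AddReg 16 16 1) ;; Basic (AddReg 15 15 1) ;; Basic (AddReg 15 15 1) ;;
           neq 11 4 13 ;; If0 11 Skip (If0 9 (Basic (LoadConst 17 1)) (Basic (LoadConst 18 1))))
         (If0 9 (Basic (LoadConst 19 1)) (Basic (LoadConst 20 1)))"
  let ?body = "compare_rows ;; ?update"
  let ?f = "\<lambda>k \<sigma>. sem ?body m (\<sigma>(4 := k))"
  define E where "E k P \<longleftrightarrow> (\<exists>j\<ge>k. j < n \<and> P j (m (c * n + j)))" for k P
  define M where "M k = card {j. k \<le> j \<and> j < n \<and> R j c}" for k
  let ?I = "\<lambda>k (\<sigma> :: nat \<Rightarrow> nat). \<sigma> 0 = n \<and> \<sigma> 1 = 1 \<and> \<sigma> 3 = 0 \<and> \<sigma> 13 = c \<and> \<sigma> 21 = c * n + k \<and>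
    \<sigma> 16 = M k \<and> \<sigma> 15 = 2 * M k \<and>
    (\<sigma> 17 = 0 \<longleftrightarrow> \<not> E k (\<lambda>j a. R j c \<and> j \<noteq> c \<and> a = 0)) \<and>
    (\<sigma> 18 = 0 \<longleftrightarrow> \<not> E k (\<lambda>j a. R j c \<and> j \<noteq> c \<and> a \<noteq> 0)) \<and>
    (\<sigma> 19 = 0 \<longleftrightarrow> \<not> E k (\<lambda>j a. \<not> R j c \<and> a = 0)) \<and>
    (\<sigma> 20 = 0 \<longleftrightarrow> \<not> E k (\<lambda>j a. \<not> R j c \<and> a \<noteq> 0))"
  let ?\<rho> = "\<rho>1(15 := 0, 16 := 0, 17 := 0, 18 := 0, 19 := 0, 20 := 0)"
  have I: "?I 0 (for_down ?f n ?\<rho>)"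
  proof (rule for_down_invariant[where I = ?I])
    have "M n = 0" by (auto simp: M_def)
    moreover have "\<not> E n P" for P by (auto simp: E_def)
    ultimately show "?I n ?\<rho>" using \<rho>1 by auto
  next
    fix k and \<sigma> :: "nat \<Rightarrow> nat" assume k: "k < n" and I: "?I (Suc k) \<sigma>"
    have split: "E k P \<longleftrightarrow> P k (m (c * n + k)) \<or> E (Suc k) P" for P
      unfolding E_def using k by (metis Suc_leD Suc_leI le_neq_implies_less order_refl)
    have N: "M k = M (Suc k) + (if R k c then 1 else 0)"
      unfolding M_def by (rule card_from_Suc[OF k])
    let ?\<sigma> = "sem compare_rows m (\<sigma>(4 := k))"
    have keep: "?\<sigma> i = \<sigma> i" if "i \<in> {0, 1, 3, 13, 15, 16, 17, 18, 19, 20, 21}" for i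
      using that by (auto simp: compare_rows_unchanged)
    have keep4: "?\<sigma> 4 = k" by (simp add: compare_rows_unchanged)
    have cmp: "?\<sigma> 12 = 0 \<longleftrightarrow> R k c" using sem_compare_rows[of "\<sigma>(4 := k)" n m] I k c by simp
    define \<sigma>' where "\<sigma>' = ?\<sigma>"
    have \<sigma>': "\<sigma>' 0 = n" "\<sigma>' 1 = 1" "\<sigma>' 3 = 0" "\<sigma>' 13 = c" "\<sigma>' 21 = c * n + Suc k" "\<sigma>' 4 = k"
      "\<sigma>' 16 = M (Suc k)" "\<sigma>' 15 = 2 * M (Suc k)"
      "\<sigma>' 17 = 0 \<longleftrightarrow> \<not> E (Suc k) (\<lambda>j a. R j c \<and> j \<noteq> c \<and> a = 0)"
      "\<sigma>' 18 = 0 \<longleftrightarrow> \<not> E (Suc k) (\<lambda>j a. R j c \<and> j \<noteq> c \<and> a \<noteq> 0)"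
      "\<sigma>' 19 = 0 \<longleftrightarrow> \<not> E (Suc k) (\<lambda>j a. \<not> R j c \<and> a = 0)"
      "\<sigma>' 20 = 0 \<longleftrightarrow> \<not> E (Suc k) (\<lambda>j a. \<not> R j c \<and> a \<noteq> 0)"
      "\<sigma>' 12 = 0 \<longleftrightarrow> R k c"
      unfolding \<sigma>'_def using I keep keep4 cmp by simp_all
    have step: "?f k \<sigma> = sem ?update m \<sigma>'"
      by (simp add: \<sigma>'_def)
    show "?I k (?f k \<sigma>)"
      unfolding step split N
      by (cases "R k c"; cases "k = c"; cases "m (c * n + k) = 0") (simp_all add: sem_neq \<sigma>' \<sigma>'(2)[unfolded One_nat_def] order_eq_iff[symmetric])
  qed
  have eq: "sem count m \<rho> i = for_down ?f n ?\<rho> i" if "i \<noteq> 4" for i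
    using \<rho>1(1) that by (simp add: count_def \<rho>1_def)
  show "sem count m \<rho> 16 = card {j. j < n \<and> R j c}" "sem count m \<rho> 15 = 2 * card {j. j < n \<and> R j c}"
    "sem count m \<rho> 17 = 0 \<longleftrightarrow> \<not> (\<exists>j<n. R j c \<and> j \<noteq> c \<and> m (c * n + j) = 0)"
    "sem count m \<rho> 18 = 0 \<longleftrightarrow> \<not> (\<exists>j<n. R j c \<and> j \<noteq> c \<and> m (c * n + j) \<noteq> 0)"
    "sem count m \<rho> 19 = 0 \<longleftrightarrow> \<not> (\<exists>j<n. \<not> R j c \<and> m (c * n + j) = 0)"
    "sem count m \<rho> 20 = 0 \<longleftrightarrow> \<not> (\<exists>j<n. \<not> R j c \<and> m (c * n + j) \<noteq> 0)"
    using I by (simp_all add: eq E_def M_def)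
qed

lemma sem_analyse:
  assumes "\<rho> 0 = n" "\<rho> 1 = 1" "\<rho> 3 = 0"
  obtains c where "c < n" "\<And>x. x < n \<Longrightarrow> n < 2 * card {j. j < n \<and> R j x} \<Longrightarrow> R c x"
    "sem analyse m \<rho> 16 = card {j. j < n \<and> R j c}"
    "sem analyse m \<rho> 15 = 2 * card {j. j < n \<and> R j c}"
    "sem analyse m \<rho> 22 \<noteq> 0 \<longleftrightarrow> (\<exists>i<n. \<exists>j<n. R i c \<and> i \<noteq> c \<and> \<not> R j c \<and> (m (c * n + i) = 0 \<longleftrightarrow> m (c * n + j) = 0))"
proof -
  let ?\<rho>1 = "sem vote m \<rho>"
  have vote0: "?\<rho>1 0 = n" "?\<rho>1 1 = 1" "?\<rho>1 3 = 0"
    using assms by (simp_all add: sem_wf_unchanged[OF wf_vote])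
  note vote1 = sem_vote[OF assms]
  note count1 = sem_count[OF vote0 vote1(1)]
  let ?\<rho>2 = "sem count m ?\<rho>1"
  have 1: "sem analyse m \<rho> = sem find_witness m ?\<rho>2" by (simp add: analyse_def)
  have 2: "sem find_witness m \<sigma> 22 \<noteq> 0 \<longleftrightarrow> \<sigma> 17 \<noteq> 0 \<and> \<sigma> 19 \<noteq> 0 \<or> \<sigma> 18 \<noteq> 0 \<and> \<sigma> 20 \<noteq> 0" for \<sigma>
    by (simp add: find_witness_def)
  have 3: "sem find_witness m \<sigma> i = \<sigma> i" if "i \<noteq> 22" for \<sigma> i
    using sem_unchanged[of i find_witness m \<sigma>] that by (simp add: find_witness_def)
  show thesis
  proof (rule that[OF vote1])
    show "sem analyse m \<rho> 16 = card {j. j < n \<and> R j (?\<rho>1 13)}"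
      unfolding 1 count1(1)[symmetric] by (rule 3) simp
    show "sem analyse m \<rho> 15 = 2 * card {j. j < n \<and> R j (?\<rho>1 13)}"
      unfolding 1 count1(2)[symmetric] by (rule 3) simp
    show "sem analyse m \<rho> 22 \<noteq> 0 \<longleftrightarrow> (\<exists>i<n. \<exists>j<n. R i (?\<rho>1 13) \<and> i \<noteq> ?\<rho>1 13 \<and> \<not> R j (?\<rho>1 13) \<and>
        (m (?\<rho>1 13 * n + i) = 0 \<longleftrightarrow> m (?\<rho>1 13 * n + j) = 0))"
      unfolding 1 2 count1(3-6) not_not
      using ex_pair_iff[of n "\<lambda>i. R i (?\<rho>1 13) \<and> i \<noteq> ?\<rho>1 13" "\<lambda>i. m (?\<rho>1 13 * n + i) = 0"
        "\<lambda>j. \<not> R j (?\<rho>1 13)"] by (simp only: conj_assoc)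
  qed
qed

end

lemma sem_recognize:
  assumes "\<rho> 0 = n" "\<rho> 1 = 1" "\<rho> 3 = 0"
  shows "sem recognize m \<rho> 24 = n + 1 -
    (if n + (if sem analyse m \<rho> 22 \<noteq> 0 then 1 else 3) < sem analyse m \<rho> 15 then 1 else 0)"
proof -
  let ?\<rho>' = "sem analyse m \<rho>"
  have "?\<rho>' 0 = n" "?\<rho>' 1 = 1"
    using assms by (simp_all add: sem_wf_unchanged[OF wf_analyse])
  thus ?thesis by (simp add: recognize_def)
qed

lemma sem_evaluate:
  assumes "\<rho> 0 = n" "\<rho> 1 = 1" "\<rho> 3 = 0"
  shows "sem evaluate m \<rho> 24 = n + 1 - (sem analyse m \<rho> 16 + (if sem analyse m \<rho> 22 \<noteq> 0 then 2 else 1))"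
proof -
  let ?\<rho>' = "sem analyse m \<rho>"
  have "?\<rho>' 0 = n" "?\<rho>' 1 = 1"
    using assms by (simp_all add: sem_wf_unchanged[OF wf_analyse])
  thus ?thesis by (simp add: evaluate_def)
qed

section \<open>The exceptional graphs\<close>

lemma has_witness_similar:
  assumes "simple A" "similar A v v'" "has_witness A v"
  shows "has_witness A v'"
proof (cases "v = v'")
  case False
  obtain u w where uw: "similar A v u" "u \<noteq> v" "w \<in> pverts A" "\<not> similar A v w" "(v, w) \<in> parcs A \<longleftrightarrow> (v, u) \<in> parcs A"
    using assms(3) by (auto simp: has_witness_def)
  have v: "v \<in> pverts A" using assms(2) by (simp add: similar_def)
  have "\<not> similar A v' w" using similar_trans[OF assms(1,2)] uw(4) by blast
  moreover have "w \<noteq> v" "w \<noteq> v'" using uw(4) similar_refl[OF v] assms(2) by auto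
  hence "(v', w) \<in> parcs A \<longleftrightarrow> (v, w) \<in> parcs A" using similarD[OF assms(2) uw(3)] by blast
  moreover have "(v, u) \<in> parcs A \<longleftrightarrow> (v', v) \<in> parcs A"
    using similar_homogeneous[OF assms(1) uw(1) assms(2) similar_refl[OF v]] uw(2) False by auto
  ultimately show ?thesis
    using uw(3,5) similar_sym[OF assms(2)] False unfolding has_witness_def by blast
qed (use assms in simp)

text \<open>Makes the value independent of the representative, be it the one chosen by
  \<open>SOME\<close> or the row found by the vote.\<close>

lemma large_rank_similar:
  assumes "simple A" "similar A v v'"
  shows "large_rank A v = large_rank A v'"
proof -
  have "v \<in> pverts A" "v' \<in> pverts A" using assms(2) by (auto simp: similar_def)
  hence "sim_class A v = sim_class A v'" using sim_class_eq_iff[OF assms(1)] assms(2) by blast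
  moreover have "has_witness A v \<longleftrightarrow> has_witness A v'"
    using has_witness_similar[OF assms(1)] assms(2) similar_sym by metis
  ultimately show ?thesis by (simp add: large_rank_def)
qed

lemma majority_similar:
  assumes "simple A" "v \<in> pverts A" "v' \<in> pverts A"
    and "card (pverts A) < 2 * card (sim_class A v)" "card (pverts A) < 2 * card (sim_class A v')"
  shows "similar A v v'"
proof (rule ccontr)
  assume ns: "\<not> similar A v v'"
  have fin: "finite (pverts A)" using assms(1) by (simp add: simple_def)
  have "sim_class A v \<inter> sim_class A v' = {}"
    using classes_disjoint[OF assms(1), of "sim_class A v" "sim_class A v'"] assms(2,3)
      sim_class_eq_iff[OF assms(1-3)] ns unfolding classes_def by blast
  hence "card (sim_class A v) + card (sim_class A v') = card (sim_class A v \<union> sim_class A v')"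
    using finite_sim_class[OF fin] by (intro card_Un_disjoint[symmetric])
  also have "\<dots> \<le> card (pverts A)" by (intro card_mono fin Un_least sim_class_subset)
  finally show False using assms(4,5) by simp
qed

section \<open>Dominant classes and the exact rank\<close>

definition dominant :: "'a pair_pre_digraph \<Rightarrow> 'a \<Rightarrow> bool" where
  "dominant A v \<longleftrightarrow> v \<in> pverts A \<and> card (pverts A) + 1 < 2 * card (sim_class A v) \<and>
     card (pverts A) + 5 < 2 * large_rank A v"

text \<open>The numbers 1 and 3 are 5 - 2 * 2 and 5 - 2 * 1, as \<open>large_rank\<close> adds 2 or
  1 to the class size. In this form the condition is tested by the program.\<close>

lemma dominant_iff:
  "dominant A v \<longleftrightarrow> v \<in> pverts A \<and>
     card (pverts A) + (if has_witness A v then 1 else 3) < 2 * card (sim_class A v)"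
  by (auto simp: dominant_def large_rank_def)

lemma dominant_similar: "simple A \<Longrightarrow> dominant A v \<Longrightarrow> dominant A v' \<Longrightarrow> similar A v v'"
  by (rule majority_similar) (auto simp: dominant_def)

lemma dominant_transfer:
  assumes "simple A" "dominant A v" "similar A v v'"
  shows "dominant A v'"
proof -
  have "v \<in> pverts A" "v' \<in> pverts A" using assms(3) by (auto simp: similar_def)
  hence "sim_class A v = sim_class A v'" using sim_class_eq_iff[OF assms(1)] assms(3) by blast
  thus ?thesis using assms(2) large_rank_similar[OF assms(1,3)] \<open>v' \<in> pverts A\<close> by (simp add: dominant_def)
qed

definition exceptional :: "binstruct set" where
  "exceptional = {G \<in> graphs. \<exists>v. dominant G v}"

lemma exceptionalE:
  assumes "G \<in> exceptional"
  obtains v where "simple G" "G \<in> graphs" "dominant G v"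
  using assms by (auto simp: exceptional_def graphs_iff)

definition rank_of :: "binstruct \<Rightarrow> nat" where
  "rank_of G = (if G \<in> exceptional then large_rank G (SOME v. dominant G v) else (order G + 5) div 2)"

lemma rank_of_exceptional:
  assumes "G \<in> exceptional" "dominant G v"
  shows "rank_of G = large_rank G v"
proof -
  have "dominant G (SOME v. dominant G v)" using assms(2) by (rule someI)
  moreover have simple: "simple G" using assms(1) by (rule exceptionalE)
  ultimately have "similar G (SOME v. dominant G v) v" using assms(2) by (intro dominant_similar)
  thus ?thesis using large_rank_similar[OF simple] assms(1) by (simp only: rank_of_def if_True)
qed

lemma rank_bound_rank_of:
  assumes "G \<in> graphs"
  shows "rank_bound G (rank_of G)"
proof
  show "simple G" using assms by (simp add: graphs_iff)
  show "m \<le> rank_of G" if "2 * m \<le> order G + 5" for m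
  proof (cases "G \<in> exceptional")
    case True
    then obtain v where v: "dominant G v" by (rule exceptionalE)
    \<comment> \<open>The rank of a dominant class is beyond (n + 5) / 2 by definition, hence above
      every such \<open>m\<close>.\<close>
    show ?thesis using rank_of_exceptional[OF True v] v that by (simp add: dominant_def)
  next
    case False
    thus ?thesis using that by (simp add: rank_of_def)
  qed
  show "large_rank G v \<le> rank_of G"
    if "v \<in> pverts G" "order G + 1 < 2 * card (sim_class G v)" "order G + 5 < 2 * large_rank G v" for v
  proof -
    have v: "dominant G v" using that by (simp add: dominant_def)
    hence "G \<in> exceptional" using assms by (auto simp: exceptional_def)
    thus ?thesis using rank_of_exceptional v by simp
  qed
qed

lemma order_pos: "G \<in> graphs \<Longrightarrow> 0 < order G"
  by (auto simp: graphs_iff simple_def card_gt_0_iff)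

lemma defines_rank_of:
  assumes "G \<in> graphs"
  shows "defines_struct (game_fm G (rank_of G)) G"
proof (rule defines_game_fm)
  interpret rank_bound G "rank_of G" using assms by (rule rank_bound_rank_of)
  have G: "finite (pverts G)" "pverts G \<noteq> {}" "G \<in> structures"
    using assms by (auto simp: graphs_iff simple_def structures_iff)
  show "finite (pverts G)" "pverts G \<noteq> {}" by (fact G)+
  show "0 < rank_of G" using K_half[of 1] by simp
  fix B assume B: "B \<in> structures" "survives_alt G B (rank_of G) {}" "survives_alt B G (rank_of G) {}"
  obtain h where "bij_betw h (pverts G) (pverts B)"
    "\<forall>x\<in>pverts G. \<forall>y\<in>pverts G. (x, y) \<in> parcs G \<longleftrightarrow> (h x, h y) \<in> parcs B"
    using survives_imp_isomorphism[of B] B G by (auto simp: structures_iff)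
  thus "isomorphic G B" using isomorphicI[OF G(3) B(1)] by blast
qed

lemma rank_game_fm: "G \<in> graphs \<Longrightarrow> quantifier_rank (game_fm G k) = k"
  by (rule quantifier_rank_game_fm) (auto simp: graphs_iff simple_def)

lemma D_le_rank_of: "G \<in> graphs \<Longrightarrow> D G \<le> rank_of G"
  unfolding D_def using defines_rank_of rank_game_fm by (intro Least_le) blast

lemma D_exceptional:
  assumes "G \<in> exceptional"
  shows "D G = rank_of G"
proof (rule antisym)
  have G: "G \<in> graphs" using assms by (simp add: exceptional_def)
  show "D G \<le> rank_of G" using G by (rule D_le_rank_of)
  obtain v where v: "simple G" "dominant G v" using assms by (rule exceptionalE)
  have "2 \<le> card (sim_class G v)" using v(2) order_pos[OF G] by (simp add: dominant_def)
  hence lower: "large_rank G v \<le> quantifier_rank \<phi>" if "defines_struct \<phi> G" for \<phi>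
    using large_rank_le_quantifier_rank[OF G] v(2) that by (simp add: dominant_def)
  have "\<exists>\<phi>. defines_struct \<phi> G \<and> quantifier_rank \<phi> = D G"
    unfolding D_def by (rule LeastI_ex) (use defines_rank_of[OF G] in blast)
  then obtain \<phi> where "defines_struct \<phi> G" "quantifier_rank \<phi> = D G" by blast
  thus "rank_of G \<le> D G" using lower[of \<phi>] rank_of_exceptional[OF assms v(2)] by simp
qed

section \<open>The programs on the adjacency matrix of a graph\<close>

locale enumerated_graph =
  fixes G :: binstruct and v :: "nat \<Rightarrow> nat"
  assumes G: "G \<in> graphs" and v: "bij_betw v {..<order G} (pverts G)"
begin

abbreviation "m \<equiv> mem (input_state G v)"
abbreviation "n \<equiv> order G"

lemma simple_G: "simple G"
  using G by (simp add: graphs_iff)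

lemma v_in: "x < n \<Longrightarrow> v x \<in> pverts G"
  using v by (auto simp: bij_betw_def)

lemma v_inj: "x < n \<Longrightarrow> y < n \<Longrightarrow> v x = v y \<longleftrightarrow> x = y"
  using v by (auto simp: bij_betw_def dest: inj_onD)

lemma v_surj: "a \<in> pverts G \<Longrightarrow> \<exists>x<n. a = v x"
  using v by (auto simp: bij_betw_def image_iff)

lemma matrix_entry:
  assumes "x < n" "y < n"
  shows "m (x * n + y) = (if (v x, v y) \<in> parcs G then 1 else 0)"
proof -
  have "x * n + y < Suc x * n" using assms(2) by simp
  also have "\<dots> \<le> n * n" using assms(1) by (intro mult_le_mono1) simp
  finally have "x * n + y < n * n" .
  thus ?thesis using assms by (simp add: mem_input_state)
qed

lemma rows_agree_iff:
  assumes "x < n" "y < n"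
  shows "rows_agree m n x y \<longleftrightarrow> similar G (v x) (v y)"
proof -
  have "similar G (v x) (v y) \<longleftrightarrow> (\<forall>j<n. j \<noteq> x \<longrightarrow> j \<noteq> y \<longrightarrow> (v x, v j) \<in> parcs G \<longleftrightarrow> (v y, v j) \<in> parcs G)"
    (is "_ \<longleftrightarrow> ?rows")
  proof
    assume sim: "similar G (v x) (v y)"
    show ?rows using similarD[OF sim v_in] v_inj assms by auto
  next
    assume rows: ?rows
    have "(v x, z) \<in> parcs G \<longleftrightarrow> (v y, z) \<in> parcs G" if z: "z \<in> pverts G - {v x, v y}" for z
    proof -
      obtain j where "j < n" "z = v j" using v_surj z by blast
      thus ?thesis using rows z by auto
    qed
    thus "similar G (v x) (v y)" using v_in assms by (simp add: similar_def)
  qed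
  thus ?thesis using assms by (auto simp: rows_agree_def matrix_entry split: if_splits)
qed

lemma row_equivalence_G: "row_equivalence m n"
proof
  show "0 < n" using G by (rule order_pos)
  show "rows_agree m n y x" if "x < n" "y < n" "rows_agree m n x y" for x y
    using that similar_sym by (simp add: rows_agree_iff)
  show "rows_agree m n x z" if "x < n" "y < n" "z < n" "rows_agree m n x y" "rows_agree m n y z" for x y z
    using that similar_trans[OF simple_G, of "v x" "v y" "v z"] by (simp add: rows_agree_iff)
qed

lemma card_rows_agree:
  assumes "c < n"
  shows "card {j. j < n \<and> rows_agree m n j c} = card (sim_class G (v c))"
proof -
  have "v ` {j. j < n \<and> rows_agree m n j c} = sim_class G (v c)"
  proof (intro equalityI subsetI)
    fix a assume "a \<in> sim_class G (v c)"
    hence a: "similar G (v c) a" "a \<in> pverts G" by (auto simp: sim_class_def similar_def)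
    then obtain x where "x < n" "a = v x" using v_surj by blast
    thus "a \<in> v ` {j. j < n \<and> rows_agree m n j c}" using similar_sym[OF a(1)] assms by (auto simp: rows_agree_iff)
  qed (use assms similar_sym in \<open>auto simp: rows_agree_iff sim_class_def\<close>)
  moreover have "inj_on v {j. j < n \<and> rows_agree m n j c}"
    using v_inj by (auto intro: inj_onI)
  ultimately show ?thesis by (metis card_image)
qed

lemma has_witness_iff:
  assumes "c < n"
  shows "has_witness G (v c) \<longleftrightarrow> (\<exists>i<n. \<exists>j<n. rows_agree m n i c \<and> i \<noteq> c \<and> \<not> rows_agree m n j c \<and>
    (m (c * n + i) = 0 \<longleftrightarrow> m (c * n + j) = 0))"
proof
  assume "has_witness G (v c)"
  then obtain u w where uw: "similar G (v c) u" "u \<noteq> v c" "w \<in> pverts G" "\<not> similar G (v c) w"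
    "(v c, w) \<in> parcs G \<longleftrightarrow> (v c, u) \<in> parcs G" by (auto simp: has_witness_def)
  have "u \<in> pverts G" using uw(1) by (simp add: similar_def)
  then obtain i where i: "i < n" "u = v i" using v_surj by blast
  obtain j where j: "j < n" "w = v j" using v_surj[OF uw(3)] by blast
  show "\<exists>i<n. \<exists>j<n. rows_agree m n i c \<and> i \<noteq> c \<and> \<not> rows_agree m n j c \<and>
      (m (c * n + i) = 0 \<longleftrightarrow> m (c * n + j) = 0)"
    using uw i j assms similar_sym[of G "v c"] similar_sym[of G _ "v c"]
    by (intro exI[of _ i] exI[of _ j] conjI) (auto simp: rows_agree_iff matrix_entry)
next
  assume "\<exists>i<n. \<exists>j<n. rows_agree m n i c \<and> i \<noteq> c \<and> \<not> rows_agree m n j c \<and>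
    (m (c * n + i) = 0 \<longleftrightarrow> m (c * n + j) = 0)"
  thus "has_witness G (v c)"
  proof (elim exE conjE)
    fix i j
    assume ij: "i < n" "j < n" "rows_agree m n i c" "i \<noteq> c" "\<not> rows_agree m n j c"
      "m (c * n + i) = 0 \<longleftrightarrow> m (c * n + j) = 0"
    have "similar G (v c) (v i)" "\<not> similar G (v c) (v j)"
      using ij assms similar_sym[of G "v c"] similar_sym[of G _ "v c"] by (auto simp: rows_agree_iff)
    moreover have "(v c, v j) \<in> parcs G \<longleftrightarrow> (v c, v i) \<in> parcs G"
      using ij assms by (auto simp: matrix_entry split: if_splits)
    ultimately show "has_witness G (v c)"
      using ij(1,2,4) assms v_in v_inj unfolding has_witness_def by blast
  qed
qed

text \<open>Without a dominant class the vote may return any row. Testing the class of that row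
  still decides the question, because dominance depends only on the class and a dominant class
  always wins the vote.\<close>

lemma analyse_graph:
  assumes "\<rho> 0 = n" "\<rho> 1 = 1" "\<rho> 3 = 0"
  obtains c where "c < n" "(\<exists>a. dominant G a) \<longleftrightarrow> dominant G (v c)"
    "sem analyse m \<rho> 16 = card (sim_class G (v c))"
    "sem analyse m \<rho> 15 = 2 * card (sim_class G (v c))"
    "sem analyse m \<rho> 22 \<noteq> 0 \<longleftrightarrow> has_witness G (v c)"
proof -
  interpret row_equivalence m n by (rule row_equivalence_G)
  obtain c where c: "c < n" "\<And>x. x < n \<Longrightarrow> n < 2 * card {j. j < n \<and> R j x} \<Longrightarrow> R c x"
    "sem analyse m \<rho> 16 = card {j. j < n \<and> R j c}"
    "sem analyse m \<rho> 15 = 2 * card {j. j < n \<and> R j c}"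
    "sem analyse m \<rho> 22 \<noteq> 0 \<longleftrightarrow> (\<exists>i<n. \<exists>j<n. R i c \<and> i \<noteq> c \<and> \<not> R j c \<and> (m (c * n + i) = 0 \<longleftrightarrow> m (c * n + j) = 0))"
    using sem_analyse[OF assms] by blast
  have "dominant G (v c)" if a: "dominant G a" for a
  proof -
    obtain x where x: "x < n" "a = v x" using a v_surj by (auto simp: dominant_def)
    have "n < 2 * card {j. j < n \<and> R j x}" using a x card_rows_agree by (simp add: dominant_def)
    hence "R c x" by (rule c(2)[OF x(1)])
    hence "similar G a (v c)" using rows_agree_iff[OF c(1) x(1)] x(2) similar_sym by simp
    thus ?thesis using dominant_transfer[OF simple_G a] by blast
  qed
  hence dom: "(\<exists>a. dominant G a) \<longleftrightarrow> dominant G (v c)" by blast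
  show thesis
    using c(3-5) unfolding card_rows_agree[OF c(1)] has_witness_iff[OF c(1), symmetric]
    by (rule that[OF c(1) dom])
qed

lemma recognize_correct:
  "n + 1 - sem recognize m ((reg (input_state G v))(1 := 1)) 24 = (if G \<in> exceptional then 1 else 0)"
proof -
  let ?\<rho> = "(reg (input_state G v))(1 := 1)"
  have \<rho>: "?\<rho> 0 = n" "?\<rho> 1 = 1" "?\<rho> 3 = 0" by (simp_all add: reg_input_state)
  obtain c where c: "c < n" "(\<exists>a. dominant G a) \<longleftrightarrow> dominant G (v c)"
    "sem analyse m ?\<rho> 15 = 2 * card (sim_class G (v c))"
    "sem analyse m ?\<rho> 22 \<noteq> 0 \<longleftrightarrow> has_witness G (v c)"
    using analyse_graph[OF \<rho>] by metis
  have "G \<in> exceptional \<longleftrightarrow> dominant G (v c)" using G c(2) by (simp add: exceptional_def)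
  also have "\<dots> \<longleftrightarrow> n + (if has_witness G (v c) then 1 else 3) < 2 * card (sim_class G (v c))"
    using v_in[OF c(1)] by (simp only: dominant_iff simp_thms)
  finally show ?thesis unfolding sem_recognize[OF \<rho>] c(3,4) by simp
qed

lemma evaluate_correct:
  assumes "G \<in> exceptional"
  shows "n + 1 - sem evaluate m ((reg (input_state G v))(1 := 1)) 24 = D G"
proof -
  let ?\<rho> = "(reg (input_state G v))(1 := 1)"
  have \<rho>: "?\<rho> 0 = n" "?\<rho> 1 = 1" "?\<rho> 3 = 0" by (simp_all add: reg_input_state)
  obtain c where c: "c < n" "(\<exists>a. dominant G a) \<longleftrightarrow> dominant G (v c)"
    "sem analyse m ?\<rho> 16 = card (sim_class G (v c))"
    "sem analyse m ?\<rho> 22 \<noteq> 0 \<longleftrightarrow> has_witness G (v c)"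
    using analyse_graph[OF \<rho>] by metis
  have "dominant G (v c)" using assms c(2) by (auto simp: exceptional_def)
  hence D: "D G = large_rank G (v c)" using D_exceptional rank_of_exceptional assms by simp
  have fin: "finite (pverts G)" using simple_G by (simp add: simple_def)
  \<comment> \<open>The result is returned as a truncated difference from n + 1, so it must not
    exceed n + 1. When the rank is class size plus 2, the witness is a vertex outside the
    class.\<close>
  have "large_rank G (v c) \<le> n + 1"
  proof (cases "has_witness G (v c)")
    case True
    then obtain w where "w \<in> pverts G" "w \<notin> sim_class G (v c)"
      by (auto simp: has_witness_def sim_class_def)
    hence "sim_class G (v c) \<subset> pverts G" using sim_class_subset[of G "v c"] by blast
    hence "card (sim_class G (v c)) < n" using fin by (intro psubset_card_mono)
    thus ?thesis by (simp add: large_rank_def)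
  next
    case False
    thus ?thesis using card_mono[OF fin sim_class_subset, of "v c"] by (simp add: large_rank_def)
  qed
  thus ?thesis unfolding sem_evaluate[OF \<rho>] c(3,4) D by (simp add: large_rank_def)
qed

end

theorem theorem1p2:
  shows "\<exists>C :: binstruct set.
    efficiently_recognizable C \<and>
    (\<forall>G\<in>graphs. real (D G) \<le> (real (order G) + 5) / 2 \<longleftrightarrow> G \<notin> C) \<and>
    efficiently_computable_on C D \<and>
    (\<forall>G\<in>graphs. \<exists>\<phi>.
       defines_struct \<phi> G \<and>
       alternation_number \<phi> = 1 \<and>
       (G \<in> C \<longrightarrow> quantifier_rank \<phi> = D G) \<and>
       (G \<notin> C \<longrightarrow> real (quantifier_rank \<phi>) \<le> (real (order G) + 5) / 2))"
proof (intro exI[of _ exceptional] conjI ballI)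
  show "efficiently_recognizable exceptional"
    unfolding efficiently_recognizable_def
  proof
    show "exceptional \<subseteq> graphs" by (auto simp: exceptional_def)
    show "efficiently_computable_on graphs (\<lambda>G. if G \<in> exceptional then 1 else 0)"
      using wf_recognize cost_recognize
        enumerated_graph.recognize_correct[OF enumerated_graph.intro]
      by (intro efficiently_computable_onI[of recognize 24 500]) auto
  qed
  show "efficiently_computable_on exceptional D"
    using wf_evaluate cost_evaluate
      enumerated_graph.evaluate_correct[OF enumerated_graph.intro]
    by (intro efficiently_computable_onI[of evaluate 24 500]) (auto simp: exceptional_def)
next
  fix G assume G: "G \<in> graphs"
  have half: "real (rank_of G) \<le> (real (order G) + 5) / 2" if "G \<notin> exceptional"
  proof -
    have "2 * rank_of G \<le> order G + 5" using that by (simp add: rank_of_def)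
    hence "real (2 * rank_of G) \<le> real (order G + 5)" by (simp only: of_nat_le_iff)
    thus ?thesis by simp
  qed
  show "real (D G) \<le> (real (order G) + 5) / 2 \<longleftrightarrow> G \<notin> exceptional"
  proof
    assume le: "real (D G) \<le> (real (order G) + 5) / 2"
    show "G \<notin> exceptional"
    proof
      assume ex: "G \<in> exceptional"
      then obtain v where v: "dominant G v" by (rule exceptionalE)
      hence "order G + 5 < 2 * D G" using D_exceptional[OF ex] rank_of_exceptional[OF ex v] by (simp add: dominant_def)
      thus False using le by simp
    qed
  next
    assume "G \<notin> exceptional"
    thus "real (D G) \<le> (real (order G) + 5) / 2" using half D_le_rank_of[OF G] by linarith
  qed
  interpret rank_bound G "rank_of G" using G by (rule rank_bound_rank_of)
  \<comment> \<open>At least two rounds are available, which makes the alternation number exactly 1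
    even for the smallest graphs.\<close>
  have "2 \<le> rank_of G" using order_pos[OF G] by (intro K_half) simp
  hence "alternation_number (game_fm G (rank_of G)) = 1"
    using G by (intro alternation_number_game_fm) (auto simp: graphs_iff simple_def)
  thus "\<exists>\<phi>. defines_struct \<phi> G \<and> alternation_number \<phi> = 1 \<and>
       (G \<in> exceptional \<longrightarrow> quantifier_rank \<phi> = D G) \<and>
       (G \<notin> exceptional \<longrightarrow> real (quantifier_rank \<phi>) \<le> (real (order G) + 5) / 2)"
    using defines_rank_of[OF G] rank_game_fm[OF G] D_exceptional half by (intro exI[of _ "game_fm G (rank_of G)"]) simp
qed

end
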